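(* Let $Z$ be a JBW*-triple and let $\delta: Z\to Z$ be a continuous local triple derivation. Then $\delta$ is a triple derivation.
   Context: A triple product on a complex vector space $Z$ is a real tri-linear map $(x,y,z)\mapsto\{x,y,z\}$, $Z^3\to Z$, which is complex linear in $x$ and $z$, complex anti-linear in $y$, and symmetric in the outer variables ($\{x,y,z\}=\{z,y,x\}$). A Jordan triple is a complex vector space with a triple product satisfying the Jordan triple identity $$\{a,b,\{x,y,z\}\}=\{\{a,b,x\},y,z\}-\{x,\{b,a,y\},z\}+\{x,y,\{a,b,z\}\}.$$ For $a,b\in Z$ write $D(a,b)$ for the linear operator $x\mapsto\{a,b,x\}$. A JB*-triple is a complex Banach space $Z$ which is also a Jordan triple, such that the triple product is jointly continuous and for every $x\in Z$: (i) the spectrum of $D(x,x)$ is contained in $[0,\infty)$; (ii) $\exp(iD(x,x))$ is a triple automorphism and a surjective linear isometry; (iii) $\|D(x,x)(x)\|=\|x\|^3$. A triple automorphism is a bijective linear map $T$ with $T\{x,y,z\}=\{Tx,Ty,Tz\}$ for all $x,y,z$. A JBW*-triple is a JB*-triple which has a (necessarily unique) Banach space predual. A triple derivation on a Jordan triple $Z$ is a (complex) linear map $d:Z\to Z$ with $d\{x,y,z\}=\{dx,y,z\}+\{x,dy,z\}+\{x,y,dz\}$ for all $x,y,z\in Z$. A local triple derivation on $Z$ is a (complex) linear map $\delta:Z\to Z$ such that for every $x\in Z$ there exists a triple derivation $\delta_x$ on $Z$ with $\delta_x(x)=\delta(x)$. Continuity is with respect to the norm. *)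

theory Defs
  imports "HOL-Analysis.Analysis"
begin

section \<open>Complex vector spaces and complex Banach spaces\<close>

text \<open>The norm, the topology and the underlying real scalar multiplication are those of the
  library classes; complex scalar multiplication is required to extend the real one.\<close>

class complex_vector = real_vector +
  fixes scaleC :: "complex \<Rightarrow> 'a \<Rightarrow> 'a"  (infixr \<open>*\<^sub>C\<close> 75)
  assumes scaleC_add_right: "a *\<^sub>C (x + y) = a *\<^sub>C x + a *\<^sub>C y"
    and scaleC_add_left: "(a + b) *\<^sub>C x = a *\<^sub>C x + b *\<^sub>C x"
    and scaleC_scaleC: "a *\<^sub>C (b *\<^sub>C x) = (a * b) *\<^sub>C x"
    and scaleC_one: "1 *\<^sub>C x = x"
    and scaleC_of_real: "complex_of_real r *\<^sub>C x = r *\<^sub>R x"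

class complex_banach = complex_vector + banach +
  assumes norm_scaleC: "norm (a *\<^sub>C x) = cmod a * norm x"

lemma vector_space_scaleC: "vector_space (scaleC :: complex \<Rightarrow> 'a \<Rightarrow> 'a::complex_vector)"
  by standard (simp_all add: scaleC_add_right scaleC_add_left scaleC_scaleC scaleC_one)

abbreviation clinear :: "('a::complex_vector \<Rightarrow> 'b::complex_vector) \<Rightarrow> bool"
  where "clinear \<equiv> Vector_Spaces.linear scaleC scaleC"

definition antilinear :: "('a::complex_vector \<Rightarrow> 'b::complex_vector) \<Rightarrow> bool"
  where "antilinear f \<longleftrightarrow>
    (\<forall>x y. f (x + y) = f x + f y) \<and> (\<forall>c x. f (c *\<^sub>C x) = cnj c *\<^sub>C f x)"


section \<open>Operators on a complex Banach space\<close>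

text \<open>The spectrum relative to the algebra of bounded complex linear operators.\<close>

definition op_spectrum :: "('a::complex_banach \<Rightarrow> 'a) \<Rightarrow> complex set"
  where "op_spectrum T =
    {c. \<not> (\<exists>S. clinear S \<and> bounded_linear S \<and>
            (\<forall>x. S (T x - c *\<^sub>C x) = x) \<and> (\<forall>x. T (S x) - c *\<^sub>C S x = x))}"

text \<open>The exponential series evaluated at a point. It is used only for bounded operators \<open>T\<close>,
  where the series converges absolutely in operator norm, so that the pointwise sum is the value
  of the operator exponential.\<close>

definition op_exp :: "('a::complex_banach \<Rightarrow> 'a) \<Rightarrow> 'a \<Rightarrow> 'a"
  where "op_exp T x = (\<Sum>n. (T ^^ n) x /\<^sub>R fact n)"

definition surj_linear_isometry :: "('a::complex_banach \<Rightarrow> 'a) \<Rightarrow> bool"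
  where "surj_linear_isometry T \<longleftrightarrow> clinear T \<and> surj T \<and> (\<forall>x. norm (T x) = norm x)"


section \<open>Jordan triples\<close>

locale jordan_triple =
  fixes tp :: "'z::complex_vector \<Rightarrow> 'z \<Rightarrow> 'z \<Rightarrow> 'z"
  assumes linear_left: "clinear (\<lambda>x. tp x y z)"
    and antilinear_middle: "antilinear (\<lambda>y. tp x y z)"
    and linear_right: "clinear (\<lambda>z. tp x y z)"
    and outer_symmetric: "tp x y z = tp z y x"
    and jordan_identity:
      "tp a b (tp x y z) = tp (tp a b x) y z - tp x (tp b a y) z + tp x y (tp a b z)"

definition triple_automorphism ::
    "('z::complex_vector \<Rightarrow> 'z \<Rightarrow> 'z \<Rightarrow> 'z) \<Rightarrow> ('z \<Rightarrow> 'z) \<Rightarrow> bool"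
  where "triple_automorphism tp T \<longleftrightarrow>
    clinear T \<and> bij T \<and> (\<forall>x y z. T (tp x y z) = tp (T x) (T y) (T z))"

definition triple_derivation ::
    "('z::complex_vector \<Rightarrow> 'z \<Rightarrow> 'z \<Rightarrow> 'z) \<Rightarrow> ('z \<Rightarrow> 'z) \<Rightarrow> bool"
  where "triple_derivation tp d \<longleftrightarrow>
    clinear d \<and> (\<forall>x y z. d (tp x y z) = tp (d x) y z + tp x (d y) z + tp x y (d z))"

definition local_triple_derivation ::
    "('z::complex_vector \<Rightarrow> 'z \<Rightarrow> 'z \<Rightarrow> 'z) \<Rightarrow> ('z \<Rightarrow> 'z) \<Rightarrow> bool"
  where "local_triple_derivation tp \<delta> \<longleftrightarrow>
    clinear \<delta> \<and> (\<forall>x. \<exists>d. triple_derivation tp d \<and> d x = \<delta> x)"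


section \<open>JB*-triples and JBW*-triples\<close>

locale jb_triple = jordan_triple tp
  for tp :: "'z::complex_banach \<Rightarrow> 'z \<Rightarrow> 'z \<Rightarrow> 'z" +
  fixes D :: "'z \<Rightarrow> 'z \<Rightarrow> 'z \<Rightarrow> 'z"
  defines D_def: "D a b x \<equiv> tp a b x"
  assumes jointly_continuous: "continuous_on UNIV (\<lambda>(x, y, z). tp x y z)"
    and spectrum_nonneg: "op_spectrum (D x x) \<subseteq> complex_of_real ` {0..}"
    and exp_automorphism: "triple_automorphism tp (op_exp (\<lambda>z. \<i> *\<^sub>C D x x z))"
    and exp_isometry: "surj_linear_isometry (op_exp (\<lambda>z. \<i> *\<^sub>C D x x z))"
    and norm_cube: "norm (D x x x) = norm x ^ 3"

definition cdual :: "('x::complex_banach \<Rightarrow> complex) set"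
  where "cdual = {f. Vector_Spaces.linear scaleC (*) f \<and> bounded_linear f}"

text \<open>\<open>isometric_iso_dual \<Phi>\<close>: the map \<open>\<Phi>\<close> is an isometric complex linear isomorphism of \<open>'z\<close> onto
  the dual of \<open>'x\<close>, the latter carrying pointwise operations and the operator norm.\<close>

definition isometric_iso_dual :: "('z::complex_banach \<Rightarrow> 'x::complex_banach \<Rightarrow> complex) \<Rightarrow> bool"
  where "isometric_iso_dual \<Phi> \<longleftrightarrow>
    bij_betw \<Phi> UNIV cdual \<and>
    (\<forall>z w. \<Phi> (z + w) = (\<lambda>\<xi>. \<Phi> z \<xi> + \<Phi> w \<xi>)) \<and>
    (\<forall>c z. \<Phi> (c *\<^sub>C z) = (\<lambda>\<xi>. c * \<Phi> z \<xi>)) \<and>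
    (\<forall>z. onorm (\<Phi> z) = norm z)"

text \<open>HOL cannot quantify existentially over the predual, which is a type here. It is therefore a
  type parameter \<open>'x\<close>; a theorem that assumes \<open>jbw_triple tp TYPE('x)\<close> holds for every \<open>'x\<close>, that
  is, whenever there is some Banach space predual.\<close>

definition jbw_triple ::
    "('z::complex_banach \<Rightarrow> 'z \<Rightarrow> 'z \<Rightarrow> 'z) \<Rightarrow> 'x::complex_banach itself \<Rightarrow> bool"
  where "jbw_triple tp _ \<longleftrightarrow>
    jb_triple tp \<and> (\<exists>\<Phi> :: 'z \<Rightarrow> 'x \<Rightarrow> complex. isometric_iso_dual \<Phi>)"

end

theory Submission
  imports Defs "HOL-Computational_Algebra.Fundamental_Theorem_Algebra"
begin

text \<open>
  Write \<open>T a b c = {\<delta> a,b,c} + {a,\<delta> b,c} + {a,b,\<delta> c} - \<delta>{a,b,c}\<close>. By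
  polarization it suffices that \<open>T x x x = 0\<close> for every \<open>x\<close>. The odd powers of \<open>x\<close> and a spectral
  radius estimate for \<open>D x x\<close> give a continuous functional calculus \<open>f \<mapsto> f(x)\<close> on the spectrum, in
  which cut-off functions replace tripotents. If \<open>e\<close> is unitary on the part \<open>t \<ge> \<eta>\<close> of the spectrum,
  then \<open>\<delta> e = d e\<close> for a derivation \<open>d\<close> shows that \<open>T e e e\<close> has no Peirce-2 component there;
  differentiating along \<open>e exp(i \<rho> \<phi>)\<close> extends this to \<open>T f g h\<close> for all functions \<open>f, g, h\<close>
  supported in that part. For the remaining Peirce components of \<open>\<delta>\<close>, orthogonality of elements
  with disjoint supports yields a bounded bilinear map on continuous functions that vanishes on
  pairs with product zero; such a map depends only on the product of its arguments, which makes these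
  components of \<open>T f f f\<close> vanish as well. Finally \<open>f(x)\<close> tends to \<open>x\<close> as \<open>\<eta>\<close> tends to \<open>0\<close>.
\<close>

text \<open>Cut-offs are needed because the closed subtriple generated by one element may contain no
  nonzero tripotent, and the obstacle is that \<delta> is controlled at single elements only: a
  derivation that agrees with \<delta> at \<open>a\<close> says nothing about \<delta> at
  \<open>{a,a,a}\<close>. Two facts survive. If \<open>w\<close> is orthogonal to \<open>f\<close>
  and \<open>g\<close>, then \<open>{f, \<delta> w, g} = 0\<close>, so the part of an element below
  the cut-off does not disturb the Peirce-2 part above it. And \<delta> at a cube of
  \<open>k\<close> is \<open>2 D(k,k) w + Q(k) w\<close> for some unknown \<open>w\<close>, hence
  tied to the support of \<open>k\<close>.

  The element \<open>fc f\<close> is the odd function s -> s f(s^2) evaluated at \<open>x\<close>,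
  with t = s^2. Every triple product therefore carries one factor t, and unitary means t |e(t)|^2 =
  1. A guide to the operator identities is the finite case x = sum of s_i e_i with orthogonal
  tripotents e_i: with t_i = s_i^2 and t_0 = 0, \<open>Lo f\<close> acts on the Peirce space (i,j)
  as half the sum of t_i f(t_i) and t_j f(t_j).\<close>

interpretation scaleC: vector_space "scaleC :: complex \<Rightarrow> 'a \<Rightarrow> 'a::complex_vector"
  by (rule vector_space_scaleC)

lemma clinear_iff:
  "clinear f \<longleftrightarrow> (\<forall>x y. f (x + y) = f x + f y) \<and> (\<forall>c x. f (c *\<^sub>C x) = c *\<^sub>C f x)"
proof
  assume "clinear f"
  then interpret Vector_Spaces.linear scaleC scaleC f .
  show "(\<forall>x y. f (x + y) = f x + f y) \<and> (\<forall>c x. f (c *\<^sub>C x) = c *\<^sub>C f x)"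
    by (simp add: add scale)
next
  assume "(\<forall>x y. f (x + y) = f x + f y) \<and> (\<forall>c x. f (c *\<^sub>C x) = c *\<^sub>C f x)"
  then show "clinear f"
    by unfold_locales auto
qed

lemma clinear_add: "clinear f \<Longrightarrow> f (x + y) = f x + f y"
  and clinear_scaleC: "clinear f \<Longrightarrow> f (c *\<^sub>C x) = c *\<^sub>C f x"
  by (simp_all add: clinear_iff)

lemma clinear_zero: "clinear f \<Longrightarrow> f 0 = 0"
  using clinear_scaleC[of f 0 0] by simp

lemma clinear_minus: "clinear f \<Longrightarrow> f (- x) = - f x"
  using clinear_scaleC[of f "-1" x] by simp

lemma clinear_diff: "clinear f \<Longrightarrow> f (x - y) = f x - f y"
  using clinear_add[of f x "-y"] by (simp add: clinear_minus)

lemma clinear_sum: "clinear f \<Longrightarrow> f (sum g I) = (\<Sum>i\<in>I. f (g i))"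
  by (induction I rule: infinite_finite_induct) (simp_all add: clinear_zero clinear_add)

lemma clinear_scaleR: "clinear f \<Longrightarrow> f (r *\<^sub>R x) = r *\<^sub>R f x"
  using clinear_scaleC[of f "of_real r" x] by (simp add: scaleC_of_real)

lemmas clinear_simps = clinear_add clinear_scaleC clinear_zero clinear_minus clinear_diff

lemma clinear_compose: "clinear f \<Longrightarrow> clinear g \<Longrightarrow> clinear (\<lambda>x. f (g x))"
  by (simp add: clinear_iff)

lemma bounded_linear_of_clinear:
  assumes "clinear f" and "\<And>x. norm (f x) \<le> C * norm x"
  shows "bounded_linear f"
  using assms by (intro bounded_linear_intro[where K = C])
    (simp_all add: clinear_add clinear_scaleR mult.commute)

lemma bounded_linear_scaleC: "bounded_linear (\<lambda>x. c *\<^sub>C (x :: 'a :: complex_banach))"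
  by (intro bounded_linear_of_clinear[where C = "cmod c"])
    (simp_all add: clinear_iff scaleC_add_right norm_scaleC mult.commute scaleC_scaleC)

lemma tendsto_scaleC:
  "(f \<longlongrightarrow> l) F \<Longrightarrow> ((\<lambda>n. c *\<^sub>C (f n :: 'a :: complex_banach)) \<longlongrightarrow> c *\<^sub>C l) F"
  by (rule bounded_linear.tendsto[OF bounded_linear_scaleC])

section \<open>Invertible operators and the spectral radius\<close>

definition invertible_op :: "('a::complex_banach \<Rightarrow> 'a) \<Rightarrow> bool"
  where "invertible_op T \<longleftrightarrow>
    (\<exists>S. clinear S \<and> bounded_linear S \<and> (\<forall>x. S (T x) = x) \<and> (\<forall>x. T (S x) = x))"

lemma not_in_op_spectrum_iff: "c \<notin> op_spectrum T \<longleftrightarrow> invertible_op (\<lambda>x. T x - c *\<^sub>C x)"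
  unfolding op_spectrum_def invertible_op_def by blast

lemma invertible_op_compose:
  assumes "invertible_op f" "invertible_op g"
  shows "invertible_op (\<lambda>x. f (g x))"
proof -
  obtain S where "clinear S" "bounded_linear S" "\<And>x. S (f x) = x" "\<And>x. f (S x) = x"
    using assms(1) unfolding invertible_op_def by auto
  moreover obtain S' where "clinear S'" "bounded_linear S'" "\<And>x. S' (g x) = x" "\<And>x. g (S' x) = x"
    using assms(2) unfolding invertible_op_def by auto
  ultimately show ?thesis
    unfolding invertible_op_def
    using clinear_compose[of S' S] bounded_linear_compose[of S' S]
    by (intro exI[of _ "\<lambda>x. S' (S x)"]) simp
qed

lemma invertible_op_scaleC: "c \<noteq> 0 \<Longrightarrow> invertible_op (\<lambda>x :: 'a :: complex_banach. c *\<^sub>C x)"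
  unfolding invertible_op_def
  by (intro exI[of _ "\<lambda>x. inverse c *\<^sub>C x"])
    (simp add: scaleC_scaleC scaleC_one bounded_linear_scaleC clinear_iff scaleC_add_right mult.commute)

text \<open>Banach's fixed point theorem takes the place of the Neumann series: S y is the unique
  fixed point of x -> y + A x. Linearity and the left inverse law follow from uniqueness.\<close>

lemma invertible_op_id_minus:
  assumes A: "clinear A" and q: "\<And>x. norm (A x) \<le> q * norm x" and "0 \<le> q" "q < 1"
  shows "invertible_op (\<lambda>x. x - A (x :: 'a :: complex_banach))"
proof -
  have ex: "\<exists>!x. y + A x = x" for y
  proof -
    have "dist (y + A a) (y + A b) \<le> q * dist a b" for a b
      using q[of "a - b"] by (simp add: dist_norm clinear_diff[OF A])
    then show ?thesis
      using banach_fix_type[of q "\<lambda>x. y + A x"] assms(3,4) by auto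
  qed
  then obtain S where S: "\<And>y. y + A (S y) = S y" and uniq: "\<And>x y. y + A x = x \<Longrightarrow> x = S y"
    by metis
  have S_eq: "S y - A (S y) = y" for y
    using S[of y] by (simp add: diff_eq_eq)
  have lin: "clinear S"
    unfolding clinear_iff
  proof (intro conjI allI)
    show "S (x + y) = S x + S y" for x y
    proof (rule uniq[symmetric])
      have "x + y + A (S x + S y) = (x + A (S x)) + (y + A (S y))"
        by (simp add: clinear_add[OF A])
      then show "x + y + A (S x + S y) = S x + S y" by (simp only: S)
    qed
    show "S (c *\<^sub>C x) = c *\<^sub>C S x" for c x
    proof (rule uniq[symmetric])
      have "c *\<^sub>C x + A (c *\<^sub>C S x) = c *\<^sub>C (x + A (S x))"
        by (simp add: clinear_scaleC[OF A] scaleC_add_right)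
      then show "c *\<^sub>C x + A (c *\<^sub>C S x) = c *\<^sub>C S x" by (simp only: S)
    qed
  qed
  have "norm (S y) \<le> (1 / (1 - q)) * norm y" for y
  proof -
    have "norm (S y) \<le> norm y + q * norm (S y)"
      using norm_triangle_ineq[of y "A (S y)"] q[of "S y"] S[of y] by simp
    then have "(1 - q) * norm (S y) \<le> norm y" by (simp add: algebra_simps)
    then show ?thesis using \<open>q < 1\<close> by (simp add: field_simps)
  qed
  then have "bounded_linear S" by (rule bounded_linear_of_clinear[OF lin])
  moreover have "S (x - A x) = x" for x
    by (rule uniq[symmetric]) simp
  ultimately show ?thesis
    unfolding invertible_op_def using lin S_eq by blast
qed

lemma op_spectrum_bounded:
  assumes A: "clinear A" and K: "\<And>x. norm (A x) \<le> K * norm x" and "0 \<le> K" "K < cmod c"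
  shows "c \<notin> op_spectrum (A :: 'a :: complex_banach \<Rightarrow> 'a)"
proof -
  have c: "c \<noteq> 0" using assms(3,4) by auto
  have "invertible_op (\<lambda>x. x - inverse c *\<^sub>C A x)"
  proof (rule invertible_op_id_minus[where q = "K / cmod c"])
    show "clinear (\<lambda>x. inverse c *\<^sub>C A x)"
      using A by (simp add: clinear_iff scaleC_add_right scaleC_scaleC mult.commute)
    show "norm (inverse c *\<^sub>C A x) \<le> K / cmod c * norm x" for x
      using K[of x] c by (simp add: norm_scaleC norm_inverse norm_divide field_simps)
  qed (use assms c in \<open>auto simp: field_simps\<close>)
  from invertible_op_compose[OF invertible_op_scaleC[of "-c"] this] c
  have "invertible_op (\<lambda>x. - (c *\<^sub>C (x - inverse c *\<^sub>C A x)))" by simp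
  also have "(\<lambda>x. - (c *\<^sub>C (x - inverse c *\<^sub>C A x))) = (\<lambda>x. A x - c *\<^sub>C x)"
    using c by (simp add: scaleC.scale_right_diff_distrib scaleC_scaleC scaleC_one)
  finally show ?thesis by (simp add: not_in_op_spectrum_iff)
qed

section \<open>Power bounds for an operator with spectrum in the open unit disc\<close>

lemma clinear_funpow:
  fixes T :: "'a::complex_vector \<Rightarrow> 'a"
  assumes "clinear T" shows "clinear (T ^^ n)"
proof (induction n)
  case (Suc n)
  then show ?case using clinear_compose[OF assms Suc] by (simp add: comp_def)
qed (simp add: clinear_iff)

text \<open>The root of unity w^k differs from 1 because k/n is not an integer. In the average of
  the resolvent these vanishing sums remove every power of the operator strictly between 0 and
  n.\<close>

lemma sum_roots_of_unity_power:
  assumes "0 < k" "k < n"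
  shows "(\<Sum>j<n. (cis (2 * pi / real n) ^ j) ^ k) = (0 :: complex)"
proof -
  let ?w = "cis (2 * pi / real n)"
  have n: "real n > 0" using assms by simp
  have wk: "?w ^ k \<noteq> 1"
  proof
    assume "?w ^ k = 1"
    then have "Re (?w ^ k) = 1" by simp
    then have "cos (2 * pi * (real k / real n)) = 1"
      by (simp add: Complex.DeMoivre algebra_simps)
    then obtain m :: int where m: "2 * pi * (real k / real n) = real_of_int m * 2 * pi"
      by (auto simp: cos_one_2pi_int)
    have "(2 * pi) * (real k / real n) = (2 * pi) * real_of_int m" using m by (simp only: ac_simps)
    then have "real k / real n = real_of_int m" by (simp only: mult_cancel_left) simp
    moreover have "0 < real k / real n" "real k / real n < 1" using assms by simp_all
    ultimately show False by auto
  qed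
  have "?w ^ n = 1"
    using n by (simp add: Complex.DeMoivre)
  moreover have "(?w ^ k) ^ n = (?w ^ n) ^ k"
    by (simp only: power_mult[symmetric] mult.commute)
  ultimately have "(?w ^ k) ^ n = 1" by simp
  moreover have "(\<Sum>j<n. (?w ^ k) ^ j) = ((?w ^ k) ^ n - 1) / (?w ^ k - 1)"
    using geometric_sum[OF wk] .
  moreover have "(?w ^ j) ^ k = (?w ^ k) ^ j" for j
    by (simp only: power_mult[symmetric] mult.commute)
  ultimately show ?thesis by simp
qed

text \<open>\<open>R l\<close> inverts 1 - l T on the closed unit disc, so the spectrum of
  \<open>T\<close> lies in the open one. This is the setting for a spectral radius estimate by
  elementary means, without contour integrals.\<close>

locale disc_resolvent =
  fixes T :: "'a::complex_banach \<Rightarrow> 'a" and R :: "complex \<Rightarrow> 'a \<Rightarrow> 'a" and K :: real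
  assumes T: "clinear T" and K: "norm (T x) \<le> K * norm x" and K0: "0 \<le> K"
    and R_lin: "cmod l \<le> 1 \<Longrightarrow> clinear (R l)"
    and R_bdd: "cmod l \<le> 1 \<Longrightarrow> \<exists>C\<ge>0. \<forall>x. norm (R l x) \<le> C * norm x"
    and R_left: "cmod l \<le> 1 \<Longrightarrow> R l (x - l *\<^sub>C T x) = x"
    and R_right: "cmod l \<le> 1 \<Longrightarrow> R l x - l *\<^sub>C T (R l x) = x"
begin

lemma R_commute:
  assumes l: "cmod l \<le> 1" shows "R l (T x) = T (R l x)"
proof -
  have "R l x - l *\<^sub>C T (R l x) = x" using R_right[OF l] .
  then have "T x = T (R l x) - l *\<^sub>C T (T (R l x))"
    using clinear_diff[OF T] clinear_scaleC[OF T] by metis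
  then show ?thesis using R_left[OF l, of "T (R l x)"] by simp
qed

lemma resolvent_identity:
  assumes "cmod l \<le> 1" "cmod m \<le> 1"
  shows "R l x - R m x = (l - m) *\<^sub>C R l (T (R m x))"
proof -
  let ?y = "R m x"
  have "R l x = R l ((?y - l *\<^sub>C T ?y) + (l - m) *\<^sub>C T ?y)"
    using R_right[OF assms(2), of x] by (simp add: scaleC.scale_left_diff_distrib)
  also have "\<dots> = ?y + (l - m) *\<^sub>C R l (T ?y)"
    by (simp add: clinear_simps[OF R_lin[OF assms(1)]] R_left[OF assms(1)] del: clinear_diff
        flip: clinear_diff[OF R_lin[OF assms(1)]] clinear_scaleC[OF R_lin[OF assms(1)]])
  finally show ?thesis by simp
qed

text \<open>By compactness of the disc local bounds suffice. Close to m, the resolvent identity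
  bounds \<open>R m x - R l x\<close> by half the norm of \<open>R l x\<close>, which can be
  absorbed.\<close>

lemma resolvent_bounded: "\<exists>C\<ge>0. \<forall>l x. cmod l \<le> 1 \<longrightarrow> norm (R l x) \<le> C * norm x"
proof -
  obtain c where c: "\<And>l. cmod l \<le> 1 \<Longrightarrow> 0 \<le> c l"
      "\<And>l x. cmod l \<le> 1 \<Longrightarrow> norm (R l x) \<le> c l * norm x"
    using R_bdd by metis
  \<comment> \<open>The radius makes |m - l| c(m) K at most 1/2; the summand 1 keeps the denominator
    positive.\<close>
  define d where "d m = 1 / (2 * (c m * K + 1))" for m
  have d: "d m > 0" if "cmod m \<le> 1" for m
    using c(1)[OF that] K0 by (simp add: d_def add_nonneg_pos)
  have loc: "norm (R l x) \<le> 2 * c m * norm x" if "cmod l \<le> 1" "cmod m \<le> 1" "cmod (m - l) < d m" for l m x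
  proof -
    have pos: "c m * K + 1 > 0" using c(1)[OF that(2)] K0 by (simp add: add_nonneg_pos)
    have "cmod (m - l) * (c m * K) \<le> d m * (c m * K + 1)"
      using that c(1)[OF that(2)] d[OF that(2)] K0 by (intro mult_mono) auto
    also have "\<dots> = 1 / 2" using pos by (simp add: d_def field_simps)
    finally have small: "cmod (m - l) * (c m * K) \<le> 1 / 2" .
    have "norm (R m (T (R l x))) \<le> c m * (K * norm (R l x))"
      using c(2)[OF that(2), of "T (R l x)"] mult_left_mono[OF K[of "R l x"] c(1)[OF that(2)]]
      by linarith
    then have "cmod (m - l) * norm (R m (T (R l x))) \<le> cmod (m - l) * (c m * (K * norm (R l x)))"
      by (intro mult_left_mono) auto
    also have "\<dots> = (cmod (m - l) * (c m * K)) * norm (R l x)" by simp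
    also have "\<dots> \<le> 1 / 2 * norm (R l x)" by (intro mult_right_mono small) auto
    finally have "norm (R m x - R l x) \<le> 1 / 2 * norm (R l x)"
      by (simp add: resolvent_identity[OF that(2,1)] norm_scaleC)
    moreover have "norm (R l x) \<le> norm (R m x) + norm (R m x - R l x)"
      using norm_triangle_ineq4[of "R m x" "R m x - R l x"] by simp
    ultimately show ?thesis using c(2)[OF that(2), of x] by simp
  qed
  have "compact (cball (0::complex) 1)" by simp
  moreover have "open (ball m (d m))" if "m \<in> cball 0 1" for m by simp
  moreover have "cball (0::complex) 1 \<subseteq> (\<Union>m\<in>cball 0 1. ball m (d m))"
    using d by force
  ultimately obtain F where F: "F \<subseteq> cball 0 1" "finite F" "cball (0::complex) 1 \<subseteq> (\<Union>m\<in>F. ball m (d m))"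
    by (rule compactE_image)
  let ?C = "\<Sum>m\<in>F. 2 * c m"
  have "?C \<ge> 0" using F(1) c(1) by (intro sum_nonneg) auto
  moreover have "norm (R l x) \<le> ?C * norm x" if "cmod l \<le> 1" for l x
  proof -
    have "l \<in> cball 0 1" using that by simp
    then obtain m where m: "m \<in> F" "l \<in> ball m (d m)" using F(3) by blast
    then have "norm (R l x) \<le> 2 * c m * norm x"
      using F(1) that by (intro loc) (auto simp: dist_norm)
    also have "2 * c m \<le> ?C"
      using F c(1) m by (intro member_le_sum) auto
    finally show ?thesis by (simp add: mult_right_mono)
  qed
  ultimately show ?thesis by blast
qed

lemma resolvent_lipschitz:
  "\<exists>L>0. \<forall>l m x. cmod l \<le> 1 \<longrightarrow> cmod m \<le> 1 \<longrightarrow> norm (R l x - R m x) \<le> L * cmod (l - m) * norm x"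
proof -
  obtain C where C: "C \<ge> 0" "\<And>l x. cmod l \<le> 1 \<Longrightarrow> norm (R l x) \<le> C * norm x"
    using resolvent_bounded by blast
  have "norm (R l x - R m x) \<le> (C * K * C + 1) * cmod (l - m) * norm x"
    if "cmod l \<le> 1" "cmod m \<le> 1" for l m x
  proof -
    have "norm (R l (T (R m x))) \<le> C * (K * (C * norm x))"
      by (rule order_trans[OF C(2)[OF that(1)]], intro mult_left_mono C(1),
          rule order_trans[OF K], intro mult_left_mono C(2) that(2) K0)
    then have "norm (R l x - R m x) \<le> cmod (l - m) * (C * (K * (C * norm x)))"
      by (simp add: resolvent_identity[OF that] norm_scaleC mult_left_mono)
    also have "\<dots> \<le> cmod (l - m) * (C * (K * (C * norm x))) + cmod (l - m) * norm x" by simp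
    finally show ?thesis by (simp add: algebra_simps)
  qed
  moreover have "C * K * C + 1 > 0" using C(1) K0 by (simp add: add_nonneg_pos)
  ultimately show ?thesis by blast
qed

lemmas Tn = clinear_funpow[OF T]

lemma resolvent_geometric:
  assumes l: "cmod l \<le> 1"
  shows "R l x = (\<Sum>k<n. l ^ k *\<^sub>C (T ^^ k) x) + l ^ n *\<^sub>C (T ^^ n) (R l x)"
proof (induction n)
  case (Suc n)
  have "(T ^^ n) (R l x) = (T ^^ n) x + l *\<^sub>C (T ^^ Suc n) (R l x)"
  proof -
    have "R l x = x + l *\<^sub>C T (R l x)" using R_right[OF l, of x] by (simp add: algebra_simps)
    from arg_cong[OF this, of "T ^^ n"] show ?thesis
      by (simp only: clinear_simps[OF Tn] funpow_Suc_right comp_apply)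
  qed
  from arg_cong[OF this, of "\<lambda>v. l ^ n *\<^sub>C v"]
  have "l ^ n *\<^sub>C (T ^^ n) (R l x) = l ^ n *\<^sub>C (T ^^ n) x + l ^ Suc n *\<^sub>C (T ^^ Suc n) (R l x)"
    by (simp only: scaleC_add_right scaleC_scaleC power_Suc2)
  with Suc show ?case by (simp add: add.assoc)
qed (simp add: scaleC_one)


text \<open>Averaging the resolvent over the circle of radius \<open>r\<close> at \<open>n\<close>-th roots of unity gives
  the inverse of \<open>1 - r\<^sup>n T\<^sup>n\<close>.\<close>

definition mean_resolvent :: "nat \<Rightarrow> real \<Rightarrow> 'a \<Rightarrow> 'a"
  where "mean_resolvent n r x =
    complex_of_real (1 / real n) *\<^sub>C (\<Sum>j<n. R (complex_of_real r * cis (2 * pi / real n) ^ j) x)"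

text \<open>All sampling points have the same n-th power r^n, so the remainder terms of the finite
  geometric expansions share one coefficient. In the sum of the remaining terms only the power 0
  survives.\<close>

lemma mean_resolvent_diff:
  assumes r: "0 \<le> r" "r \<le> 1" and n: "n > 0"
  shows "mean_resolvent n r x - complex_of_real r ^ n *\<^sub>C (T ^^ n) (mean_resolvent n r x) = x"
proof -
  let ?w = "cis (2 * pi / real n)"
  let ?l = "\<lambda>j. complex_of_real r * ?w ^ j"
  have l: "cmod (?l j) \<le> 1" for j using r by (simp add: norm_mult norm_power)
  have "?w ^ n = 1" using n by (simp add: Complex.DeMoivre)
  moreover have "(?w ^ j) ^ n = (?w ^ n) ^ j" for j
    by (simp only: power_mult[symmetric] mult.commute)
  ultimately have "(?w ^ j) ^ n = 1" for j by simp
  then have ln: "?l j ^ n = complex_of_real r ^ n" for j by (simp add: power_mult_distrib)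
  have "R (?l j) x - complex_of_real r ^ n *\<^sub>C (T ^^ n) (R (?l j) x) = (\<Sum>k<n. ?l j ^ k *\<^sub>C (T ^^ k) x)" for j
    using resolvent_geometric[OF l, of j x n] unfolding ln by (simp add: algebra_simps)
  then have "(\<Sum>j<n. R (?l j) x) - complex_of_real r ^ n *\<^sub>C (T ^^ n) (\<Sum>j<n. R (?l j) x)
      = (\<Sum>j<n. \<Sum>k<n. ?l j ^ k *\<^sub>C (T ^^ k) x)"
    by (simp add: clinear_sum[OF Tn] scaleC.scale_sum_right sum_subtractf[symmetric])
  also have "\<dots> = (\<Sum>k<n. \<Sum>j<n. ?l j ^ k *\<^sub>C (T ^^ k) x)" by (rule sum.swap)
  also have "\<dots> = (\<Sum>k<n. (complex_of_real r ^ k * (\<Sum>j<n. (?w ^ j) ^ k)) *\<^sub>C (T ^^ k) x)"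
    by (simp add: scaleC.scale_sum_left sum_distrib_left power_mult_distrib)
  also have "\<dots> = (\<Sum>k<n. if k = 0 then of_nat n *\<^sub>C x else 0)"
    by (intro sum.cong) (auto simp: sum_roots_of_unity_power)
  also have "\<dots> = of_nat n *\<^sub>C x" using n by simp
  finally have *: "(\<Sum>j<n. R (?l j) x) - complex_of_real r ^ n *\<^sub>C (T ^^ n) (\<Sum>j<n. R (?l j) x) = of_nat n *\<^sub>C x" .
  have "mean_resolvent n r x - complex_of_real r ^ n *\<^sub>C (T ^^ n) (mean_resolvent n r x)
     = complex_of_real (1 / real n) *\<^sub>C ((\<Sum>j<n. R (?l j) x) - complex_of_real r ^ n *\<^sub>C (T ^^ n) (\<Sum>j<n. R (?l j) x))"
    unfolding mean_resolvent_def
    by (simp only: clinear_simps[OF Tn] scaleC.scale_right_diff_distrib scaleC_scaleC mult.commute)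
  then show ?thesis using n unfolding * by (simp add: scaleC_scaleC scaleC_one)
qed

lemma mean_resolvent_surj:
  assumes r: "0 \<le> r" "r \<le> 1" and n: "n > 0"
  shows "mean_resolvent n r (z - complex_of_real r ^ n *\<^sub>C (T ^^ n) z) = z"
proof -
  let ?l = "\<lambda>j. complex_of_real r * cis (2 * pi / real n) ^ j"
  have l: "cmod (?l j) \<le> 1" for j using r by (simp add: norm_mult norm_power)
  have comm: "R (?l j) ((T ^^ k) z) = (T ^^ k) (R (?l j) z)" for j k
    by (induction k) (simp_all add: R_commute[OF l])
  have "mean_resolvent n r (z - complex_of_real r ^ n *\<^sub>C (T ^^ n) z)
     = mean_resolvent n r z - complex_of_real r ^ n *\<^sub>C (T ^^ n) (mean_resolvent n r z)"
    unfolding mean_resolvent_def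
    by (simp add: clinear_simps[OF Tn] clinear_simps[OF R_lin[OF l]] comm sum_subtractf
        clinear_sum[OF Tn] scaleC.scale_right_diff_distrib scaleC_scaleC
        mult.commute[of "complex_of_real r ^ n"] flip: scaleC.scale_sum_right)
  then show ?thesis using mean_resolvent_diff[OF assms] by simp
qed

lemma mean_resolvent_lipschitz:
  assumes L: "\<And>l m x. cmod l \<le> 1 \<Longrightarrow> cmod m \<le> 1 \<Longrightarrow> norm (R l x - R m x) \<le> L * cmod (l - m) * norm x"
    and "0 \<le> r" "r \<le> 1" "0 \<le> s" "s \<le> 1" "n > 0"
  shows "norm (mean_resolvent n r x - mean_resolvent n s x) \<le> L * \<bar>r - s\<bar> * norm x"
proof -
  let ?l = "\<lambda>r j. complex_of_real r * cis (2 * pi / real n) ^ j"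
  have "norm (R (?l r j) x - R (?l s j) x) \<le> L * \<bar>r - s\<bar> * norm x" for j
  proof -
    have "cmod (?l r j - ?l s j) = \<bar>r - s\<bar>"
      by (simp add: norm_mult norm_power flip: left_diff_distrib of_real_diff)
    then show ?thesis
      using L[of "?l r j" "?l s j" x] assms by (simp add: norm_mult norm_power)
  qed
  then have "norm (\<Sum>j<n. R (?l r j) x - R (?l s j) x) \<le> real n * (L * \<bar>r - s\<bar> * norm x)"
    by (intro order_trans[OF norm_sum] order_trans[OF sum_bounded_above]) auto
  then have sum_le: "norm (\<Sum>j<n. R (?l r j) x - R (?l s j) x) / real n \<le> L * \<bar>r - s\<bar> * norm x"
    using \<open>n > 0\<close> by (subst pos_divide_le_eq) (simp_all only: of_nat_0_less_iff mult.commute)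
  have "mean_resolvent n r x - mean_resolvent n s x
      = complex_of_real (1 / real n) *\<^sub>C (\<Sum>j<n. R (?l r j) x - R (?l s j) x)"
    by (simp only: mean_resolvent_def sum_subtractf scaleC.scale_right_diff_distrib)
  then have "norm (mean_resolvent n r x - mean_resolvent n s x)
      = norm (\<Sum>j<n. R (?l r j) x - R (?l s j) x) / real n"
    using \<open>n > 0\<close> by (simp add: norm_scaleC norm_divide)
  with sum_le show ?thesis by simp
qed

text \<open>Put x = z - r^n T^n z, so that the averages at r and s send x to z and y. The bound 1/4
  at s gives |y - x| <= |x|/3, and |z - y| <= |x|/6 then makes |z - x| <= |x|/2. Hence |x| <= 2 |z|
  and |z - x| <= |z|, which is the claim: 1/6 is exactly 1/2 - 1/3.\<close>

lemma power_step:
  assumes L: "\<And>l m x. cmod l \<le> 1 \<Longrightarrow> cmod m \<le> 1 \<Longrightarrow> norm (R l x - R m x) \<le> L * cmod (l - m) * norm x"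
    and r: "0 \<le> r" "r \<le> 1" and s: "0 \<le> s" "s \<le> 1" and n: "n > 0" and rs: "L * \<bar>r - s\<bar> \<le> 1 / 6"
    and bd: "\<And>z. s ^ n * norm ((T ^^ n) z) \<le> norm z / 4"
  shows "r ^ n * norm ((T ^^ n) z) \<le> norm z"
proof -
  define x where "x = z - complex_of_real r ^ n *\<^sub>C (T ^^ n) z"
  have z: "mean_resolvent n r x = z"
    unfolding x_def by (rule mean_resolvent_surj[OF r n])
  define y where "y = mean_resolvent n s x"
  have "norm (y - x) \<le> norm y / 4"
  proof -
    have "y - x = complex_of_real s ^ n *\<^sub>C (T ^^ n) y"
      using mean_resolvent_diff[OF s n, of x] by (simp add: y_def algebra_simps)
    then show ?thesis using bd[of y] s by (simp add: norm_scaleC norm_power)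
  qed
  moreover have "norm (z - y) \<le> norm x / 6"
    using mean_resolvent_lipschitz[OF L r s n, of x] mult_right_mono[OF rs norm_ge_zero[of x]]
    unfolding z y_def by simp
  moreover have "norm y \<le> norm x + norm (y - x)" by (rule norm_triangle_sub)
  moreover have "norm (z - x) \<le> norm (z - y) + norm (y - x)"
    using norm_triangle_ineq[of "z - y" "y - x"] by simp
  moreover have "norm x \<le> norm z + norm (z - x)" 
    using norm_triangle_sub[of x z] by (simp add: norm_minus_commute)
  ultimately have "norm (z - x) \<le> norm z" by linarith
  moreover have "z - x = complex_of_real r ^ n *\<^sub>C (T ^^ n) z" by (simp add: x_def)
  ultimately show ?thesis using r by (simp add: norm_scaleC norm_power)
qed

text \<open>The radius is pushed from 0 to 1 in finitely many steps. A forward step of length h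
  needs the bound 1/4 and yields only the bound 1; retreating by h/2 restores 1/4 for large n, at a
  net gain of h/2.\<close>

lemma eventually_power_bounded: "\<exists>N. \<forall>n\<ge>N. \<forall>z. norm ((T ^^ n) z) \<le> norm z"
proof -
  obtain L where L0: "L > 0" and L: "\<And>l m x. cmod l \<le> 1 \<Longrightarrow> cmod m \<le> 1 \<Longrightarrow>
      norm (R l x - R m x) \<le> L * cmod (l - m) * norm x"
    using resolvent_lipschitz by blast
  obtain m :: nat where m: "real m > 6 * L" using reals_Archimedean2 by blast
  then have m0: "m > 0" using L0 by (cases m) auto
  define h where "h = 1 / real m"
  have h: "h > 0" "L * h \<le> 1 / 6" using m m0 by (simp_all add: h_def field_simps)
  have step: "\<exists>N. \<forall>n\<ge>N. \<forall>z. (real k * h / 2) ^ n * norm ((T ^^ n) z) \<le> norm z / 4"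
    if "(real k + 1) * h / 2 \<le> 1" for k
    using that
  proof (induction k)
    case 0
    show ?case by (intro exI[of _ 1]) (auto simp: power_0_left)
  next
    case (Suc k)
    let ?r = "(real k + 2) * h / 2"
    have kh: "(real k + 2) * h / 2 \<le> 1" using Suc.prems by (simp add: algebra_simps)
    then have "(real k + 1) * h / 2 \<le> 1" using h by (simp add: algebra_simps)
    from Suc.IH[OF this] obtain N where N: "\<And>n z. n \<ge> N \<Longrightarrow> (real k * h / 2) ^ n * norm ((T ^^ n) z) \<le> norm z / 4"
      by blast
    have r: "?r ^ n * norm ((T ^^ n) z) \<le> norm z" if "n \<ge> N" "n > 0" for n z
    proof (rule power_step[OF L, where s = "real k * h / 2"])
      show "L * \<bar>?r - real k * h / 2\<bar> \<le> 1 / 6" using h by (simp add: algebra_simps)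
      show "real k * h / 2 \<le> 1" using kh h by (simp add: algebra_simps)
    qed (use kh h N that in auto)
    \<comment> \<open>The ratio of the radius after the retreat to the radius before it; its n-th
      power falls below 1/4.\<close>
    let ?q = "(real k + 1) / (real k + 2)"
    have "(\<lambda>n. ?q ^ n) \<longlonglongrightarrow> 0" by (rule LIMSEQ_power_zero) simp
    then have "eventually (\<lambda>n. ?q ^ n < 1 / 4) sequentially" by (rule order_tendstoD) simp
    then obtain N' where N': "\<And>n. n \<ge> N' \<Longrightarrow> ?q ^ n < 1 / 4" by (auto simp: eventually_sequentially)
    have "(real (Suc k) * h / 2) ^ n * norm ((T ^^ n) z) \<le> norm z / 4" if "n \<ge> max (N + 1) N'" for n z
    proof -
      have "real (Suc k) * h / 2 = ?q * ?r" by (simp add: field_simps)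
      then have "(real (Suc k) * h / 2) ^ n * norm ((T ^^ n) z) = ?q ^ n * (?r ^ n * norm ((T ^^ n) z))"
        by (simp only: power_mult_distrib mult.assoc)
      also have "\<dots> \<le> 1 / 4 * norm z"
        using N'[of n] r[of n z] that h by (intro mult_mono) auto
      finally show ?thesis by simp
    qed
    then show ?case by blast
  qed
  \<comment> \<open>The index 2m - 2 belongs to the radius 1 - h, from which one full forward step
    ends at 1.\<close>
  have eq: "real (2 * m - 2) = 2 * real m - 2" using m0 by (simp add: of_nat_diff)
  have s: "real (2 * m - 2) * h / 2 = 1 - h" "(real (2 * m - 2) + 1) * h / 2 \<le> 1"
    unfolding eq using m0 by (simp_all add: h_def field_simps)
  from step[OF s(2)] obtain N where N: "\<And>n z. n \<ge> N \<Longrightarrow> (1 - h) ^ n * norm ((T ^^ n) z) \<le> norm z / 4"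
    unfolding s(1) by blast
  have "norm ((T ^^ n) z) \<le> norm z" if "n \<ge> N + 1" for n z
    using power_step[OF L, of 1 "1 - h" n z] N h that m0 by (simp add: h_def)
  then show ?thesis by blast
qed

end

lemma eventually_power_bounded:
  fixes T :: "'a::complex_banach \<Rightarrow> 'a"
  assumes T: "clinear T" and K: "\<And>x. norm (T x) \<le> K * norm x" "0 \<le> K"
    and inv: "\<And>l. cmod l \<le> 1 \<Longrightarrow> invertible_op (\<lambda>x. x - l *\<^sub>C T x)"
  shows "\<exists>N. \<forall>n\<ge>N. \<forall>z. norm ((T ^^ n) z) \<le> norm z"
proof -
  have "\<forall>l\<in>cball 0 1. \<exists>S. clinear S \<and> bounded_linear S \<and> (\<forall>x. S (x - l *\<^sub>C T x) = x) \<and>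
      (\<forall>x. S x - l *\<^sub>C T (S x) = x)"
    using inv unfolding invertible_op_def by auto
  then obtain R where R: "\<And>l. cmod l \<le> 1 \<Longrightarrow> clinear (R l) \<and> bounded_linear (R l) \<and>
      (\<forall>x. R l (x - l *\<^sub>C T x) = x) \<and> (\<forall>x. R l x - l *\<^sub>C T (R l x) = x)"
    by (metis mem_cball_0)
  have "disc_resolvent T R K"
  proof (rule disc_resolvent.intro)
    show "clinear T" by (fact T)
    show "norm (T x) \<le> K * norm x" for x by (fact K)
    show "0 \<le> K" by (fact K)
    fix l :: complex assume l: "cmod l \<le> 1"
    show "clinear (R l)" "R l (x - l *\<^sub>C T x) = x" "R l x - l *\<^sub>C T (R l x) = x" for x
      using R[OF l] by simp_all
    have "bounded_linear (R l)" using R[OF l] by simp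
    from bounded_linear.nonneg_bounded[OF this]
    show "\<exists>C\<ge>0. \<forall>x. norm (R l x) \<le> C * norm x" by (simp only: mult.commute)
  qed
  then show ?thesis by (rule disc_resolvent.eventually_power_bounded)
qed

section \<open>Polynomials in an operator\<close>

definition op_poly :: "('a::complex_vector \<Rightarrow> 'a) \<Rightarrow> complex poly \<Rightarrow> 'a \<Rightarrow> 'a"
  where "op_poly A p z = fold_coeffs (\<lambda>a w. a *\<^sub>C z + A w) p 0"

lemma op_poly_0 [simp]: "op_poly A 0 z = 0"
  by (simp add: op_poly_def)

lemma op_poly_pCons: "clinear A \<Longrightarrow> op_poly A (pCons a p) z = a *\<^sub>C z + A (op_poly A p z)"
  by (cases "p = 0 \<and> a = 0") (auto simp: op_poly_def clinear_zero)

lemma op_poly_1: "clinear A \<Longrightarrow> op_poly A 1 z = z"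
  unfolding one_pCons by (simp add: op_poly_pCons clinear_zero scaleC_one)

lemma op_poly_clinear:
  assumes A: "clinear A" shows "clinear (op_poly A p)"
proof (induction p)
  case (pCons a p)
  then show ?case
    by (simp add: clinear_iff op_poly_pCons[OF A] clinear_simps[OF A] scaleC_add_right scaleC_scaleC mult.commute)
qed (simp add: clinear_iff)

lemma op_poly_add: "clinear A \<Longrightarrow> op_poly A (p + q) z = op_poly A p z + op_poly A q z"
  by (induction p q rule: poly_induct2) (simp_all add: op_poly_pCons clinear_add scaleC_add_left)

lemma op_poly_smult: "clinear A \<Longrightarrow> op_poly A (smult c p) z = c *\<^sub>C op_poly A p z"
  by (induction p) (simp_all add: op_poly_pCons clinear_scaleC scaleC_add_right scaleC_scaleC)

lemma op_poly_diff: "clinear A \<Longrightarrow> op_poly A (p - q) z = op_poly A p z - op_poly A q z"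
  using op_poly_add[of A p "smult (-1) q" z] op_poly_smult[of A "-1" q z] by simp

lemma op_poly_commute:
  assumes A: "clinear A" and B: "clinear B" and AB: "\<And>z. A (B z) = B (A z)"
  shows "op_poly A p (B z) = B (op_poly A p z)"
  by (induction p) (simp_all add: op_poly_pCons[OF A] clinear_simps[OF B] AB)

lemma op_poly_mult:
  assumes A: "clinear A" shows "op_poly A (p * q) z = op_poly A p (op_poly A q z)"
proof (induction p)
  case (pCons a p)
  have "op_poly A (pCons 0 (p * q)) z = A (op_poly A p (op_poly A q z))"
    by (simp add: op_poly_pCons[OF A] pCons.IH)
  then show ?case
    by (simp add: op_poly_pCons[OF A] op_poly_add[OF A] op_poly_smult[OF A])
qed simp

lemma op_poly_power:
  assumes A: "clinear A" shows "op_poly A (p ^ n) z = (op_poly A p ^^ n) z"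
  by (induction n) (simp_all add: op_poly_1[OF A] op_poly_mult[OF A])

lemma op_poly_sum: "clinear A \<Longrightarrow> op_poly A p z = (\<Sum>i\<le>degree p. coeff p i *\<^sub>C (A ^^ i) z)"
proof (induction p)
  case (pCons a p)
  have "(\<Sum>i\<le>degree p. coeff p i *\<^sub>C A ((A ^^ i) z)) = A (\<Sum>i\<le>degree p. coeff p i *\<^sub>C (A ^^ i) z)"
    by (simp add: clinear_sum[OF pCons.prems] clinear_scaleC[OF pCons.prems])
  then show ?case
    using pCons by (simp add: op_poly_pCons sum.atMost_Suc_shift clinear_zero del: sum.atMost_Suc)
qed simp

lemma op_poly_bounded:
  assumes A: "clinear A" and K: "\<And>x. norm (A x) \<le> K * norm x" "0 \<le> K"
  shows "\<exists>C\<ge>0. \<forall>x. norm (op_poly A p x) \<le> C * norm (x :: 'a :: complex_banach)"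
proof (induction p)
  case 0
  show ?case by (intro exI[of _ 0]) simp
next
  case (pCons a p)
  then obtain C where C: "C \<ge> 0" "\<And>x. norm (op_poly A p x) \<le> C * norm x" by auto
  have "norm (op_poly A (pCons a p) x) \<le> (cmod a + K * C) * norm x" for x
  proof -
    have "norm (op_poly A (pCons a p) x) \<le> cmod a * norm x + norm (A (op_poly A p x))"
      unfolding op_poly_pCons[OF A] by (rule order_trans[OF norm_triangle_ineq]) (simp add: norm_scaleC)
    also have "norm (A (op_poly A p x)) \<le> K * (C * norm x)"
      using K(1)[of "op_poly A p x"] mult_left_mono[OF C(2)[of x] K(2)] by linarith
    finally show ?thesis by (simp add: algebra_simps)
  qed
  then show ?case using C(1) K(2) by (intro exI[of _ "cmod a + K * C"]) simp
qed

text \<open>The half of the spectral mapping theorem that is used: factor \<open>q\<close> into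
  linear factors, each of which is invertible off the spectrum.\<close>

lemma invertible_op_poly:
  assumes A: "clinear A" and "q \<noteq> 0" and "\<And>c. poly q c = 0 \<Longrightarrow> c \<notin> op_spectrum A"
  shows "invertible_op (op_poly A q)"
  using assms(2,3)
proof (induction "degree q" arbitrary: q)
  case 0
  then obtain c where q: "q = [:c:]" "c \<noteq> 0" by (metis degree_eq_zeroE pCons_0_0)
  then have "op_poly A q = (\<lambda>z. c *\<^sub>C z)"
    by (auto simp: op_poly_pCons[OF A] clinear_zero[OF A])
  then show ?case using q by (simp add: invertible_op_scaleC)
next
  case (Suc n)
  then obtain c where c: "poly q c = 0" using alg_closed_imp_poly_has_root[of q] by auto
  then obtain r where r: "q = [:-c, 1:] * r" by (metis poly_eq_0_iff_dvd dvdE)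
  then have "r \<noteq> 0" using Suc.prems by auto
  then have "degree q = Suc (degree r)" unfolding r by (subst degree_mult_eq) auto
  then have inv_r: "invertible_op (op_poly A r)"
    using Suc.hyps Suc.prems \<open>r \<noteq> 0\<close> r by auto
  have "invertible_op (\<lambda>x. A x - c *\<^sub>C x)"
    using Suc.prems(2)[OF c] by (simp add: not_in_op_spectrum_iff)
  from invertible_op_compose[OF this inv_r]
  have "invertible_op (\<lambda>x. A (op_poly A r x) - c *\<^sub>C op_poly A r x)" .
  also have "(\<lambda>x. A (op_poly A r x) - c *\<^sub>C op_poly A r x) = op_poly A q"
    unfolding r
    by (simp add: fun_eq_iff op_poly_mult[OF A] op_poly_pCons[OF A] op_poly_diff[OF A] op_poly_smult[OF A] clinear_zero[OF A] scaleC_one)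
  finally show ?case .
qed

text \<open>After division by \<open>M\<close> the polynomial is smaller than 1 in modulus on
  \<open>S\<close>. Then 1 - l q has no zero on \<open>S\<close> for any l in the closed disc, so
  the power bound for such resolvents applies.\<close>

lemma op_poly_power_bounded:
  assumes A: "clinear A" and K: "\<And>x. norm (A x) \<le> K * norm x" "0 \<le> K"
    and S: "op_spectrum A \<subseteq> S" "S \<noteq> {}"
    and M: "0 < M" "\<And>c. c \<in> S \<Longrightarrow> cmod (poly p c) < M"
  shows "\<exists>N. \<forall>n\<ge>N. \<forall>z. norm ((op_poly A p ^^ n) z) \<le> M ^ n * norm (z :: 'a :: complex_banach)"
proof -
  define q where "q = smult (complex_of_real (1 / M)) p"
  have lin: "clinear (op_poly A q)" by (rule op_poly_clinear[OF A])
  obtain C where C: "C \<ge> 0" "\<And>x. norm (op_poly A q x) \<le> C * norm x"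
    using op_poly_bounded[OF A K] by blast
  have "invertible_op (\<lambda>x. x - l *\<^sub>C op_poly A q x)" if l: "cmod l \<le> 1" for l
  proof -
    have *: "poly (1 - smult l q) c \<noteq> 0" if "c \<in> S" for c
    proof
      assume "poly (1 - smult l q) c = 0"
      then have "l * poly p c = M" using M(1) by (simp add: q_def field_simps)
      then have "cmod l * cmod (poly p c) = M" using M(1) by (metis norm_mult norm_of_real abs_of_pos)
      moreover have "cmod l * cmod (poly p c) \<le> 1 * cmod (poly p c)"
        using l by (intro mult_right_mono) auto
      ultimately show False using M(2)[OF that] by simp
    qed
    \<comment> \<open>A point of \<open>S\<close> is needed here to exclude the zero
      polynomial.\<close>
    then have "1 - smult l q \<noteq> 0" using S(2) by fastforce
    then have "invertible_op (op_poly A (1 - smult l q))"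
      using * S(1) by (intro invertible_op_poly[OF A]) auto
    also have "op_poly A (1 - smult l q) = (\<lambda>x. x - l *\<^sub>C op_poly A q x)"
      by (simp add: fun_eq_iff op_poly_diff[OF A] op_poly_1[OF A] op_poly_smult[OF A])
    finally show ?thesis .
  qed
  from eventually_power_bounded[OF lin C(2) C(1) this]
  obtain N where N: "\<And>n z. n \<ge> N \<Longrightarrow> norm ((op_poly A q ^^ n) z) \<le> norm z" by blast
  have "(op_poly A p ^^ n) z = complex_of_real M ^ n *\<^sub>C (op_poly A q ^^ n) z" for n z
  proof -
    have "op_poly A (p ^ n) z = op_poly A (smult (complex_of_real M ^ n) (q ^ n)) z"
      using M(1) by (simp add: q_def smult_power[symmetric] power_mult_distrib[symmetric])
    then show ?thesis by (simp add: op_poly_power[OF A] op_poly_smult[OF A])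
  qed
  then show ?thesis using N M(1) by (intro exI[of _ N]) (simp add: norm_scaleC norm_power mult_left_mono)
qed

section \<open>Jordan triple identities\<close>

lemma antilinear_add: "antilinear f \<Longrightarrow> f (x + y) = f x + f y"
  and antilinear_scaleC: "antilinear f \<Longrightarrow> f (c *\<^sub>C x) = cnj c *\<^sub>C f x"
  by (simp_all add: antilinear_def)

context jordan_triple
begin

lemma tp_add:
  "tp (x + x') y z = tp x y z + tp x' y z"
  "tp x (y + y') z = tp x y z + tp x y' z"
  "tp x y (z + z') = tp x y z + tp x y z'"
  using clinear_add[OF linear_left] antilinear_add[OF antilinear_middle] clinear_add[OF linear_right]
  by blast+

lemma tp_scaleC:
  "tp (c *\<^sub>C x) y z = c *\<^sub>C tp x y z"
  "tp x (c *\<^sub>C y) z = cnj c *\<^sub>C tp x y z"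
  "tp x y (c *\<^sub>C z) = c *\<^sub>C tp x y z"
  using clinear_scaleC[OF linear_left] antilinear_scaleC[OF antilinear_middle] clinear_scaleC[OF linear_right]
  by blast+

lemma tp_zero [simp]: "tp 0 y z = 0" "tp x 0 z = 0" "tp x y 0 = 0"
  using tp_scaleC(1)[where c = 0] tp_scaleC(2)[where c = 0] tp_scaleC(3)[where c = 0] by simp_all

lemma tp_minus: "tp (- x) y z = - tp x y z" "tp x (- y) z = - tp x y z" "tp x y (- z) = - tp x y z"
  using tp_scaleC(1)[where c = "-1"] tp_scaleC(2)[where c = "-1"] tp_scaleC(3)[where c = "-1"] by simp_all

lemma tp_diff:
  "tp (x - x') y z = tp x y z - tp x' y z"
  "tp x (y - y') z = tp x y z - tp x y' z"
  "tp x y (z - z') = tp x y z - tp x y z'"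
  by (simp_all only: diff_conv_add_uminus tp_add tp_minus)

lemma tp_sum:
  "tp (sum f I) y z = (\<Sum>i\<in>I. tp (f i) y z)"
  "tp x (sum f I) z = (\<Sum>i\<in>I. tp x (f i) z)"
  "tp x y (sum f I) = (\<Sum>i\<in>I. tp x y (f i))"
  by (induction I rule: infinite_finite_induct) (simp_all add: tp_add)

lemma jordan_commutator:
  "tp a b (tp u v z) - tp u v (tp a b z) = tp (tp a b u) v z - tp u (tp b a v) z"
  by (simp add: jordan_identity[of a b u v z])

lemma tp_middle: "tp x (tp b a y) z = tp (tp a b x) y z + tp x y (tp a b z) - tp a b (tp x y z)"
  by (simp add: jordan_identity[of a b x y z])

lemma tp_tp_middle:
  "tp f (tp g z k) h = tp h k (tp f g z) + tp f k (tp h g z) - tp (tp f k h) g z"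
  using tp_middle[of f g z k h] outer_symmetric by metis

text \<open>This is D(a,b) Q(a) = Q(a) D(b,a). Solving the Jordan identity for the middle term in
  two ways gives W = 2Y - X and W = 2X - Y, so 3X = 3Y.\<close>

lemma jordan_cube: "tp a b (tp a z a) = tp a (tp b a z) a"
proof -
  let ?X = "tp a b (tp a z a)" and ?Y = "tp a z (tp a b a)" and ?W = "tp a (tp b a z) a"
  have "?W = ?Y + ?Y - ?X"
    using tp_middle[of a b a z a] outer_symmetric by metis
  moreover have "tp a (tp z a b) a = ?X + ?X - ?Y"
    using tp_middle[of a z a b a] outer_symmetric by metis
  then have "?W = ?X + ?X - ?Y" by (simp add: outer_symmetric[of z a b])
  ultimately have "3 *\<^sub>R ?X = 3 *\<^sub>R ?Y"
    by (simp add: scaleR_left_distrib[of 1 2, simplified] scaleR_2 algebra_simps)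
  then have "?X = ?Y" by simp
  with \<open>?W = ?Y + ?Y - ?X\<close> show ?thesis by simp
qed

text \<open>Polarization of the cube identity in \<open>a\<close>. The terms with only two distinct
  variables vanish separately (\<open>h\<close>), and those with three occur in equal pairs because
  \<open>g\<close> is symmetric in its last two arguments.\<close>

lemma jordan_cube_linearized:
  "(tp a y (tp b z c) - tp b (tp y a z) c) + (tp b y (tp a z c) - tp a (tp y b z) c)
    + (tp c y (tp a z b) - tp a (tp y c z) b) = 0"
proof -
  define g where "g p q r = tp p y (tp q z r) - tp q (tp y p z) r" for p q r
  have sym: "g p q r = g p r q" for p q r by (simp add: g_def outer_symmetric[of q _ r])
  have add: "g (p + p') q r = g p q r + g p' q r" "g p (q + q') r = g p q r + g p q' r"
    "g p q (r + r') = g p q r + g p q r'" for p p' q q' r r'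
    by (simp_all add: g_def tp_add)
  have zero: "g p p p = 0" for p by (simp add: g_def jordan_cube)
  define h where "h p q = g p p q + g p q p + g q p p + (g p q q + g q p q + g q q p)" for p q
  have "g (p + q) (p + q) (p + q) = h p q" for p q
    by (simp only: add) (simp add: zero h_def add_ac)
  then have h: "h p q = 0" for p q by (simp add: zero)
  have "g (a + b + c) (a + b + c) (a + b + c)
      = h a b + h a c + h b c + 2 *\<^sub>R (g a b c + g b a c + g c a b)"
    by (simp only: add) (simp add: zero h_def scaleR_2 sym[of a c b] sym[of b c a] sym[of c b a] add_ac)
  then have "g a b c + g b a c + g c a b = 0" by (simp add: zero h)
  then show ?thesis by (simp add: g_def)
qed

text \<open>The power x^(2m+1): each application of D(x,x) raises the degree by two.\<close>

definition odd_power :: "'z \<Rightarrow> nat \<Rightarrow> 'z"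
  where "odd_power x m = (tp x x ^^ m) x"

lemma odd_power_simps: "odd_power x 0 = x" "tp x x (odd_power x m) = odd_power x (Suc m)"
  by (simp_all add: odd_power_def)

text \<open>The operators \<open>D x\<^sub>k x\<^sub>l\<close> with \<open>k + l = N + 1\<close> form an arithmetic progression whose
  difference is the commutator of \<open>D x x\<close> and \<open>D x\<^sub>N x\<close>; the negative of that commutator is
  \<open>N + 1\<close> times the difference, hence everything vanishes.\<close>

lemma odd_power_box_aux:
  "(\<forall>m\<le>N. \<forall>z. tp (odd_power x m) (odd_power x (N - m)) z = tp (odd_power x N) x z) \<and>
   (\<forall>z. tp x x (tp (odd_power x N) x z) = tp (odd_power x N) x (tp x x z))"
proof -
  let ?p = "odd_power x"
  have step: "(\<forall>z. tp x x (tp (?p N) x z) = tp (?p N) x (tp x x z)) \<and>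
      (\<forall>m\<le>Suc N. \<forall>z. tp (?p m) (?p (Suc N - m)) z = tp (?p (Suc N)) x z)"
    if IH: "\<And>m z. m \<le> N \<Longrightarrow> tp (?p m) (?p (N - m)) z = tp (?p N) x z" for N
  proof -
    define c where "c z = tp x x (tp (?p N) x z) - tp (?p N) x (tp x x z)" for z
    define d where "d k z = tp (?p k) (?p (Suc N - k)) z" for k z
    have d_Suc: "d (Suc m) z = d m z + c z" if "m \<le> N" for m z
    proof -
      have "c z = tp x x (tp (?p m) (?p (N - m)) z) - tp (?p m) (?p (N - m)) (tp x x z)"
        by (simp only: c_def IH[OF that])
      also have "\<dots> = d (Suc m) z - d m z"
        using that by (simp add: jordan_commutator odd_power_simps d_def Suc_diff_le)
      finally show ?thesis by simp
    qed
    have dk: "d k z = d 0 z + real k *\<^sub>R c z" if "k \<le> Suc N" for k z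
      using that by (induction k) (simp_all add: d_Suc scaleR_left_distrib add_ac)
    have "tp x (?p N) x = ?p (Suc N)"
      using IH[of 0 x] by (simp add: odd_power_simps outer_symmetric[of "?p N" x x])
    then have "- c z = d (Suc N) z - d 0 z" for z
      using jordan_commutator[of "?p N" x x x z]
      by (simp add: c_def d_def odd_power_simps outer_symmetric[of "?p N" x x])
    then have *: "real (Suc N) *\<^sub>R c z = - c z" for z
      by (simp only: dk[OF order_refl]) simp
    have "(real (Suc N) + 1) *\<^sub>R c z = 0" for z
      by (simp only: scaleR_left_distrib scaleR_one *) simp
    then have c0: "c z = 0" for z
      unfolding scaleR_eq_0_iff by (auto simp: add_nonneg_eq_0_iff)
    have "tp (?p m) (?p (Suc N - m)) z = tp (?p (Suc N)) x z" if "m \<le> Suc N" for m z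
      using dk[OF that, of z] dk[OF order_refl, of z] by (simp add: c0 d_def odd_power_simps(1))
    then show ?thesis using c0 by (auto simp: c_def)
  qed
  have "\<forall>m\<le>N. \<forall>z. tp (?p m) (?p (N - m)) z = tp (?p N) x z"
  proof (induction N)
    case (Suc N)
    then show ?case using step[of N] by blast
  qed (simp add: odd_power_simps)
  then show ?thesis using step[of N] by blast
qed

lemma odd_power_box: "tp (odd_power x m) (odd_power x n) z = tp (odd_power x (m + n)) x z"
  using conjunct1[OF odd_power_box_aux[of "m + n" x], rule_format, of m z] by simp

lemma odd_power_commute:
  "tp x x (tp (odd_power x n) x z) = tp (odd_power x n) x (tp x x z)"
  using odd_power_box_aux[of n x] by blast

abbreviation box_poly :: "'z \<Rightarrow> complex poly \<Rightarrow> 'z"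
  where "box_poly x p \<equiv> op_poly (tp x x) p x"

lemma box_poly_sum: "box_poly x p = (\<Sum>i\<le>degree p. coeff p i *\<^sub>C odd_power x i)"
  unfolding odd_power_def by (rule op_poly_sum[OF linear_right])

lemma box_poly_shift: "tp (tp x x (box_poly x p)) (box_poly x q) z = tp (box_poly x p) (tp x x (box_poly x q)) z"
  by (simp add: box_poly_sum tp_sum tp_scaleC odd_power_simps odd_power_box)

lemma box_poly_commute: "tp x x (tp (box_poly x p) x z) = tp (box_poly x p) x (tp x x z)"
  by (simp add: box_poly_sum tp_sum tp_scaleC odd_power_commute)

text \<open>Induction on \<open>q\<close> moves one factor D(x,x) after another from the middle
  argument to the left one. Coefficients are conjugated because the middle slot is
  antilinear.\<close>

lemma box_poly_box: "tp (box_poly x p) (box_poly x q) z = tp (box_poly x (p * map_poly cnj q)) x z"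
proof (induction q arbitrary: p)
  case (pCons a q)
  have pc: "box_poly x (pCons a r) = a *\<^sub>C x + tp x x (box_poly x r)" for a r
    by (rule op_poly_pCons[OF linear_right])
  have "tp (box_poly x p) (box_poly x (pCons a q)) z
      = cnj a *\<^sub>C tp (box_poly x p) x z + tp (box_poly x (pCons 0 p)) (box_poly x q) z"
    by (simp add: pc tp_add tp_scaleC box_poly_shift)
  also have "\<dots> = tp (box_poly x (smult (cnj a) p + pCons 0 p * map_poly cnj q)) x z"
    by (simp only: pCons.IH op_poly_add[OF linear_right] op_poly_smult[OF linear_right] tp_add tp_scaleC)
  finally show ?case by (simp add: map_poly_pCons)
qed simp

text \<open>Since D(p(x),x) commutes with D(x,x), the polynomial \<open>r\<close> can be pulled out
  and acts on a product ending in x. The factor \<open>[:0, 1:]\<close> is the D(x,x) left by that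
  last product.\<close>

lemma box_poly_triple:
  "tp (box_poly x p) (box_poly x q) (box_poly x r) = box_poly x ([:0, 1:] * p * map_poly cnj q * r)"
proof -
  let ?s = "p * map_poly cnj q"
  have "tp (box_poly x p) (box_poly x q) (box_poly x r) = tp (box_poly x ?s) x (box_poly x r)"
    by (rule box_poly_box)
  also have "\<dots> = op_poly (tp x x) r (tp (box_poly x ?s) x x)"
    by (rule op_poly_commute[of "tp x x" "tp (box_poly x ?s) x",
          OF linear_right linear_right box_poly_commute, symmetric])
  also have "tp (box_poly x ?s) x x = box_poly x (pCons 0 ?s)"
    by (simp add: op_poly_pCons[OF linear_right] outer_symmetric[of _ x x])
  also have "op_poly (tp x x) r (box_poly x (pCons 0 ?s)) = box_poly x (r * pCons 0 ?s)"
    by (rule op_poly_mult[OF linear_right, symmetric])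
  finally show ?thesis by (simp add: mult.commute)
qed

end

section \<open>The norm of an odd polynomial of an element\<close>

lemma map_poly_cnj_mult: "map_poly cnj (p * q) = map_poly cnj p * map_poly cnj q"
  by (simp add: poly_eq_poly_eq_iff[symmetric] fun_eq_iff)

lemma map_poly_cnj_power: "map_poly cnj (p ^ n) = map_poly cnj p ^ n"
  by (induction n) (simp_all add: map_poly_cnj_mult)

text \<open>The spectrum of D(x,x) enters only through a bounding interval, so all later functions
  live on the whole of [0,R].\<close>

locale triple_element = jordan_triple tp
  for tp :: "'z::complex_banach \<Rightarrow> 'z \<Rightarrow> 'z \<Rightarrow> 'z" +
  fixes x :: 'z and B R :: real
  assumes tp_norm: "norm (tp a b c) \<le> B * norm a * norm b * norm c" and B: "0 \<le> B"
    and tp_continuous: "continuous_on UNIV (\<lambda>(a, b, c). tp a b c)"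
    and norm_tp_cube: "norm (tp a a a) = norm a ^ 3"
    and R: "0 < R" and spectrum: "op_spectrum (tp x x) \<subseteq> complex_of_real ` {0..R}"
begin

text \<open>The argument by which a C*-norm equals a spectral radius. Iterated cubes of y =
  \<open>box_poly x p\<close> are \<open>q^n(D) y\<close> with q = t |p|^2 on the interval, so the
  cube law makes |y|^(2n+1) equal to a norm which the power bound keeps below M'^n |y|. The detour
  through M' > M supplies the strict inequality which that bound requires.\<close>

lemma norm_box_poly:
  assumes p: "\<And>t. 0 \<le> t \<Longrightarrow> t \<le> R \<Longrightarrow> t * (cmod (poly p (complex_of_real t)))\<^sup>2 \<le> M"
  shows "(norm (box_poly x p))\<^sup>2 \<le> M"
proof (rule dense_ge)
  fix M' assume "M < M'"
  define q where "q = [:0, 1:] * p * map_poly cnj p"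
  have "0 \<le> M" using p[of 0] R by simp
  then have M': "0 < M'" using \<open>M < M'\<close> by simp
  have cq: "map_poly cnj q = q"
    by (simp add: q_def poly_eq_poly_eq_iff[symmetric] fun_eq_iff)
  have lin: "clinear (tp x x)" by (rule linear_right)
  have bd: "norm (tp x x z) \<le> (B * norm x * norm x) * norm z" for z
    using tp_norm[of x x z] by simp
  have "cmod (poly q c) < M'" if "c \<in> complex_of_real ` {0..R}" for c
  proof -
    obtain t where t: "c = complex_of_real t" "0 \<le> t" "t \<le> R" using \<open>c \<in> _\<close> by auto
    have "cmod (poly q c) = t * (cmod (poly p (complex_of_real t)))\<^sup>2"
      using t by (simp add: q_def norm_mult power2_eq_square)
    then show ?thesis using p[OF t(2,3)] \<open>M < M'\<close> by simp
  qed
  from op_poly_power_bounded[OF lin bd _ spectrum _ M' this]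
  obtain N where N: "\<And>n z. n \<ge> N \<Longrightarrow> norm ((op_poly (tp x x) q ^^ n) z) \<le> M' ^ n * norm z"
    using B R by auto
  have gen: "[:0, 1:] * (Q * p) * (Q * map_poly cnj p) * (Q * p) = Q ^ 3 * ([:0, 1:] * p * map_poly cnj p) * p"
    for Q by (simp only: power3_eq_cube ac_simps)
  let ?y = "box_poly x p"
  \<comment> \<open>Cubing replaces n by 3n + 1, since 3 (2n + 1) = 2 (3n + 1) + 1; arbitrarily
    large exponents suffice.\<close>
  have cubes: "\<exists>n\<ge>k. norm ?y ^ (2 * n + 1) = norm (box_poly x (q ^ n * p))" for k
  proof (induction k)
    case (Suc k)
    then obtain n where n: "n \<ge> k" "norm ?y ^ (2 * n + 1) = norm (box_poly x (q ^ n * p))" by blast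
    have "2 * (3 * n + 1) + 1 = (2 * n + 1) * 3" by simp
    then have "norm ?y ^ (2 * (3 * n + 1) + 1) = (norm ?y ^ (2 * n + 1)) ^ 3"
      by (simp only: power_mult)
    also have "\<dots> = norm (tp (box_poly x (q ^ n * p)) (box_poly x (q ^ n * p)) (box_poly x (q ^ n * p)))"
      by (simp only: n(2) norm_tp_cube)
    also have "[:0, 1:] * (q ^ n * p) * map_poly cnj (q ^ n * p) * (q ^ n * p) = (q ^ n) ^ 3 * q * p"
      unfolding map_poly_cnj_mult map_poly_cnj_power cq by (rule gen[of "q ^ n", folded q_def])
    then have "tp (box_poly x (q ^ n * p)) (box_poly x (q ^ n * p)) (box_poly x (q ^ n * p))
        = box_poly x (q ^ (3 * n + 1) * p)"
      by (simp only: box_poly_triple power_mult[symmetric] power_add power_one_right mult.commute[of n 3])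
    finally show ?case using n(1) by (intro exI[of _ "3 * n + 1"]) simp
  qed (intro exI[of _ 0], simp)
  obtain n where n: "n \<ge> Suc N" "norm ?y ^ (2 * n + 1) = norm (box_poly x (q ^ n * p))"
    using cubes by blast
  have "norm ?y ^ (2 * n + 1) \<le> M' ^ n * norm ?y"
    using N[of n ?y] n by (simp add: op_poly_mult[OF lin] op_poly_power[OF lin])
  then have "((norm ?y)\<^sup>2) ^ n * norm ?y \<le> M' ^ n * norm ?y"
    by (simp only: power_add power_mult power_one_right)
  then have "?y = 0 \<or> ((norm ?y)\<^sup>2) ^ n \<le> M' ^ n" by (auto simp: mult_le_cancel_right)
  then show "(norm ?y)\<^sup>2 \<le> M'"
    using M' n(1) power_mono_iff[of "(norm ?y)\<^sup>2" M' n] by (elim disjE) simp_all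
qed

end

section \<open>Continuous functional calculus\<close>

lemma complex_poly_dense:
  fixes f :: "real \<Rightarrow> complex"
  assumes f: "continuous_on {a..b} f" and "0 < e"
  shows "\<exists>p. \<forall>t\<in>{a..b}. cmod (f t - poly p (complex_of_real t)) < e"
proof -
  obtain g :: "real \<Rightarrow> complex" where g: "polynomial_function g" "\<And>t. t \<in> {a..b} \<Longrightarrow> cmod (f t - g t) < e"
    using Stone_Weierstrass_polynomial_function[OF compact_Icc f \<open>0 < e\<close>] by blast
  have "real_polynomial_function (Re \<circ> g)" "real_polynomial_function (Im \<circ> g)"
    using g(1) bounded_linear_Re bounded_linear_Im by (auto simp: polynomial_function_def)
  then obtain c m d n where cd: "Re \<circ> g = (\<lambda>t. \<Sum>i\<le>m. c i * t ^ i)" "Im \<circ> g = (\<lambda>t. \<Sum>i\<le>n. d i * t ^ i)"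
    by (auto simp: real_polynomial_function_iff_sum)
  define p where "p = (\<Sum>i\<le>m::nat. monom (complex_of_real (c i)) i) + smult \<i> (\<Sum>i\<le>n::nat. monom (complex_of_real (d i)) i)"
  have "poly p (complex_of_real t) = g t" for t
  proof -
    have "poly p (complex_of_real t) = complex_of_real (\<Sum>i\<le>m. c i * t ^ i) + \<i> * complex_of_real (\<Sum>i\<le>n. d i * t ^ i)"
      by (simp add: p_def poly_sum poly_monom)
    also have "\<dots> = complex_of_real (Re (g t)) + \<i> * complex_of_real (Im (g t))"
      using fun_cong[OF cd(1), of t] fun_cong[OF cd(2), of t] by (simp only: comp_apply)
    finally show ?thesis by (simp add: complex_eq[symmetric])
  qed
  then show ?thesis using g(2) by (intro exI[of _ p]) auto
qed

context triple_element
begin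

abbreviation cts :: "(real \<Rightarrow> complex) \<Rightarrow> bool"
  where "cts f \<equiv> continuous_on {0..R} f"

lemma tendsto_tp:
  assumes "(f \<longlongrightarrow> a) F" "(g \<longlongrightarrow> b) F" "(h \<longlongrightarrow> c) F"
  shows "((\<lambda>n. tp (f n) (g n) (h n)) \<longlongrightarrow> tp a b c) F"
  using continuous_on_tendsto_compose[OF tp_continuous tendsto_Pair[OF assms(1) tendsto_Pair[OF assms(2,3)]]]
  by simp

definition approx_poly :: "(real \<Rightarrow> complex) \<Rightarrow> nat \<Rightarrow> complex poly"
  where "approx_poly f n =
    (SOME p. \<forall>t\<in>{0..R}. cmod (f t - poly p (complex_of_real t)) < inverse (real (Suc n)))"

text \<open>The constant 1 is sent to x, the identity function to {x,x,x}. The approximating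
  polynomials depend only on the values on [0,R], which is why \<open>fc_cong\<close> asks for no
  continuity.\<close>

definition fc :: "(real \<Rightarrow> complex) \<Rightarrow> 'z"
  where "fc f = lim (\<lambda>n. box_poly x (approx_poly f n))"

lemma fc_cong: "(\<And>t. 0 \<le> t \<Longrightarrow> t \<le> R \<Longrightarrow> f t = g t) \<Longrightarrow> fc f = fc g"
proof -
  assume eq: "\<And>t. 0 \<le> t \<Longrightarrow> t \<le> R \<Longrightarrow> f t = g t"
  have "approx_poly f = approx_poly g"
    unfolding approx_poly_def using eq by (intro ext arg_cong[of _ _ Eps] ball_cong) auto
  then show ?thesis by (simp add: fc_def)
qed

lemma approx_poly:
  assumes "cts f" "t \<in> {0..R}"
  shows "cmod (f t - poly (approx_poly f n) (complex_of_real t)) < inverse (real (Suc n))"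
proof -
  have "0 < inverse (real (Suc n))" by simp
  from someI_ex[OF complex_poly_dense[OF assms(1) this]] assms(2)
  show ?thesis unfolding approx_poly_def by (rule bspec)
qed

text \<open>The norm estimate carries the weight t <= R; its square root is the factor
  \<open>sqrt R\<close>.\<close>

lemma box_poly_diff_le:
  assumes "\<And>t. t \<in> {0..R} \<Longrightarrow> cmod (poly p (complex_of_real t) - poly q (complex_of_real t)) \<le> e"
  shows "norm (box_poly x p - box_poly x q) \<le> e * sqrt R"
proof -
  have e: "0 \<le> e" using order_trans[OF norm_ge_zero assms[of 0]] R by simp
  have "t * (cmod (poly (p - q) (complex_of_real t)))\<^sup>2 \<le> e\<^sup>2 * R" if "0 \<le> t" "t \<le> R" for t
    using assms[of t] that by (subst mult.commute) (intro mult_mono power_mono, auto)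
  from norm_box_poly[OF this] have "(norm (box_poly x p - box_poly x q))\<^sup>2 \<le> (e * sqrt R)\<^sup>2"
    using R by (simp add: op_poly_diff[OF linear_right] power_mult_distrib)
  then show ?thesis by (rule power2_le_imp_le) (use e R in simp)
qed

lemma box_poly_approx_tendsto:
  assumes f: "cts f"
  shows "(\<lambda>n. box_poly x (approx_poly f n)) \<longlonglongrightarrow> fc f"
proof -
  have le: "norm (box_poly x (approx_poly f m) - box_poly x (approx_poly f n)) \<le> 2 * inverse (real (Suc N)) * sqrt R"
    if "m \<ge> N" "n \<ge> N" for m n N
  proof (rule box_poly_diff_le)
    fix t assume t: "t \<in> {0..R}"
    have "inverse (real (Suc k)) \<le> inverse (real (Suc N))" if "k \<ge> N" for k using that by simp
    then have "cmod (f t - poly (approx_poly f k) (complex_of_real t)) \<le> inverse (real (Suc N))" if "k \<ge> N" for k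
      using less_imp_le[OF approx_poly[OF f t, of k]] that order_trans by blast
    from this[OF that(1)] this[OF that(2)]
    show "cmod (poly (approx_poly f m) (complex_of_real t) - poly (approx_poly f n) (complex_of_real t))
        \<le> 2 * inverse (real (Suc N))"
      using norm_triangle_ineq4[of "f t - poly (approx_poly f n) (complex_of_real t)"
          "f t - poly (approx_poly f m) (complex_of_real t)"] by simp
  qed
  have "Cauchy (\<lambda>n. box_poly x (approx_poly f n))"
  proof (rule metric_CauchyI)
    fix e :: real assume "0 < e"
    have "(\<lambda>N. 2 * inverse (real (Suc N)) * sqrt R) \<longlonglongrightarrow> 2 * 0 * sqrt R"
      by (intro tendsto_intros LIMSEQ_inverse_real_of_nat)
    then have "eventually (\<lambda>N. 2 * inverse (real (Suc N)) * sqrt R < e) sequentially"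
      using \<open>0 < e\<close> by (intro order_tendstoD) simp_all
    then obtain N where N: "2 * inverse (real (Suc N)) * sqrt R < e"
      unfolding eventually_sequentially by blast
    show "\<exists>N. \<forall>m\<ge>N. \<forall>n\<ge>N. dist (box_poly x (approx_poly f m)) (box_poly x (approx_poly f n)) < e"
      unfolding dist_norm using le_less_trans[OF le N] by blast
  qed
  then show ?thesis unfolding fc_def using Cauchy_convergent convergent_LIMSEQ_iff by blast
qed

lemma fc_poly_dist:
  assumes f: "cts f" and p: "\<And>t. t \<in> {0..R} \<Longrightarrow> cmod (f t - poly p (complex_of_real t)) \<le> e"
  shows "norm (fc f - box_poly x p) \<le> e * sqrt R"
proof (rule LIMSEQ_le)
  show "(\<lambda>n. norm (box_poly x (approx_poly f n) - box_poly x p)) \<longlonglongrightarrow> norm (fc f - box_poly x p)"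
    by (intro tendsto_intros box_poly_approx_tendsto f)
  have "(\<lambda>n. (inverse (real (Suc n)) + e) * sqrt R) \<longlonglongrightarrow> (0 + e) * sqrt R"
    by (intro tendsto_intros LIMSEQ_inverse_real_of_nat)
  then show "(\<lambda>n. (inverse (real (Suc n)) + e) * sqrt R) \<longlonglongrightarrow> e * sqrt R" by simp
  have "norm (box_poly x (approx_poly f n) - box_poly x p) \<le> (inverse (real (Suc n)) + e) * sqrt R" for n
  proof (rule box_poly_diff_le)
    fix t assume t: "t \<in> {0..R}"
    show "cmod (poly (approx_poly f n) (complex_of_real t) - poly p (complex_of_real t)) \<le> inverse (real (Suc n)) + e"
      using norm_triangle_ineq4[of "f t - poly p (complex_of_real t)" "f t - poly (approx_poly f n) (complex_of_real t)"]
        approx_poly[OF f t, of n] p[OF t] by simp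
  qed
  then show "\<exists>N. \<forall>n\<ge>N. norm (box_poly x (approx_poly f n) - box_poly x p) \<le> (inverse (real (Suc n)) + e) * sqrt R"
    by blast
qed

lemma fc_uniform_limit:
  assumes f: "cts f" and lim: "uniform_limit {0..R} (\<lambda>n t. poly (p n) (complex_of_real t)) f sequentially"
  shows "(\<lambda>n. box_poly x (p n)) \<longlonglongrightarrow> fc f"
proof (rule LIMSEQ_I)
  fix e :: real assume "0 < e"
  then have e: "e / (2 * sqrt R) > 0" using R by simp
  from uniform_limitD[OF lim this]
  obtain N where N: "\<And>n t. n \<ge> N \<Longrightarrow> t \<in> {0..R} \<Longrightarrow> dist (poly (p n) (complex_of_real t)) (f t) < e / (2 * sqrt R)"
    unfolding eventually_sequentially by blast
  have "norm (fc f - box_poly x (p n)) \<le> e / (2 * sqrt R) * sqrt R" if "n \<ge> N" for n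
    using less_imp_le[OF N[OF that]] by (intro fc_poly_dist[OF f]) (simp add: dist_norm norm_minus_commute[of "f _"])
  then have le: "norm (box_poly x (p n) - fc f) \<le> e / 2" if "n \<ge> N" for n
    using R that by (simp add: norm_minus_commute)
  have "norm (box_poly x (p n) - fc f) < e" if "n \<ge> N" for n
    using \<open>0 < e\<close> le[OF that] by simp
  then show "\<exists>N. \<forall>n\<ge>N. norm (box_poly x (p n) - fc f) < e"
    by blast
qed

lemma approx_poly_uniform_limit:
  assumes f: "cts f"
  shows "uniform_limit {0..R} (\<lambda>n t. poly (approx_poly f n) (complex_of_real t)) f sequentially"
proof (rule uniform_limitI)
  fix e :: real assume "0 < e"
  then have "eventually (\<lambda>n. inverse (real (Suc n)) < e) sequentially"
    by (rule order_tendstoD(2)[OF LIMSEQ_inverse_real_of_nat])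
  then show "\<forall>\<^sub>F n in sequentially. \<forall>t\<in>{0..R}. dist (poly (approx_poly f n) (complex_of_real t)) (f t) < e"
  proof eventually_elim
    case (elim n)
    show ?case
      using less_trans[OF approx_poly[OF f] elim] by (simp add: dist_norm norm_minus_commute[of _ "f _"] del: of_nat_Suc)
  qed
qed

lemma fc_poly: "fc (\<lambda>t. poly p (complex_of_real t)) = box_poly x p"
proof -
  have "cts (\<lambda>t. poly p (complex_of_real t))" by (intro continuous_intros)
  from fc_poly_dist[OF this, of p 0] show ?thesis by simp
qed

lemma fc_one: "fc (\<lambda>t. 1) = x"
  using fc_poly[of 1] by (simp add: op_poly_1[OF linear_right])

lemma fc_zero: "fc (\<lambda>t. 0) = 0"
  using fc_poly[of 0] by simp

lemma fc_add:
  assumes "cts f" "cts g" shows "fc (\<lambda>t. f t + g t) = fc f + fc g"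
proof -
  have "uniform_limit {0..R} (\<lambda>n t. poly (approx_poly f n + approx_poly g n) (complex_of_real t)) (\<lambda>t. f t + g t) sequentially"
    using uniform_limit_add[OF approx_poly_uniform_limit[OF assms(1)] approx_poly_uniform_limit[OF assms(2)]] by simp
  moreover have "cts (\<lambda>t. f t + g t)" by (intro continuous_intros assms)
  ultimately have "(\<lambda>n. box_poly x (approx_poly f n + approx_poly g n)) \<longlonglongrightarrow> fc (\<lambda>t. f t + g t)"
    by (rule fc_uniform_limit[rotated])
  moreover have "(\<lambda>n. box_poly x (approx_poly f n + approx_poly g n)) \<longlonglongrightarrow> fc f + fc g"
    unfolding op_poly_add[OF linear_right] by (intro tendsto_add box_poly_approx_tendsto assms)
  ultimately show ?thesis by (rule LIMSEQ_unique)
qed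

lemma fc_triple:
  assumes "cts f" "cts g" "cts h"
  shows "tp (fc f) (fc g) (fc h) = fc (\<lambda>t. complex_of_real t * f t * cnj (g t) * h t)"
proof -
  let ?p = "\<lambda>n. [:0, 1:] * approx_poly f n * map_poly cnj (approx_poly g n) * approx_poly h n"
  have bdd: "bounded (k ` {0..R})" if "cts k" for k :: "real \<Rightarrow> complex"
    using compact_continuous_image[OF that] compact_Icc compact_imp_bounded by blast
  have cnj_lim: "uniform_limit {0..R} (\<lambda>n t. cnj (poly (approx_poly g n) (complex_of_real t))) (\<lambda>t. cnj (g t)) sequentially"
    using approx_poly_uniform_limit[OF assms(2)]
    by (simp add: uniform_limit_iff dist_norm flip: complex_cnj_diff)
  have "uniform_limit {0..R} (\<lambda>n t. complex_of_real t * poly (approx_poly f n) (complex_of_real t)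
      * cnj (poly (approx_poly g n) (complex_of_real t)) * poly (approx_poly h n) (complex_of_real t))
      (\<lambda>t. complex_of_real t * f t * cnj (g t) * h t) sequentially"
    by (intro uniform_lim_mult uniform_limit_const approx_poly_uniform_limit cnj_lim bdd assms continuous_intros)
  then have "uniform_limit {0..R} (\<lambda>n t. poly (?p n) (complex_of_real t))
      (\<lambda>t. complex_of_real t * f t * cnj (g t) * h t) sequentially"
    by (simp add: mult_ac)
  moreover have "cts (\<lambda>t. complex_of_real t * f t * cnj (g t) * h t)" by (intro continuous_intros assms)
  ultimately have "(\<lambda>n. box_poly x (?p n)) \<longlonglongrightarrow> fc (\<lambda>t. complex_of_real t * f t * cnj (g t) * h t)"
    by (rule fc_uniform_limit[rotated])
  moreover have "(\<lambda>n. box_poly x (?p n)) \<longlonglongrightarrow> tp (fc f) (fc g) (fc h)"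
    unfolding box_poly_triple[symmetric] by (intro tendsto_tp box_poly_approx_tendsto assms)
  ultimately show ?thesis using LIMSEQ_unique by blast
qed

text \<open>The box operator of two functions of x depends only on the product of the first with the
  conjugate of the second. This allows all box operators to be indexed by one function, as in
  \<open>Lo\<close>.\<close>

lemma fc_box:
  assumes "cts f" "cts g"
  shows "tp (fc f) (fc g) z = tp (fc (\<lambda>t. f t * cnj (g t))) x z"
proof -
  let ?p = "\<lambda>n. approx_poly f n * map_poly cnj (approx_poly g n)"
  have bdd: "bounded (k ` {0..R})" if "cts k" for k :: "real \<Rightarrow> complex"
    using compact_continuous_image[OF that] compact_Icc compact_imp_bounded by blast
  have cnj_lim: "uniform_limit {0..R} (\<lambda>n t. cnj (poly (approx_poly g n) (complex_of_real t))) (\<lambda>t. cnj (g t)) sequentially"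
    using approx_poly_uniform_limit[OF assms(2)]
    by (simp add: uniform_limit_iff dist_norm flip: complex_cnj_diff)
  have "uniform_limit {0..R} (\<lambda>n t. poly (approx_poly f n) (complex_of_real t)
      * cnj (poly (approx_poly g n) (complex_of_real t))) (\<lambda>t. f t * cnj (g t)) sequentially"
    by (intro uniform_lim_mult approx_poly_uniform_limit cnj_lim bdd assms continuous_intros)
  then have "uniform_limit {0..R} (\<lambda>n t. poly (?p n) (complex_of_real t)) (\<lambda>t. f t * cnj (g t)) sequentially"
    by simp
  moreover have "cts (\<lambda>t. f t * cnj (g t))" by (intro continuous_intros assms)
  ultimately have "(\<lambda>n. box_poly x (?p n)) \<longlonglongrightarrow> fc (\<lambda>t. f t * cnj (g t))"
    by (rule fc_uniform_limit[rotated])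
  then have "(\<lambda>n. tp (box_poly x (?p n)) x z) \<longlonglongrightarrow> tp (fc (\<lambda>t. f t * cnj (g t))) x z"
    by (intro tendsto_tp tendsto_const)
  moreover have "(\<lambda>n. tp (box_poly x (?p n)) x z) \<longlonglongrightarrow> tp (fc f) (fc g) z"
    unfolding box_poly_box[symmetric] by (intro tendsto_tp tendsto_const box_poly_approx_tendsto assms)
  ultimately show ?thesis using LIMSEQ_unique by blast
qed

lemma fc_scaleC:
  assumes "cts f" shows "fc (\<lambda>t. c * f t) = c *\<^sub>C fc f"
proof -
  have "uniform_limit {0..R} (\<lambda>n t. poly (smult c (approx_poly f n)) (complex_of_real t)) (\<lambda>t. c * f t) sequentially"
    using bounded_linear.uniform_limit[OF bounded_linear_mult_right approx_poly_uniform_limit[OF assms]] by simp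
  moreover have "cts (\<lambda>t. c * f t)" by (intro continuous_intros assms)
  ultimately have "(\<lambda>n. box_poly x (smult c (approx_poly f n))) \<longlonglongrightarrow> fc (\<lambda>t. c * f t)"
    by (rule fc_uniform_limit[rotated])
  moreover have "(\<lambda>n. box_poly x (smult c (approx_poly f n))) \<longlonglongrightarrow> c *\<^sub>C fc f"
    unfolding op_poly_smult[OF linear_right] by (intro tendsto_scaleC box_poly_approx_tendsto assms)
  ultimately show ?thesis by (rule LIMSEQ_unique)
qed

lemma fc_diff:
  assumes "cts f" "cts g" shows "fc (\<lambda>t. f t - g t) = fc f - fc g"
proof -
  have "cts (\<lambda>t. - 1 * g t)" by (intro continuous_intros assms)
  from fc_add[OF assms(1) this] fc_scaleC[OF assms(2), of "-1"] show ?thesis by simp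
qed

lemma norm_fc_le:
  assumes "cts f" "\<And>t. 0 \<le> t \<Longrightarrow> t \<le> R \<Longrightarrow> cmod (f t) \<le> M"
  shows "norm (fc f) \<le> M * sqrt R"
  using fc_poly_dist[OF assms(1), of 0 M] assms(2) by simp

end

section \<open>Operator calculus\<close>

context triple_element
begin

definition Lo :: "(real \<Rightarrow> complex) \<Rightarrow> 'z \<Rightarrow> 'z"
  where "Lo f z = tp (fc f) x z"

definition Qo :: "(real \<Rightarrow> complex) \<Rightarrow> (real \<Rightarrow> complex) \<Rightarrow> 'z \<Rightarrow> 'z"
  where "Qo f g z = tp (fc f) z (fc g)"

lemma Lo_cong: "(\<And>t. 0 \<le> t \<Longrightarrow> t \<le> R \<Longrightarrow> f t = g t) \<Longrightarrow> Lo f z = Lo g z"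
  unfolding Lo_def using fc_cong[of f g] by simp

lemma Qo_cong:
  "(\<And>t. 0 \<le> t \<Longrightarrow> t \<le> R \<Longrightarrow> f t = f' t) \<Longrightarrow> (\<And>t. 0 \<le> t \<Longrightarrow> t \<le> R \<Longrightarrow> g t = g' t) \<Longrightarrow>
   Qo f g z = Qo f' g' z"
  unfolding Qo_def using fc_cong[of f f'] fc_cong[of g g'] by simp

lemma Lo_lin:
  "Lo f (z + w) = Lo f z + Lo f w" "Lo f (z - w) = Lo f z - Lo f w"
  "Lo f (c *\<^sub>C z) = c *\<^sub>C Lo f z" "Lo f 0 = 0" "Lo f (- z) = - Lo f z"
  by (simp_all add: Lo_def tp_add tp_diff tp_scaleC tp_minus)

lemma Qo_antilin:
  "Qo f g (z + w) = Qo f g z + Qo f g w" "Qo f g (z - w) = Qo f g z - Qo f g w"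
  "Qo f g (c *\<^sub>C z) = cnj c *\<^sub>C Qo f g z" "Qo f g 0 = 0" "Qo f g (- z) = - Qo f g z"
  by (simp_all add: Qo_def tp_add tp_diff tp_scaleC tp_minus)

lemma Lo_zero: "(\<And>t. 0 \<le> t \<Longrightarrow> t \<le> R \<Longrightarrow> f t = 0) \<Longrightarrow> Lo f z = 0"
  using Lo_cong[of f "\<lambda>t. 0"] by (simp add: Lo_def fc_zero)

lemma Qo_zero:
  "(\<And>t. 0 \<le> t \<Longrightarrow> t \<le> R \<Longrightarrow> f t = 0) \<Longrightarrow> Qo f g z = 0"
  "(\<And>t. 0 \<le> t \<Longrightarrow> t \<le> R \<Longrightarrow> g t = 0) \<Longrightarrow> Qo f g z = 0"
  using Qo_cong[of f "\<lambda>t. 0" g g] Qo_cong[of f f g "\<lambda>t. 0"] by (simp_all add: Qo_def fc_zero)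

lemma Qo_sym: "Qo f g z = Qo g f z"
  by (simp add: Qo_def outer_symmetric[of _ z])

lemma fc_box_Lo: "cts f \<Longrightarrow> cts g \<Longrightarrow> tp (fc f) (fc g) z = Lo (\<lambda>t. f t * cnj (g t)) z"
  unfolding Lo_def by (rule fc_box)

lemma x_box_Lo: "cts g \<Longrightarrow> tp x (fc g) z = Lo (\<lambda>t. cnj (g t)) z"
  using fc_box_Lo[of "\<lambda>t. 1" g z] by (simp add: fc_one)

lemma Lo_fc: "cts f \<Longrightarrow> cts g \<Longrightarrow> Lo f (fc g) = fc (\<lambda>t. complex_of_real t * f t * g t)"
  using fc_triple[of f "\<lambda>t. 1" g] by (simp add: fc_one Lo_def)

text \<open>By the Jordan identity the commutator is a difference of two box operators, and both
  have the symbol t f g.\<close>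

lemma Lo_commute:
  assumes "cts f" "cts g" shows "Lo f (Lo g z) = Lo g (Lo f z)"
proof -
  have "tp x (fc f) x = fc (\<lambda>t. complex_of_real t * cnj (f t))"
    using fc_triple[OF _ assms(1), of "\<lambda>t. 1" "\<lambda>t. 1"] by (simp add: fc_one)
  moreover have "cts (\<lambda>t. complex_of_real t * cnj (f t))" by (intro continuous_intros assms)
  ultimately have "tp (fc g) (tp x (fc f) x) z = Lo (\<lambda>t. g t * cnj (complex_of_real t * cnj (f t))) z"
    using fc_box_Lo[OF assms(2)] by simp
  also have "\<dots> = Lo (\<lambda>t. complex_of_real t * f t * g t) z" by (rule Lo_cong) simp
  also have "\<dots> = tp (tp (fc f) x (fc g)) x z"
    using Lo_fc[OF assms] by (simp add: Lo_def)
  finally show ?thesis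
    using jordan_commutator[of "fc f" x "fc g" x z] by (simp add: Lo_def)
qed

lemma Qo_Qo:
  assumes "cts f" "cts g" "cts h" "cts k"
  shows "Qo f h (Qo g k z) = Lo (\<lambda>t. h t * cnj (k t)) (Lo (\<lambda>t. f t * cnj (g t)) z)
     + Lo (\<lambda>t. f t * cnj (k t)) (Lo (\<lambda>t. h t * cnj (g t)) z)
     - Lo (\<lambda>t. complex_of_real t * f t * h t * cnj (g t) * cnj (k t)) z"
proof -
  have "tp (tp (fc f) (fc k) (fc h)) (fc g) z
      = Lo (\<lambda>t. (complex_of_real t * f t * cnj (k t) * h t) * cnj (g t)) z"
    using assms by (subst fc_triple) (auto intro!: fc_box_Lo continuous_intros)
  also have "\<dots> = Lo (\<lambda>t. complex_of_real t * f t * h t * cnj (g t) * cnj (k t)) z"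
    by (rule Lo_cong) simp
  finally show ?thesis
    using tp_tp_middle[of "fc f" "fc g" z "fc k" "fc h"]
    by (simp add: Qo_def fc_box_Lo assms)
qed

lemma Qo_11: "Qo (\<lambda>t. 1) (\<lambda>t. 1) z = tp x z x"
  by (simp add: Qo_def fc_one)

text \<open>\<open>C\<close> measures the failure of the identity. It vanishes for f = g = 1 by the
  cube identity; the linearized identity with two arguments 1 gives 2 C p f 1 = 0, and with one
  argument 1 the general case.\<close>

lemma Lo_Qo_commute:
  assumes p: "cts p" and f: "cts f" and g: "cts g"
  shows "Lo p (Qo f g z) = Qo f g (Lo (\<lambda>t. cnj (p t)) z)"
proof -
  define C where "C p f g = Lo p (Qo f g z) - Qo f g (Lo (\<lambda>t. cnj (p t)) z)" for p f g
  have one: "cts (\<lambda>t. 1)" by simp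
  have C1: "C p (\<lambda>t. 1) (\<lambda>t. 1) = 0" if p: "cts p" for p
  proof -
    have "cts (\<lambda>t. cnj (p t))" by (intro continuous_intros p)
    from jordan_cube[of x "fc (\<lambda>t. cnj (p t))" z] x_box_Lo[OF this]
    show ?thesis by (simp add: C_def Qo_11 Lo_def)
  qed
  have key: "C (\<lambda>t. f t * p t) g h + C (\<lambda>t. g t * p t) f h + C (\<lambda>t. h t * p t) f g = 0"
    if cts: "cts p" "cts f" "cts g" "cts h" for p f g h
  proof -
    have p': "cts (\<lambda>t. cnj (p t))" by (intro continuous_intros cts)
    have box: "tp (fc k) (fc (\<lambda>t. cnj (p t))) w = Lo (\<lambda>t. k t * p t) w"
      "tp (fc (\<lambda>t. cnj (p t))) (fc k) w = Lo (\<lambda>t. cnj (k t * p t)) w" if "cts k" for k w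
      using fc_box_Lo[OF that p'] fc_box_Lo[OF p' that] by (simp_all add: mult.commute)
    show ?thesis
      using jordan_cube_linearized[of "fc f" "fc (\<lambda>t. cnj (p t))" "fc g" z "fc h"]
      unfolding box[OF cts(2)] box[OF cts(3)] box[OF cts(4)] C_def Qo_def .
  qed
  have C2: "C p f (\<lambda>t. 1) = 0" if "cts p" "cts f" for p f
  proof -
    have "cts (\<lambda>t. f t * p t)" by (intro continuous_intros that)
    from key[OF that one one] C1[OF this] have "C p f (\<lambda>t. 1) + C p f (\<lambda>t. 1) = 0"
      by simp
    then have "2 *\<^sub>R C p f (\<lambda>t. 1) = 0" by (simp only: scaleR_2)
    then show ?thesis by simp
  qed
  have "cts (\<lambda>t. f t * p t)" "cts (\<lambda>t. g t * p t)" by (intro continuous_intros assms)+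
  from key[OF assms one] C2[OF this(1) g] C2[OF this(2) f] show ?thesis by (simp add: C_def)
qed

text \<open>In the Jordan identity the middle term carries \<open>Lo\<close> of the conjugate inside
  Q. Moving it outside turns it into a second copy of the left side, whence the factor 2.\<close>

lemma Lo_Qo:
  assumes p: "cts p" and f: "cts f" and g: "cts g"
  shows "2 *\<^sub>R Lo p (Qo f g z) = Qo (\<lambda>t. complex_of_real t * p t * f t) g z
    + Qo f (\<lambda>t. complex_of_real t * p t * g t) z"
proof -
  have "Lo p (Qo f g z) = Qo (\<lambda>t. complex_of_real t * p t * f t) g z
      - Qo f g (Lo (\<lambda>t. cnj (p t)) z) + Qo f (\<lambda>t. complex_of_real t * p t * g t) z"
    using jordan_identity[of "fc p" x "fc f" z "fc g"] x_box_Lo[OF p, of z] Lo_fc[OF p f] Lo_fc[OF p g]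
    by (simp add: Lo_def Qo_def)
  then show ?thesis
    unfolding Lo_Qo_commute[OF assms, symmetric] by (simp add: scaleR_2 algebra_simps)
qed

text \<open>In terms of half-sums this is the identity that writes (p1+p2)(f1+f2)(g1+g2) through the
  sums of products p1 f1 + p2 f2 and so on. It arises by applying \<open>Lo_Qo\<close> to Q(f,g)
  Q(1,1), a product that \<open>Qo_Qo\<close> expresses by \<open>Lo\<close> alone.\<close>

lemma Lo_Lo_Lo:
  assumes p: "cts p" and f: "cts f" and g: "cts g"
  shows "2 *\<^sub>R Lo p (Lo f (Lo g z)) = Lo (\<lambda>t. complex_of_real t * p t * f t) (Lo g z)
    + Lo (\<lambda>t. complex_of_real t * p t * g t) (Lo f z) + Lo (\<lambda>t. complex_of_real t * f t * g t) (Lo p z)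
    - Lo (\<lambda>t. complex_of_real t * complex_of_real t * p t * f t * g t) z"
proof -
  have one: "cts (\<lambda>t. 1)" by simp
  have QQ: "Qo f g (Qo (\<lambda>t. 1) (\<lambda>t. 1) z) = 2 *\<^sub>R Lo f (Lo g z) - Lo (\<lambda>t. complex_of_real t * f t * g t) z"
    if "cts f" "cts g" for f g
    using Qo_Qo[OF that(1) one that(2) one, of z] Lo_commute[OF that, of z] by (simp add: scaleR_2)
  let ?pf = "\<lambda>t. complex_of_real t * p t * f t" and ?pg = "\<lambda>t. complex_of_real t * p t * g t"
  have pf: "cts ?pf" and pg: "cts ?pg" and fg: "cts (\<lambda>t. complex_of_real t * f t * g t)"
    by (intro continuous_intros assms)+
  have "2 *\<^sub>R (2 *\<^sub>R Lo p (Lo f (Lo g z)) - Lo p (Lo (\<lambda>t. complex_of_real t * f t * g t) z))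
      = 2 *\<^sub>R Lo p (Qo f g (Qo (\<lambda>t. 1) (\<lambda>t. 1) z))"
    unfolding QQ[OF f g] by (simp add: scaleR_2 Lo_lin)
  also have "\<dots> = (2 *\<^sub>R Lo ?pf (Lo g z) - Lo (\<lambda>t. complex_of_real t * ?pf t * g t) z)
      + (2 *\<^sub>R Lo f (Lo ?pg z) - Lo (\<lambda>t. complex_of_real t * f t * ?pg t) z)"
    by (simp only: Lo_Qo[OF assms] QQ[OF pf g] QQ[OF f pg])
  also have "Lo (\<lambda>t. complex_of_real t * ?pf t * g t) z = Lo (\<lambda>t. complex_of_real t * complex_of_real t * p t * f t * g t) z"
    by (rule Lo_cong) simp
  also have "Lo (\<lambda>t. complex_of_real t * f t * ?pg t) z = Lo (\<lambda>t. complex_of_real t * complex_of_real t * p t * f t * g t) z"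
    by (rule Lo_cong) simp
  finally have "2 *\<^sub>R (2 *\<^sub>R Lo p (Lo f (Lo g z)) - Lo p (Lo (\<lambda>t. complex_of_real t * f t * g t) z))
      = 2 *\<^sub>R (Lo ?pf (Lo g z) + Lo f (Lo ?pg z)
        - Lo (\<lambda>t. complex_of_real t * complex_of_real t * p t * f t * g t) z)"
    by (simp add: scaleR_2 algebra_simps)
  then have "2 *\<^sub>R Lo p (Lo f (Lo g z)) - Lo p (Lo (\<lambda>t. complex_of_real t * f t * g t) z)
      = Lo ?pf (Lo g z) + Lo f (Lo ?pg z)
        - Lo (\<lambda>t. complex_of_real t * complex_of_real t * p t * f t * g t) z"
    by simp
  then show ?thesis
    unfolding Lo_commute[OF f pg] Lo_commute[OF p fg] by (simp add: algebra_simps)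
qed

end

section \<open>The defect of a local derivation on unitary-like elements\<close>

lemma clinear_derivation: "triple_derivation tp d \<Longrightarrow> clinear d"
  and derivation_tp: "triple_derivation tp d \<Longrightarrow> d (tp a b c) = tp (d a) b c + tp a (d b) c + tp a b (d c)"
  by (simp_all add: triple_derivation_def)

locale local_derivation = triple_element tp x B R
  for tp :: "'z::complex_banach \<Rightarrow> 'z \<Rightarrow> 'z \<Rightarrow> 'z" and x B R +
  fixes \<delta> :: "'z \<Rightarrow> 'z"
  assumes local: "local_triple_derivation tp \<delta>" and continuous: "continuous_on UNIV \<delta>"
begin

lemma \<delta>_clinear: "clinear \<delta>"
  using local by (simp add: local_triple_derivation_def)

lemma local_obtain: obtains d where "triple_derivation tp d" "d a = \<delta> a"
  using local unfolding local_triple_derivation_def by blast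

lemma tendsto_\<delta>: "(f \<longlongrightarrow> a) F \<Longrightarrow> ((\<lambda>n. \<delta> (f n)) \<longlongrightarrow> \<delta> a) F"
  using continuous_on_tendsto_compose[OF continuous] by simp

definition defect :: "'z \<Rightarrow> 'z \<Rightarrow> 'z \<Rightarrow> 'z"
  where "defect a b c = tp (\<delta> a) b c + tp a (\<delta> b) c + tp a b (\<delta> c) - \<delta> (tp a b c)"

lemma defect_add:
  "defect (a + a') b c = defect a b c + defect a' b c"
  "defect a (b + b') c = defect a b c + defect a b' c"
  "defect a b (c + c') = defect a b c + defect a b c'"
  by (simp_all add: defect_def tp_add clinear_simps[OF \<delta>_clinear])

lemma defect_scaleC:
  "defect (k *\<^sub>C a) b c = k *\<^sub>C defect a b c"
  "defect a (k *\<^sub>C b) c = cnj k *\<^sub>C defect a b c"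
  "defect a b (k *\<^sub>C c) = k *\<^sub>C defect a b c"
  by (simp_all add: defect_def tp_scaleC clinear_simps[OF \<delta>_clinear] scaleC_add_right
      scaleC.scale_right_diff_distrib)

lemma defect_scaleR:
  "defect (k *\<^sub>R a) b c = k *\<^sub>R defect a b c"
  "defect a (k *\<^sub>R b) c = k *\<^sub>R defect a b c"
  "defect a b (k *\<^sub>R c) = k *\<^sub>R defect a b c"
  by (simp_all add: defect_scaleC flip: scaleC_of_real)

lemma defect_sym: "defect a b c = defect c b a"
  by (simp add: defect_def outer_symmetric[of _ b] outer_symmetric[of _ "\<delta> b"])

lemma tendsto_defect:
  assumes "(f \<longlongrightarrow> a) F" "(g \<longlongrightarrow> b) F" "(h \<longlongrightarrow> c) F"
  shows "((\<lambda>n. defect (f n) (g n) (h n)) \<longlongrightarrow> defect a b c) F"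
  unfolding defect_def by (intro tendsto_add tendsto_diff tendsto_tp tendsto_\<delta> assms)

lemma orthogonal_box:
  assumes "cts f" "cts g" "\<And>t. 0 \<le> t \<Longrightarrow> t \<le> R \<Longrightarrow> f t = 0 \<or> g t = 0"
  shows "tp (fc f) (fc g) z = 0"
  unfolding fc_box_Lo[OF assms(1,2)] by (rule Lo_zero) (use assms(3) in force)

definition supported :: "real \<Rightarrow> (real \<Rightarrow> complex) \<Rightarrow> bool"
  where "supported \<eta> f \<longleftrightarrow> cts f \<and> (\<forall>t. 0 \<le> t \<longrightarrow> t \<le> R \<longrightarrow> t < \<eta> \<longrightarrow> f t = 0)"

text \<open>An element \<open>fc e\<close> with \<open>plateau \<eta> e\<close> behaves like a tripotent on the part \<open>t \<ge> \<eta>\<close> of the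
  spectrum. The space \<open>nullspace \<eta>\<close> is a substitute for the kernel of the corresponding Peirce-2
  projection.\<close>

definition plateau :: "real \<Rightarrow> (real \<Rightarrow> complex) \<Rightarrow> bool"
  where "plateau \<eta> e \<longleftrightarrow> cts e \<and>
    (\<forall>t. 0 \<le> t \<longrightarrow> t \<le> R \<longrightarrow> \<eta> \<le> t \<longrightarrow> complex_of_real t * e t * cnj (e t) = 1)"

definition nullspace :: "real \<Rightarrow> 'z set"
  where "nullspace \<eta> = {z. \<forall>f g. supported \<eta> f \<longrightarrow> supported \<eta> g \<longrightarrow> Qo f g z = 0}"

lemma nullspaceI: "(\<And>f g. supported \<eta> f \<Longrightarrow> supported \<eta> g \<Longrightarrow> Qo f g z = 0) \<Longrightarrow> z \<in> nullspace \<eta>"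
  and nullspaceD: "z \<in> nullspace \<eta> \<Longrightarrow> supported \<eta> f \<Longrightarrow> supported \<eta> g \<Longrightarrow> Qo f g z = 0"
  by (simp_all add: nullspace_def)

lemma nullspace_add: "z \<in> nullspace \<eta> \<Longrightarrow> w \<in> nullspace \<eta> \<Longrightarrow> z + w \<in> nullspace \<eta>"
  and nullspace_diff: "z \<in> nullspace \<eta> \<Longrightarrow> w \<in> nullspace \<eta> \<Longrightarrow> z - w \<in> nullspace \<eta>"
  and nullspace_scaleC: "z \<in> nullspace \<eta> \<Longrightarrow> c *\<^sub>C z \<in> nullspace \<eta>"
  by (simp_all add: nullspace_def Qo_antilin)

lemma nullspace_scaleR: "z \<in> nullspace \<eta> \<Longrightarrow> c *\<^sub>R z \<in> nullspace \<eta>"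
  using nullspace_scaleC[of z \<eta> "complex_of_real c"] by (simp add: scaleC_of_real)

lemma nullspace_closed:
  assumes "\<And>n. f n \<in> nullspace \<eta>" "f \<longlonglongrightarrow> z" shows "z \<in> nullspace \<eta>"
proof (rule nullspaceI)
  fix g h assume gh: "supported \<eta> g" "supported \<eta> h"
  have "(\<lambda>n. Qo g h (f n)) \<longlonglongrightarrow> Qo g h z"
    unfolding Qo_def by (intro tendsto_tp tendsto_const assms)
  then show "Qo g h z = 0"
    using nullspaceD[OF assms(1) gh] by (simp add: LIMSEQ_const_iff)
qed

lemma nullspace_Lo:
  assumes p: "cts p" and z: "z \<in> nullspace \<eta>" shows "Lo p z \<in> nullspace \<eta>"
proof (rule nullspaceI)
  fix g h assume gh: "supported \<eta> g" "supported \<eta> h"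
  have "cts (\<lambda>t. cnj (p t))" by (intro continuous_intros p)
  then have "Qo g h (Lo (\<lambda>t. cnj (cnj (p t))) z) = Lo (\<lambda>t. cnj (p t)) (Qo g h z)"
    using gh by (intro Lo_Qo_commute[symmetric]) (auto simp: supported_def)
  then show "Qo g h (Lo p z) = 0" using nullspaceD[OF z gh] by (simp add: Lo_lin)
qed

text \<open>Apply d to {f,w,g} = 0: by orthogonality only the term {f, d w, g} remains.\<close>

lemma nullspace_derivation:
  assumes d: "triple_derivation tp d" and w: "cts w" "\<And>t. 0 \<le> t \<Longrightarrow> t \<le> R \<Longrightarrow> \<eta> \<le> t \<Longrightarrow> w t = 0"
  shows "d (fc w) \<in> nullspace \<eta>"
proof (rule nullspaceI)
  fix f g assume fg: "supported \<eta> f" "supported \<eta> g"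
  then have cts: "cts f" "cts g" by (simp_all add: supported_def)
  have orth: "tp (fc f) (fc w) z = 0" "tp (fc g) (fc w) z = 0" for z
    using fg w by (auto intro!: orthogonal_box cts simp: supported_def)
  have "d (tp (fc f) (fc w) (fc g)) = 0"
    by (simp add: orth clinear_zero[OF clinear_derivation[OF d]])
  then show "Qo f g (d (fc w)) = 0"
    unfolding derivation_tp[OF d] by (simp add: orth outer_symmetric[of _ "fc w" "fc g"] Qo_def)
qed

lemma nullspace_\<delta>:
  assumes w: "cts w" "\<And>t. 0 \<le> t \<Longrightarrow> t \<le> R \<Longrightarrow> \<eta> \<le> t \<Longrightarrow> w t = 0"
  shows "\<delta> (fc w) \<in> nullspace \<eta>"
proof -
  obtain d where "triple_derivation tp d" "d (fc w) = \<delta> (fc w)" by (rule local_obtain)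
  then show ?thesis using nullspace_derivation[OF _ w, of d] by simp
qed

text \<open>D(e,e) is the identity on the range of each Q(f,g) with f, g supported in the plateau
  region, because there t |e|^2 f = f; and it can be moved through Q(f,g).\<close>

lemma nullspace_plateau:
  assumes e: "plateau \<eta> e" shows "Lo (\<lambda>t. e t * cnj (e t)) z - z \<in> nullspace \<eta>"
proof (rule nullspaceI)
  fix f g assume fg: "supported \<eta> f" "supported \<eta> g"
  let ?p = "\<lambda>t. e t * cnj (e t)"
  have cts: "cts f" "cts g" "cts ?p"
    using fg e by (auto simp: supported_def plateau_def intro!: continuous_intros)
  have eq: "complex_of_real t * ?p t * k t = k t" if "supported \<eta> k" "0 \<le> t" "t \<le> R" for t k
    using that e by (cases "t < \<eta>") (auto simp: supported_def plateau_def mult.assoc[symmetric])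
  have "2 *\<^sub>R Lo ?p (Qo f g z) = Qo f g z + Qo f g z"
    unfolding Lo_Qo[OF cts(3,1,2)]
    by (intro arg_cong2[of _ _ _ _ plus] Qo_cong eq fg refl)
  then have "Lo ?p (Qo f g z) = Qo f g z" by (simp add: scaleR_2[symmetric])
  moreover have "Lo ?p (Qo f g z) = Qo f g (Lo ?p z)"
    using Lo_Qo_commute[OF cts(3,1,2)] by (simp add: mult.commute)
  ultimately show "Qo f g (Lo ?p z - z) = 0" by (simp add: Qo_antilin)
qed

text \<open>Each term of \<open>Qo_Qo\<close> contains the product of f or g with the conjugate of
  w, which is 0.\<close>

lemma nullspace_Qo:
  assumes w: "cts w" "\<And>t. 0 \<le> t \<Longrightarrow> t \<le> R \<Longrightarrow> \<eta> \<le> t \<Longrightarrow> w t = 0" and e: "cts e"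
  shows "Qo w e z \<in> nullspace \<eta>"
proof (rule nullspaceI)
  fix f g assume fg: "supported \<eta> f" "supported \<eta> g"
  have cts: "cts f" "cts g" using fg by (auto simp: supported_def)
  have zero: "f t * cnj (w t) = 0" "g t * cnj (w t) = 0" if "0 \<le> t" "t \<le> R" for t
    using fg w(2) that by (auto simp: supported_def)
  have "Lo (\<lambda>t. f t * cnj (w t)) z = 0" "Lo (\<lambda>t. g t * cnj (w t)) z = 0"
    "Lo (\<lambda>t. complex_of_real t * f t * g t * cnj (w t) * cnj (e t)) z = 0"
    by (rule Lo_zero, use zero in force)+
  then show "Qo f g (Qo w e z) = 0"
    by (simp add: Qo_Qo[OF cts(1) w(1) cts(2) e] Lo_lin)
qed

text \<open>Modulo the nullspace, \<delta> of \<psi> e drops out: it enters as D(e,e) applied to it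
  minus itself. What remains is a fixed vector, independent of \<psi>, under the operator
  \<open>Lo p\<close>, so the case \<psi> = 1 decides all others.\<close>

lemma defect_mod_nullspace:
  assumes e: "plateau \<eta> e" and \<psi>: "cts \<psi>"
  defines "p \<equiv> \<lambda>t. \<psi> t * (e t * cnj (e t))"
  shows "defect (fc (\<lambda>t. \<psi> t * e t)) (fc e) (fc e) - Lo p (Qo e e (\<delta> (fc e)) + \<delta> (fc e)) \<in> nullspace \<eta>"
proof -
  let ?f = "\<lambda>t. \<psi> t * e t" and ?d = "\<delta> (fc e)"
  define v where "v t = complex_of_real t * \<psi> t * e t * cnj (e t) * e t" for t
  define w where "w t = \<psi> t * e t - v t" for t
  have ce: "cts e" using e by (simp add: plateau_def)
  have cts: "cts ?f" "cts p" "cts v" "cts w"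
    unfolding p_def w_def v_def by (intro continuous_intros \<psi> ce)+
  have w0: "w t = 0" if "0 \<le> t" "t \<le> R" "\<eta> \<le> t" for t
  proof -
    have "complex_of_real t * e t * cnj (e t) = 1" using e that by (simp add: plateau_def)
    moreover have "w t = \<psi> t * e t - \<psi> t * e t * (complex_of_real t * e t * cnj (e t))"
      by (simp add: w_def v_def)
    ultimately show ?thesis by simp
  qed
  have "tp (fc ?f) (fc e) (fc e) = fc (\<lambda>t. complex_of_real t * ?f t * cnj (e t) * e t)"
    by (rule fc_triple[OF cts(1) ce ce])
  also have "\<dots> = fc v" by (rule fc_cong) (simp add: v_def)
  finally have tp_v: "tp (fc ?f) (fc e) (fc e) = fc v" .
  have "fc v = fc (\<lambda>t. ?f t - w t)" by (rule fc_cong) (simp add: w_def)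
  also have "\<dots> = fc ?f - fc w" by (rule fc_diff[OF cts(1,4)])
  finally have "fc v = fc ?f - fc w" .
  then have \<delta>v: "\<delta> (fc v) = \<delta> (fc ?f) - \<delta> (fc w)" by (simp add: clinear_diff[OF \<delta>_clinear])
  have "Lo p z = tp (fc ?f) (fc e) z" for z
    unfolding fc_box_Lo[OF cts(1) ce] p_def by (simp add: mult.assoc)
  then have Lop: "tp (fc ?f) (fc e) z = Lo p z" for z by simp
  have "Qo (\<lambda>t. complex_of_real t * p t * e t) e ?d = Qo v e ?d"
    by (rule Qo_cong) (simp_all add: p_def v_def)
  then have "2 *\<^sub>R Lo p (Qo e e ?d) = Qo v e ?d + Qo v e ?d"
    unfolding Lo_Qo[OF cts(2) ce ce] Qo_sym[of e "\<lambda>t. complex_of_real t * p t * e t"] by simp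
  then have Qv: "Lo p (Qo e e ?d) = Qo v e ?d" by (simp add: scaleR_2[symmetric])
  have "fc w = fc ?f - fc v" using \<open>fc v = fc ?f - fc w\<close> by simp
  then have Qw: "Qo ?f e ?d - Qo v e ?d = Qo w e ?d"
    by (simp add: Qo_def tp_diff)
  have box: "tp (\<delta> (fc ?f)) (fc e) (fc e) = Lo (\<lambda>t. e t * cnj (e t)) (\<delta> (fc ?f))"
    using fc_box_Lo[OF ce ce] outer_symmetric[of "\<delta> (fc ?f)" "fc e" "fc e"] by simp
  have "defect (fc ?f) (fc e) (fc e) - Lo p (Qo e e ?d + ?d)
      = (Lo (\<lambda>t. e t * cnj (e t)) (\<delta> (fc ?f)) - \<delta> (fc ?f)) + Qo w e ?d + \<delta> (fc w)"
    unfolding defect_def tp_v \<delta>v box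
    by (simp add: Lop Lo_lin Qv Qw[symmetric] Qo_def[of ?f])
  also have "\<dots> \<in> nullspace \<eta>"
    by (intro nullspace_add nullspace_plateau[OF e] nullspace_Qo[OF cts(4) w0 ce] nullspace_\<delta>[OF cts(4) w0])
  finally show ?thesis .
qed

text \<open>With d chosen at e, the defect is d v - \<delta> v for v = {e,e,e}. As v - e vanishes
  for t >= \<eta> and d e = \<delta> e, only values of d and \<delta> below the cut-off remain, and
  these lie in the nullspace.\<close>

lemma defect_plateau_self:
  assumes e: "plateau \<eta> e" shows "defect (fc e) (fc e) (fc e) \<in> nullspace \<eta>"
proof -
  define v where "v t = complex_of_real t * e t * cnj (e t) * e t" for t
  define w where "w t = v t - e t" for t
  have ce: "cts e" using e by (simp add: plateau_def)
  have cts: "cts v" "cts w" unfolding w_def v_def by (intro continuous_intros ce)+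
  have w0: "w t = 0" if "0 \<le> t" "t \<le> R" "\<eta> \<le> t" for t
    using e that by (simp add: plateau_def w_def v_def)
  obtain d where d: "triple_derivation tp d" "d (fc e) = \<delta> (fc e)" by (rule local_obtain)
  have v: "tp (fc e) (fc e) (fc e) = fc v" unfolding v_def by (rule fc_triple[OF ce ce ce])
  have "fc v = fc e + fc w" using fc_add[OF ce cts(2)] by (simp add: w_def)
  then have "d (fc v) - \<delta> (fc v) = d (fc w) - \<delta> (fc w)"
    by (simp add: clinear_add[OF \<delta>_clinear] clinear_add[OF clinear_derivation[OF d(1)]] d(2))
  moreover have "defect (fc e) (fc e) (fc e) = d (fc v) - \<delta> (fc v)"
    using derivation_tp[OF d(1), of "fc e" "fc e" "fc e"] by (simp add: defect_def v d(2))
  ultimately show ?thesis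
    using nullspace_diff[OF nullspace_derivation[OF d(1) cts(2) w0] nullspace_\<delta>[OF cts(2) w0]] by simp
qed

text \<open>For \<psi> = 1 the two preceding facts put D(e,e) z into the nullspace, where z is the
  fixed vector \<open>?z\<close>; then z itself lies there, and so does \<open>Lo p\<close> of it
  for every \<psi>.\<close>

lemma defect_plateau_left:
  assumes e: "plateau \<eta> e" and \<psi>: "cts \<psi>"
  shows "defect (fc (\<lambda>t. \<psi> t * e t)) (fc e) (fc e) \<in> nullspace \<eta>"
proof -
  let ?z = "Qo e e (\<delta> (fc e)) + \<delta> (fc e)"
  have ce: "cts e" using e by (simp add: plateau_def)
  have ct: "cts (\<lambda>t. \<psi> t * (e t * cnj (e t)))" by (intro continuous_intros \<psi> ce)
  have "Lo (\<lambda>t. e t * cnj (e t)) ?z \<in> nullspace \<eta>"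
    using nullspace_diff[OF defect_plateau_self[OF e] defect_mod_nullspace[OF e, of "\<lambda>t. 1"]] by simp
  from nullspace_diff[OF this nullspace_plateau[OF e, of ?z]]
  have "?z \<in> nullspace \<eta>" by (simp only: diff_diff_eq2 add_diff_cancel_left')
  from nullspace_add[OF defect_mod_nullspace[OF e \<psi>] nullspace_Lo[OF ct this]]
  show ?thesis by simp
qed

end

section \<open>Differentiation along unimodular perturbations of a plateau function\<close>

lemma norm_cis_taylor: "cmod (cis s - 1 - \<i> * complex_of_real s) \<le> s\<^sup>2"
  using Taylor_exp[of "\<i> * complex_of_real s" 1]
  by (simp add: cis_conv_exp norm_mult power_mult_distrib diff_diff_eq power2_eq_square)

lemma continuous_on_Icc_bounded:
  fixes f :: "real \<Rightarrow> 'b::real_normed_vector"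
  assumes "continuous_on {a..b} f"
  shows "\<exists>M. \<forall>t\<in>{a..b}. norm (f t) \<le> M"
  using compact_imp_bounded[OF compact_continuous_image[OF assms compact_Icc]]
  unfolding bounded_iff by simp

context local_derivation
begin

lemma fc_scaleR: "cts f \<Longrightarrow> fc (\<lambda>t. complex_of_real c * f t) = c *\<^sub>R fc f"
  by (simp add: fc_scaleC scaleC_of_real)

definition rot :: "(real \<Rightarrow> complex) \<Rightarrow> (real \<Rightarrow> real) \<Rightarrow> real \<Rightarrow> real \<Rightarrow> complex"
  where "rot e \<phi> \<rho> t = e t * cis (\<rho> * \<phi> t)"

lemma cts_rot: "cts e \<Longrightarrow> continuous_on {0..R} \<phi> \<Longrightarrow> cts (rot e \<phi> \<rho>)"
  unfolding rot_def cis_conv_exp by (intro continuous_intros)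

lemma plateau_rot:
  assumes e: "plateau \<eta> e" and \<phi>: "continuous_on {0..R} \<phi>"
  shows "plateau \<eta> (rot e \<phi> \<rho>)"
proof -
  have eq: "complex_of_real t * rot e \<phi> \<rho> t * cnj (rot e \<phi> \<rho> t) = complex_of_real t * e t * cnj (e t)" for t
    using cis_mult[of "\<rho> * \<phi> t" "- (\<rho> * \<phi> t)"] by (simp add: rot_def cis_cnj mult_ac)
  show ?thesis using e cts_rot[OF _ \<phi>] unfolding plateau_def eq by simp
qed

text \<open>A fixed multiple of e is also a multiple of the rotated e. Arguments that do not move
  with \<rho> thus keep the form required by the lemmas on plateau functions.\<close>

lemma fc_unrot:
  assumes "cts \<psi>" "continuous_on {0..R} \<phi>"
  obtains \<psi>' where "cts \<psi>'" "\<And>e. fc (\<lambda>t. \<psi>' t * rot e \<phi> \<rho> t) = fc (\<lambda>t. \<psi> t * e t)"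
proof
  show "cts (\<lambda>t. \<psi> t * cis (- (\<rho> * \<phi> t)))"
    unfolding cis_conv_exp by (intro continuous_intros assms)
  have eq: "\<psi> t * cis (- (\<rho> * \<phi> t)) * rot e \<phi> \<rho> t = \<psi> t * e t" for e t
    using cis_mult[of "- (\<rho> * \<phi> t)" "\<rho> * \<phi> t"] by (simp add: rot_def mult_ac)
  show "fc (\<lambda>t. \<psi> t * cis (- (\<rho> * \<phi> t)) * rot e \<phi> \<rho> t) = fc (\<lambda>t. \<psi> t * e t)" for e
    by (simp only: eq)
qed

definition rot_quotient :: "(real \<Rightarrow> complex) \<Rightarrow> (real \<Rightarrow> real) \<Rightarrow> nat \<Rightarrow> 'z"
  where "rot_quotient e \<phi> n = real (Suc n) *\<^sub>R (fc (rot e \<phi> (inverse (real (Suc n)))) - fc e)"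

lemma rot_quotient_tendsto:
  assumes e: "cts e" and \<phi>: "continuous_on {0..R} \<phi>"
  shows "rot_quotient e \<phi> \<longlonglongrightarrow> \<i> *\<^sub>C fc (\<lambda>t. complex_of_real (\<phi> t) * e t)"
proof -
  obtain E where E: "\<And>t. t \<in> {0..R} \<Longrightarrow> cmod (e t) \<le> E"
    using continuous_on_Icc_bounded[OF e] by blast
  obtain F where F: "\<And>t. t \<in> {0..R} \<Longrightarrow> \<bar>\<phi> t\<bar> \<le> F"
    using continuous_on_Icc_bounded[OF \<phi>] unfolding real_norm_def by blast
  have E0: "0 \<le> E" using order_trans[OF norm_ge_zero E[of 0]] R by simp
  let ?g = "\<lambda>t. complex_of_real (\<phi> t) * e t"
  let ?h = "\<lambda>n t. complex_of_real (real (Suc n)) * (rot e \<phi> (inverse (real (Suc n))) t - e t) - \<i> * ?g t"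
  have g: "cts ?g" by (intro continuous_intros e \<phi>)
  have r: "cts (rot e \<phi> \<rho>)" for \<rho> by (rule cts_rot[OF e \<phi>])
  have d: "cts (\<lambda>t. rot e \<phi> \<rho> t - e t)" for \<rho> by (intro continuous_intros r e)
  have bd: "norm (rot_quotient e \<phi> n - \<i> *\<^sub>C fc ?g) \<le> (E * F\<^sup>2 * inverse (real (Suc n))) * sqrt R" for n
  proof -
    define \<rho> where "\<rho> = inverse (real (Suc n))"
    have \<rho>: "\<rho> > 0" "real (Suc n) = 1 / \<rho>" by (simp_all add: \<rho>_def field_simps)
    have "rot_quotient e \<phi> n - \<i> *\<^sub>C fc ?g = fc (?h n)"
    proof -
      have c1: "cts (\<lambda>t. complex_of_real (real (Suc n)) * (rot e \<phi> \<rho> t - e t))" "cts (\<lambda>t. \<i> * ?g t)"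
        by (intro continuous_intros d g)+
      show ?thesis
        unfolding \<rho>_def[symmetric] fc_diff[OF c1] fc_scaleR[OF d] fc_diff[OF r e] fc_scaleC[OF g]
        by (simp add: rot_quotient_def \<rho>_def)
    qed
    moreover have "norm (fc (?h n)) \<le> (E * F\<^sup>2 * \<rho>) * sqrt R"
    proof (rule norm_fc_le)
      show "cts (?h n)" by (intro continuous_intros d g)
      fix t assume "0 \<le> t" "t \<le> R"
      then have t: "t \<in> {0..R}" by simp
      have "?h n t = e t * complex_of_real (1 / \<rho>) * (cis (\<rho> * \<phi> t) - 1 - \<i> * complex_of_real (\<rho> * \<phi> t))"
        unfolding \<rho>_def[symmetric] \<rho>(2) rot_def using \<rho>(1) by (simp add: field_simps)
      then have "cmod (?h n t) = cmod (e t) * (1 / \<rho>) * cmod (cis (\<rho> * \<phi> t) - 1 - \<i> * complex_of_real (\<rho> * \<phi> t))"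
        using \<rho>(1) by (simp add: norm_mult norm_divide)
      also have "\<dots> \<le> cmod (e t) * (1 / \<rho>) * (\<rho> * \<phi> t)\<^sup>2"
        using \<rho>(1) by (intro mult_left_mono norm_cis_taylor) auto
      also have "\<dots> = cmod (e t) * \<bar>\<phi> t\<bar>\<^sup>2 * \<rho>"
        using \<rho>(1) by (simp add: power2_eq_square)
      also have "\<dots> \<le> E * F\<^sup>2 * \<rho>"
        using \<rho>(1) E0 by (intro mult_right_mono mult_mono power_mono E F t) auto
      finally show "cmod (?h n t) \<le> E * F\<^sup>2 * \<rho>" .
    qed
    ultimately show ?thesis by (simp add: \<rho>_def)
  qed
  have "(\<lambda>n. (E * F\<^sup>2 * inverse (real (Suc n))) * sqrt R) \<longlonglongrightarrow> (E * F\<^sup>2 * 0) * sqrt R"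
    by (intro tendsto_intros LIMSEQ_inverse_real_of_nat)
  then have lim: "(\<lambda>n. (E * F\<^sup>2 * inverse (real (Suc n))) * sqrt R) \<longlonglongrightarrow> 0"
    by (simp only: mult_zero_right mult_zero_left)
  show ?thesis
    by (rule LIM_zero_cancel, rule Lim_null_comparison[OF always_eventually[OF allI[OF bd]] lim])
qed

lemma fc_rot_quotient:
  "fc (rot e \<phi> (inverse (real (Suc n)))) = fc e + inverse (real (Suc n)) *\<^sub>R rot_quotient e \<phi> n"
  by (simp add: rot_quotient_def del: of_nat_Suc)

lemma fc_rot_0: "fc (rot e \<phi> 0) = fc e"
  by (simp add: rot_def[abs_def])

lemma rot_derivative_linear:
  assumes e: "cts e" and \<phi>: "continuous_on {0..R} \<phi>"
    and add: "\<And>a b. F (a + b) = F a + F b" and scale: "\<And>c a. F (c *\<^sub>R a) = c *\<^sub>R F a"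
    and lim: "\<And>f a. f \<longlonglongrightarrow> a \<Longrightarrow> (\<lambda>n. F (f n)) \<longlonglongrightarrow> F a"
    and null: "\<And>\<rho>. F (fc (rot e \<phi> \<rho>)) \<in> nullspace \<eta>"
  shows "F (\<i> *\<^sub>C fc (\<lambda>t. complex_of_real (\<phi> t) * e t)) \<in> nullspace \<eta>"
proof (rule nullspace_closed[OF _ lim[OF rot_quotient_tendsto[OF e \<phi>]]])
  fix n
  have "F (rot_quotient e \<phi> n) = real (Suc n) *\<^sub>R (F (fc (rot e \<phi> (inverse (real (Suc n))))) - F (fc (rot e \<phi> 0)))"
    by (simp add: fc_rot_quotient add scale fc_rot_0 del: of_nat_Suc)
  then show "F (rot_quotient e \<phi> n) \<in> nullspace \<eta>"
    by (simp only: nullspace_scaleR nullspace_diff null)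
qed

text \<open>The nullspace is closed under differences, real multiples and limits, so derivatives of
  curves in it stay in it; the quadratic term of the quotient disappears with \<rho>.
  \<open>H\<close> is only real homogeneous because the defect is antilinear in its middle
  slot.\<close>

lemma rot_derivative_bilinear:
  assumes e: "cts e" and \<phi>: "continuous_on {0..R} \<phi>"
    and add: "\<And>a b c. H (a + b) c = H a c + H b c" "\<And>a b c. H a (b + c) = H a b + H a c"
    and scale: "\<And>r a b. H (r *\<^sub>R a) b = r *\<^sub>R H a b" "\<And>r a b. H a (r *\<^sub>R b) = r *\<^sub>R H a b"
    and lim: "\<And>f g a b. f \<longlonglongrightarrow> a \<Longrightarrow> g \<longlonglongrightarrow> b \<Longrightarrow> (\<lambda>n. H (f n) (g n)) \<longlonglongrightarrow> H a b"
    and null: "\<And>\<rho>. H (fc (rot e \<phi> \<rho>)) (fc (rot e \<phi> \<rho>)) \<in> nullspace \<eta>"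
  defines "d \<equiv> \<i> *\<^sub>C fc (\<lambda>t. complex_of_real (\<phi> t) * e t)"
  shows "H d (fc e) + H (fc e) d \<in> nullspace \<eta>"
proof -
  let ?q = "rot_quotient e \<phi>" and ?\<rho> = "\<lambda>n. inverse (real (Suc n))"
  define w where "w n = H (?q n) (fc e) + H (fc e) (?q n) + ?\<rho> n *\<^sub>R H (?q n) (?q n)" for n
  have q: "?q \<longlonglongrightarrow> d" unfolding d_def by (rule rot_quotient_tendsto[OF e \<phi>])
  have "w \<longlonglongrightarrow> H d (fc e) + H (fc e) d + 0 *\<^sub>R H d d"
    unfolding w_def by (intro tendsto_add tendsto_scaleR lim q tendsto_const LIMSEQ_inverse_real_of_nat)
  moreover have "w n \<in> nullspace \<eta>" for n
  proof -
    let ?r = "fc (rot e \<phi> (?\<rho> n))"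
    have "H ?r ?r - H (fc e) (fc e) = ?\<rho> n *\<^sub>R w n"
      unfolding fc_rot_quotient add scale w_def by (simp add: scaleR_add_right)
    then have "w n = real (Suc n) *\<^sub>R (H ?r ?r - H (fc (rot e \<phi> 0)) (fc (rot e \<phi> 0)))"
      by (simp add: fc_rot_0 del: of_nat_Suc)
    then show ?thesis by (simp only: nullspace_scaleR nullspace_diff null)
  qed
  ultimately show ?thesis using nullspace_closed[of w] by simp
qed

lemma fc_complex_split:
  assumes "cts \<phi>" "cts e"
  shows "fc (\<lambda>t. \<phi> t * e t) = fc (\<lambda>t. complex_of_real (Re (\<phi> t)) * e t)
    + \<i> *\<^sub>C fc (\<lambda>t. complex_of_real (Im (\<phi> t)) * e t)"
proof -
  have c: "cts (\<lambda>t. complex_of_real (Re (\<phi> t)) * e t)" "cts (\<lambda>t. complex_of_real (Im (\<phi> t)) * e t)"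
    "cts (\<lambda>t. \<i> * (complex_of_real (Im (\<phi> t)) * e t))"
    by (intro continuous_intros assms)+
  have "fc (\<lambda>t. \<phi> t * e t) = fc (\<lambda>t. complex_of_real (Re (\<phi> t)) * e t + \<i> * (complex_of_real (Im (\<phi> t)) * e t))"
    by (rule fc_cong) (metis complex_eq distrib_right mult.assoc)
  then show ?thesis by (simp only: fc_add[OF c(1,3)] fc_scaleC[OF c(2)])
qed

lemma nullspace_cancel_i: "\<i> *\<^sub>C z \<in> nullspace \<eta> \<Longrightarrow> z \<in> nullspace \<eta>"
  using nullspace_scaleC[of "\<i> *\<^sub>C z" \<eta> "- \<i>"] by (simp add: scaleC_scaleC scaleC_one)

text \<open>Differentiate the defect at (e, e_\<rho>, e_\<rho>), where e counts as a multiple of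
  e_\<rho>. The factor i leaves the middle slot with the sign -1, so a difference results, whose
  other term is the known case of an outer slot.\<close>

lemma defect_plateau_middle:
  assumes e: "plateau \<eta> e" and \<psi>: "cts \<psi>"
  shows "defect (fc e) (fc (\<lambda>t. \<psi> t * e t)) (fc e) \<in> nullspace \<eta>"
proof -
  have ce: "cts e" using e by (simp add: plateau_def)
  have real: "defect (fc e) (fc (\<lambda>t. complex_of_real (\<phi> t) * e t)) (fc e) \<in> nullspace \<eta>"
    if \<phi>: "continuous_on {0..R} \<phi>" for \<phi>
  proof -
    let ?f = "fc (\<lambda>t. complex_of_real (\<phi> t) * e t)"
    have cf: "cts (\<lambda>t. complex_of_real (\<phi> t))" by (intro continuous_intros \<phi>)
    have rot: "defect (fc e) (fc (rot e \<phi> \<rho>)) (fc (rot e \<phi> \<rho>)) \<in> nullspace \<eta>" for \<rho>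
    proof -
      obtain \<psi>' where "cts \<psi>'" "\<And>e. fc (\<lambda>t. \<psi>' t * rot e \<phi> \<rho> t) = fc (\<lambda>t. 1 * e t)"
        using fc_unrot[of "\<lambda>t. 1", OF _ \<phi>] by auto
      then show ?thesis using defect_plateau_left[OF plateau_rot[OF e \<phi>], of \<psi>' \<rho>] by simp
    qed
    have "defect (fc e) (\<i> *\<^sub>C ?f) (fc e) + defect (fc e) (fc e) (\<i> *\<^sub>C ?f) \<in> nullspace \<eta>"
      by (rule rot_derivative_bilinear[where H = "defect (fc e)", OF ce \<phi>])
        (simp_all only: defect_add defect_scaleR rot tendsto_defect tendsto_const)
    then have "\<i> *\<^sub>C (defect (fc e) (fc e) ?f - defect (fc e) ?f (fc e)) \<in> nullspace \<eta>"
      by (simp add: defect_scaleC scaleC.scale_right_diff_distrib)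
    then have "defect (fc e) (fc e) ?f - defect (fc e) ?f (fc e) \<in> nullspace \<eta>"
      by (rule nullspace_cancel_i)
    moreover have "defect (fc e) (fc e) ?f \<in> nullspace \<eta>"
      using defect_plateau_left[OF e cf] defect_sym[of "fc e" "fc e" ?f] by simp
    ultimately show ?thesis using nullspace_diff by fastforce
  qed
  have "continuous_on {0..R} (\<lambda>t. Re (\<psi> t))" "continuous_on {0..R} (\<lambda>t. Im (\<psi> t))"
    by (intro continuous_intros \<psi>)+
  from real[OF this(1)] real[OF this(2)] show ?thesis
    unfolding fc_complex_split[OF \<psi> ce] defect_add defect_scaleC
    by (intro nullspace_add nullspace_scaleC)
qed

text \<open>Now both outer slots rotate. By outer symmetry the two terms of the derivative agree, so
  each is in the nullspace.\<close>

lemma defect_plateau_left_middle: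
  assumes e: "plateau \<eta> e" and \<phi>: "cts \<phi>" and \<psi>: "cts \<psi>"
  shows "defect (fc (\<lambda>t. \<phi> t * e t)) (fc (\<lambda>t. \<psi> t * e t)) (fc e) \<in> nullspace \<eta>"
proof -
  have ce: "cts e" using e by (simp add: plateau_def)
  let ?g = "fc (\<lambda>t. \<psi> t * e t)"
  have real: "defect (fc (\<lambda>t. complex_of_real (\<phi> t) * e t)) ?g (fc e) \<in> nullspace \<eta>"
    if \<phi>: "continuous_on {0..R} \<phi>" for \<phi>
  proof -
    let ?f = "fc (\<lambda>t. complex_of_real (\<phi> t) * e t)"
    have rot: "defect (fc (rot e \<phi> \<rho>)) ?g (fc (rot e \<phi> \<rho>)) \<in> nullspace \<eta>" for \<rho>
    proof -
      obtain \<psi>' where "cts \<psi>'" "\<And>e. fc (\<lambda>t. \<psi>' t * rot e \<phi> \<rho> t) = fc (\<lambda>t. \<psi> t * e t)"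
        using fc_unrot[OF \<psi> \<phi>] by blast
      then show ?thesis using defect_plateau_middle[OF plateau_rot[OF e \<phi>], of \<psi>' \<rho>] by simp
    qed
    have "defect (\<i> *\<^sub>C ?f) ?g (fc e) + defect (fc e) ?g (\<i> *\<^sub>C ?f) \<in> nullspace \<eta>"
      by (rule rot_derivative_bilinear[where H = "\<lambda>a b. defect a ?g b", OF ce \<phi>])
        (simp_all only: defect_add defect_scaleR rot tendsto_defect tendsto_const)
    then have "\<i> *\<^sub>C (2 *\<^sub>R defect ?f ?g (fc e)) \<in> nullspace \<eta>"
      by (simp add: defect_scaleC defect_sym[of "fc e" ?g ?f] scaleR_2 scaleC_add_right)
    then have "(1 / 2) *\<^sub>R (2 *\<^sub>R defect ?f ?g (fc e)) \<in> nullspace \<eta>"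
      by (rule nullspace_scaleR[OF nullspace_cancel_i])
    then show ?thesis by simp
  qed
  have "continuous_on {0..R} (\<lambda>t. Re (\<phi> t))" "continuous_on {0..R} (\<lambda>t. Im (\<phi> t))"
    by (intro continuous_intros \<phi>)+
  from real[OF this(1)] real[OF this(2)] show ?thesis
    unfolding fc_complex_split[OF \<phi> ce] defect_add defect_scaleC
    by (intro nullspace_add nullspace_scaleC)
qed

lemma defect_plateau:
  assumes e: "plateau \<eta> e" and \<phi>: "cts \<phi>" and \<psi>: "cts \<psi>" and \<theta>: "cts \<theta>"
  shows "defect (fc (\<lambda>t. \<phi> t * e t)) (fc (\<lambda>t. \<psi> t * e t)) (fc (\<lambda>t. \<theta> t * e t)) \<in> nullspace \<eta>"
proof -
  have ce: "cts e" using e by (simp add: plateau_def)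
  let ?f = "fc (\<lambda>t. \<phi> t * e t)" and ?g = "fc (\<lambda>t. \<psi> t * e t)"
  have real: "defect ?f ?g (fc (\<lambda>t. complex_of_real (\<theta> t) * e t)) \<in> nullspace \<eta>"
    if \<theta>: "continuous_on {0..R} \<theta>" for \<theta>
  proof -
    have rot: "defect ?f ?g (fc (rot e \<theta> \<rho>)) \<in> nullspace \<eta>" for \<rho>
    proof -
      obtain \<phi>' where "cts \<phi>'" "\<And>e. fc (\<lambda>t. \<phi>' t * rot e \<theta> \<rho> t) = fc (\<lambda>t. \<phi> t * e t)"
        using fc_unrot[OF \<phi> \<theta>] by blast
      moreover obtain \<psi>' where "cts \<psi>'" "\<And>e. fc (\<lambda>t. \<psi>' t * rot e \<theta> \<rho> t) = fc (\<lambda>t. \<psi> t * e t)"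
        using fc_unrot[OF \<psi> \<theta>] by blast
      ultimately show ?thesis
        using defect_plateau_left_middle[OF plateau_rot[OF e \<theta>], of \<phi>' \<psi>' \<rho>] by simp
    qed
    have "defect ?f ?g (\<i> *\<^sub>C fc (\<lambda>t. complex_of_real (\<theta> t) * e t)) \<in> nullspace \<eta>"
      by (rule rot_derivative_linear[where F = "defect ?f ?g", OF ce \<theta>])
        (simp_all only: defect_add defect_scaleR rot tendsto_defect tendsto_const)
    then show ?thesis unfolding defect_scaleC by (rule nullspace_cancel_i)
  qed
  have "continuous_on {0..R} (\<lambda>t. Re (\<theta> t))" "continuous_on {0..R} (\<lambda>t. Im (\<theta> t))"
    by (intro continuous_intros \<theta>)+
  from real[OF this(1)] real[OF this(2)] show ?thesis
    unfolding fc_complex_split[OF \<theta> ce] defect_add defect_scaleC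
    by (intro nullspace_add nullspace_scaleC)
qed

end

section \<open>Bilinear maps vanishing on disjoint functions\<close>

definition clip :: "real \<Rightarrow> real"
  where "clip y = max 0 (min 1 y)"

lemma continuous_on_clip [continuous_intros]:
  "continuous_on S f \<Longrightarrow> continuous_on S (\<lambda>t. clip (f t))"
  unfolding clip_def by (intro continuous_intros)

lemma clip_bounds: "0 \<le> clip y" "clip y \<le> 1"
  by (simp_all add: clip_def)

lemma sum_clip: "0 \<le> y \<Longrightarrow> (\<Sum>i<n. clip (y - real i)) = min y (real n)"
  by (induction n) (auto simp: clip_def)

text \<open>A trapezoid equal to 1 on [0,1], the interval on which \<open>clip\<close> is not
  locally constant, and vanishing outside (-1,2).\<close>

definition bump :: "real \<Rightarrow> real"
  where "bump y = clip (y + 1) - clip (y - 1)"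

lemma continuous_on_bump [continuous_intros]:
  "continuous_on S f \<Longrightarrow> continuous_on S (\<lambda>t. bump (f t))"
  unfolding bump_def by (intro continuous_intros)

lemma bump_abs: "\<bar>bump y\<bar> \<le> 1"
  by (simp add: bump_def clip_def)

lemma bump_support: "bump y \<noteq> 0 \<Longrightarrow> -1 < y \<and> y < 2"
  by (auto simp: bump_def clip_def)

lemma bump_clip: "clip y * (1 - clip y) * (1 - bump y) = 0"
  by (auto simp: bump_def clip_def max_def min_def)

locale zero_product_map =
  fixes S :: "'a::topological_space set"
    and \<beta> :: "('a \<Rightarrow> real) \<Rightarrow> ('a \<Rightarrow> real) \<Rightarrow> 'b::real_normed_vector" and C :: real
  assumes add_left: "\<lbrakk>continuous_on S f; continuous_on S f'; continuous_on S g\<rbrakk> \<Longrightarrow>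
      \<beta> (\<lambda>t. f t + f' t) g = \<beta> f g + \<beta> f' g"
    and add_right: "\<lbrakk>continuous_on S f; continuous_on S g; continuous_on S g'\<rbrakk> \<Longrightarrow>
      \<beta> f (\<lambda>t. g t + g' t) = \<beta> f g + \<beta> f g'"
    and zero_product: "\<lbrakk>continuous_on S f; continuous_on S g; \<And>t. t \<in> S \<Longrightarrow> f t * g t = 0\<rbrakk> \<Longrightarrow> \<beta> f g = 0"
    and bounded: "\<lbrakk>continuous_on S f; continuous_on S g; \<And>t. t \<in> S \<Longrightarrow> \<bar>f t\<bar> \<le> 1; \<And>t. t \<in> S \<Longrightarrow> \<bar>g t\<bar> \<le> 1\<rbrakk>
      \<Longrightarrow> norm (\<beta> f g) \<le> C"
begin

lemma cong_left:
  assumes "continuous_on S f" "continuous_on S f'" "continuous_on S g" "\<And>t. t \<in> S \<Longrightarrow> f t = f' t"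
  shows "\<beta> f g = \<beta> f' g"
proof -
  have d: "continuous_on S (\<lambda>t. f t - f' t)" by (intro continuous_intros assms)
  have "\<beta> (\<lambda>t. f t - f' t) g = 0" by (rule zero_product[OF d assms(3)]) (simp add: assms(4))
  then show ?thesis using add_left[OF d assms(2,3)] by simp
qed

lemma cong_right:
  assumes "continuous_on S f" "continuous_on S g" "continuous_on S g'" "\<And>t. t \<in> S \<Longrightarrow> g t = g' t"
  shows "\<beta> f g = \<beta> f g'"
proof -
  have d: "continuous_on S (\<lambda>t. g t - g' t)" by (intro continuous_intros assms)
  have "\<beta> f (\<lambda>t. g t - g' t) = 0" by (rule zero_product[OF assms(1) d]) (simp add: assms(4))
  then show ?thesis using add_right[OF assms(1) d assms(3)] by simp
qed

lemma sum_left: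
  assumes "finite I" "\<And>i. i \<in> I \<Longrightarrow> continuous_on S (f i)" "continuous_on S g"
  shows "\<beta> (\<lambda>t. \<Sum>i\<in>I. f i t) g = (\<Sum>i\<in>I. \<beta> (f i) g)"
  using assms
proof (induction I rule: finite_induct)
  case empty
  show ?case using zero_product[of "\<lambda>t. 0" g] empty by simp
next
  case (insert i I)
  have "continuous_on S (\<lambda>t. \<Sum>i\<in>I. f i t)" using insert.prems by (intro continuous_on_sum) simp
  then show ?case using insert add_left[of "f i" "\<lambda>t. \<Sum>i\<in>I. f i t" g] by simp
qed

lemma sum_right:
  assumes "finite I" "\<And>i. i \<in> I \<Longrightarrow> continuous_on S (g i)" "continuous_on S f"
  shows "\<beta> f (\<lambda>t. \<Sum>i\<in>I. g i t) = (\<Sum>i\<in>I. \<beta> f (g i))"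
  using assms
proof (induction I rule: finite_induct)
  case empty
  show ?case using zero_product[of f "\<lambda>t. 0"] empty by simp
next
  case (insert i I)
  have "continuous_on S (\<lambda>t. \<Sum>i\<in>I. g i t)" using insert.prems by (intro continuous_on_sum) simp
  then show ?case using insert add_right[of f "g i" "\<lambda>t. \<Sum>i\<in>I. g i t"] by simp
qed

text \<open>Disjointness acts twice: the mixed terms vanish, so the sum is \<beta> applied to the
  two total sums, and these total sums are still bounded by 1.\<close>

lemma disjoint_sum_bound:
  assumes I: "finite I" and p: "\<And>i. continuous_on S (p i)" and q: "\<And>i. continuous_on S (q i)"
    and disj: "\<And>i j t. i \<in> I \<Longrightarrow> j \<in> I \<Longrightarrow> i \<noteq> j \<Longrightarrow> t \<in> S \<Longrightarrow> k i t * k j t = (0::real)"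
    and k: "\<And>i t. k i t = 0 \<Longrightarrow> p i t = 0 \<and> q i t = 0"
    and le: "\<And>i t. \<bar>p i t\<bar> \<le> 1" "\<And>i t. \<bar>q i t\<bar> \<le> 1"
  shows "norm (\<Sum>i\<in>I. \<beta> (p i) (q i)) \<le> C"
proof -
  have abs: "\<bar>\<Sum>i\<in>I. r i t\<bar> \<le> 1" if t: "t \<in> S" and r: "\<And>i. k i t = 0 \<Longrightarrow> r i t = 0" "\<And>i. \<bar>r i t\<bar> \<le> 1"
    for t and r :: "_ \<Rightarrow> _ \<Rightarrow> real"
  proof (cases "\<exists>i\<in>I. k i t \<noteq> 0")
    case True
    then obtain i where i: "i \<in> I" "k i t \<noteq> 0" by blast
    have "r j t = 0" if "j \<in> I - {i}" for j using disj[of i j t] i that t r(1)[of j] by auto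
    then have "(\<Sum>j\<in>I. r j t) = r i t" using I i(1) by (simp add: sum.remove)
    then show ?thesis using r(2) by simp
  qed (use r in simp)
  have "(\<Sum>i\<in>I. \<beta> (p i) (q i)) = (\<Sum>i\<in>I. \<beta> (p i) (\<lambda>t. \<Sum>j\<in>I. q j t))"
  proof (rule sum.cong)
    fix i assume i: "i \<in> I"
    have "\<beta> (p i) (q j) = (if j = i then \<beta> (p i) (q i) else 0)" if "j \<in> I" for j
    proof (cases "j = i")
      case False
      then have "p i t * q j t = 0" if "t \<in> S" for t
        using disj[OF i \<open>j \<in> I\<close> _ that] k[of i t] k[of j t] by fastforce
      then show ?thesis using zero_product[OF p q] False by simp
    qed simp
    then have "(\<Sum>j\<in>I. \<beta> (p i) (q j)) = (\<Sum>j\<in>I. if j = i then \<beta> (p i) (q i) else 0)"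
      by (rule sum.cong[OF refl])
    also have "\<dots> = \<beta> (p i) (q i)" unfolding sum.delta[OF I] using i by simp
    finally have "(\<Sum>j\<in>I. \<beta> (p i) (q j)) = \<beta> (p i) (q i)" .
    then show "\<beta> (p i) (q i) = \<beta> (p i) (\<lambda>t. \<Sum>j\<in>I. q j t)"
      by (simp add: sum_right[OF I q p])
  qed simp
  also have "\<dots> = \<beta> (\<lambda>t. \<Sum>i\<in>I. p i t) (\<lambda>t. \<Sum>j\<in>I. q j t)"
    by (rule sum_left[OF I p continuous_on_sum[OF q], symmetric])
  finally show ?thesis
    using abs[of _ p] abs[of _ q] k le
    by (simp add: bounded continuous_on_sum p q)
qed

text \<open>The function \<open>n \<phi>\<close> is a sum of \<open>n\<close> ramps. The contribution of a single ramp is concentrated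
  where the ramp is not locally constant, and ramps whose indices differ by at least three are
  concentrated on disjoint sets; hence the contribution of all ramps is bounded independently
  of \<open>n\<close>.\<close>

theorem symmetric_one:
  assumes \<phi>: "continuous_on S \<phi>" "\<And>t. t \<in> S \<Longrightarrow> 0 \<le> \<phi> t" "\<And>t. t \<in> S \<Longrightarrow> \<phi> t \<le> 1"
  shows "\<beta> \<phi> (\<lambda>t. 1) = \<beta> (\<lambda>t. 1) \<phi>"
proof -
  define \<Delta> where "\<Delta> f = \<beta> f (\<lambda>t. 1) - \<beta> (\<lambda>t. 1) f" for f
  have one: "continuous_on S (\<lambda>t. 1 :: real)" by simp
  have main: "real n * norm (\<Delta> \<phi>) \<le> 6 * C" for n
  proof -
    define s where "s i t = clip (real n * \<phi> t - real i)" for i t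
    define k where "k i t = bump (real n * \<phi> t - real i)" for i t
    define p where "p i t = s i t * k i t" for i t
    define q where "q i t = (1 - s i t) * k i t" for i t
    have cs: "continuous_on S (s i)" and ck: "continuous_on S (k i)" for i
      unfolding s_def k_def by (intro continuous_intros \<phi>(1))+
    have c1s: "continuous_on S (\<lambda>t. 1 - s i t)" for i by (intro continuous_intros cs)
    have cp: "continuous_on S (p i)" and cq: "continuous_on S (q i)" for i
      unfolding p_def q_def by (intro continuous_intros cs ck)+
    have c3: "continuous_on S (\<lambda>t. s i t * (1 - k i t))" "continuous_on S (\<lambda>t. (1 - s i t) * (1 - k i t))" for i
      by (intro continuous_intros cs ck)+
    have key: "s i t * (1 - s i t) * (1 - k i t) = 0" for i t
      unfolding s_def k_def by (rule bump_clip)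
    \<comment> \<open>Splitting 1 = s + (1 - s) cancels the symmetric term \<beta>(s,s). As s (1 -
      s) (1 - k) = 0, both arguments of what is left may be multiplied by k.\<close>
    have ramp: "\<Delta> (s i) = \<beta> (p i) (q i) - \<beta> (q i) (p i)" for i
    proof -
      have e1: "(\<lambda>t. s i t + (1 - s i t)) = (\<lambda>t. 1)" by simp
      have e2: "(\<lambda>t. q i t + (1 - s i t) * (1 - k i t)) = (\<lambda>t. 1 - s i t)"
        by (simp add: q_def fun_eq_iff algebra_simps)
      have "\<beta> (s i) (\<lambda>t. 1) = \<beta> (s i) (s i) + \<beta> (s i) (\<lambda>t. 1 - s i t)"
        using add_right[OF cs cs c1s, of i i i] unfolding e1 .
      moreover have "\<beta> (\<lambda>t. 1) (s i) = \<beta> (s i) (s i) + \<beta> (\<lambda>t. 1 - s i t) (s i)"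
        using add_left[OF cs c1s cs, of i i i] unfolding e1 .
      moreover have "\<beta> (s i) (\<lambda>t. 1 - s i t) = \<beta> (p i) (q i)"
      proof -
        have "(\<lambda>t. p i t + s i t * (1 - k i t)) = s i" by (simp add: p_def fun_eq_iff algebra_simps)
        moreover have "\<beta> (\<lambda>t. s i t * (1 - k i t)) (\<lambda>t. 1 - s i t) = 0"
          by (rule zero_product[OF c3(1) c1s]) (use key in \<open>simp add: mult_ac\<close>)
        ultimately have "\<beta> (s i) (\<lambda>t. 1 - s i t) = \<beta> (p i) (\<lambda>t. 1 - s i t)"
          using add_left[OF cp c3(1) c1s, of i i i] by simp
        moreover have "\<beta> (p i) (\<lambda>t. (1 - s i t) * (1 - k i t)) = 0"
          by (rule zero_product[OF cp c3(2)]) (use key in \<open>simp add: p_def mult_ac\<close>)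
        then have "\<beta> (p i) (\<lambda>t. 1 - s i t) = \<beta> (p i) (q i)"
          using add_right[OF cp cq c3(2), of i i i] unfolding e2 by simp
        ultimately show ?thesis by simp
      qed
      moreover have "\<beta> (\<lambda>t. 1 - s i t) (s i) = \<beta> (q i) (p i)"
      proof -
        have "(\<lambda>t. p i t + s i t * (1 - k i t)) = s i" by (simp add: p_def fun_eq_iff algebra_simps)
        moreover have "\<beta> (\<lambda>t. 1 - s i t) (\<lambda>t. s i t * (1 - k i t)) = 0"
          by (rule zero_product[OF c1s c3(1)]) (use key in \<open>simp add: mult_ac\<close>)
        ultimately have "\<beta> (\<lambda>t. 1 - s i t) (s i) = \<beta> (\<lambda>t. 1 - s i t) (p i)"
          using add_right[OF c1s cp c3(1), of i i i] by simp
        moreover have "\<beta> (\<lambda>t. (1 - s i t) * (1 - k i t)) (p i) = 0"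
          by (rule zero_product[OF c3(2) cp]) (use key in \<open>simp add: p_def mult_ac\<close>)
        then have "\<beta> (\<lambda>t. 1 - s i t) (p i) = \<beta> (q i) (p i)"
          using add_left[OF cq c3(2) cp, of i i i] unfolding e2 by simp
        ultimately show ?thesis by simp
      qed
      ultimately show ?thesis by (simp add: \<Delta>_def)
    qed
    have k0: "k i t = 0 \<Longrightarrow> p i t = 0 \<and> q i t = 0" "k i t = 0 \<Longrightarrow> q i t = 0 \<and> p i t = 0" for i t
      by (simp_all add: p_def q_def)
    have ab: "\<bar>p i t\<bar> \<le> 1" "\<bar>q i t\<bar> \<le> 1" for i t
      unfolding p_def q_def abs_mult k_def s_def
      using clip_bounds[of "real n * \<phi> t - real i"] bump_abs[of "real n * \<phi> t - real i"]
      by (simp_all add: mult_le_one)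
    \<comment> \<open>The bump has support of length 3, hence residues modulo 3. Three classes, each
      with two sums bounded by C, give 6 C.\<close>
    define G where "G r = {i. i < n \<and> i mod 3 = r}" for r :: nat
    have fin: "finite (G r)" for r by (simp add: G_def)
    have disj: "k i t * k j t = 0" if "i \<in> G r" "j \<in> G r" "i \<noteq> j" for i j r t
    proof (rule ccontr)
      assume "k i t * k j t \<noteq> 0"
      then have "\<bar>real i - real j\<bar> < 3"
        using bump_support[of "real n * \<phi> t - real i"] bump_support[of "real n * \<phi> t - real j"]
        unfolding k_def by auto
      then have "i < j + 3" "j < i + 3" by linarith+
      moreover have "i = 3 * (i div 3) + r" "j = 3 * (j div 3) + r"
        using that mult_div_mod_eq[of 3 i] mult_div_mod_eq[of 3 j] by (simp_all add: G_def)
      ultimately have "i div 3 < j div 3 + 1" "j div 3 < i div 3 + 1" by linarith+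
      then show False using \<open>i = _\<close> \<open>j = _\<close> \<open>i \<noteq> j\<close> by simp
    qed
    have group: "norm (\<Sum>i\<in>G r. \<Delta> (s i)) \<le> 2 * C" for r
    proof -
      have "norm (\<Sum>i\<in>G r. \<beta> (p i) (q i)) \<le> C"
        by (rule disjoint_sum_bound[OF fin cp cq disj k0(1) ab])
      moreover have "norm (\<Sum>i\<in>G r. \<beta> (q i) (p i)) \<le> C"
        by (rule disjoint_sum_bound[OF fin cq cp disj k0(2) ab(2,1)])
      ultimately show ?thesis
        unfolding ramp sum_subtractf
        using norm_triangle_ineq4[of "\<Sum>i\<in>G r. \<beta> (p i) (q i)" "\<Sum>i\<in>G r. \<beta> (q i) (p i)"] by linarith
    qed
    have "{..<n} = (\<Union>r\<in>{0,1,2}. G r)" by (auto simp: G_def)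
    moreover have "(\<Sum>i\<in>(\<Union>r\<in>{0,1,2}. G r). \<Delta> (s i)) = (\<Sum>r\<in>{0,1,2}. \<Sum>i\<in>G r. \<Delta> (s i))"
      by (rule sum.UNION_disjoint) (auto simp: G_def)
    ultimately have "norm (\<Sum>i<n. \<Delta> (s i)) \<le> (\<Sum>r\<in>{0::nat,1,2}. 2 * C)"
      using group by (simp only:) (intro sum_norm_le, simp)
    then have le: "norm (\<Sum>i<n. \<Delta> (s i)) \<le> 6 * C" by simp
    have cn: "continuous_on S (\<lambda>t. \<Sum>i<m. \<phi> t)" for m :: nat by (intro continuous_on_sum \<phi>(1))
    have eq: "(\<Sum>i<n. s i t) = (\<Sum>i<n. \<phi> t)" if "t \<in> S" for t
    proof -
      have "0 \<le> real n * \<phi> t" "real n * \<phi> t \<le> real n" using \<phi>(2,3)[OF that] by (simp_all add: mult_left_le)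
      then show ?thesis unfolding s_def by (simp add: sum_clip)
    qed
    \<comment> \<open>The multiple of \<phi> is written as a sum of n equal terms, in keeping with
      the additivity of \<beta>.\<close>
    have "(\<Sum>i<n. \<Delta> (s i)) = (\<Sum>i<n. \<Delta> \<phi>)"
      unfolding \<Delta>_def sum_subtractf sum_left[OF finite_lessThan cs one, symmetric]
        sum_right[OF finite_lessThan cs one, symmetric] sum_left[OF finite_lessThan \<phi>(1) one, symmetric]
        sum_right[OF finite_lessThan \<phi>(1) one, symmetric]
      by (intro arg_cong2[of _ _ _ _ minus] cong_left cong_right continuous_on_sum cs \<phi>(1) one eq)
    with le show ?thesis by (simp add: sum_constant_scaleR)
  qed
  have "norm (\<Delta> \<phi>) \<le> 0"
  proof (rule ccontr)
    assume "\<not> norm (\<Delta> \<phi>) \<le> 0"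
    then obtain n where "real n * norm (\<Delta> \<phi>) > 6 * C" using reals_Archimedean3 by (meson not_le)
    with main[of n] show False by simp
  qed
  then show ?thesis by (simp add: \<Delta>_def)
qed

end

section \<open>Vanishing of the defect\<close>


context local_derivation
begin

lemma \<delta>_bounded: "\<exists>K\<ge>0. \<forall>z. norm (\<delta> z) \<le> K * norm z"
proof -
  have "isCont \<delta> 0" using continuous by (simp add: continuous_on_eq_continuous_at)
  then obtain r where r: "r > 0" "\<And>z. norm z < r \<Longrightarrow> norm (\<delta> z) < 1"
    unfolding continuous_at_eps_delta dist_norm clinear_zero[OF \<delta>_clinear] diff_zero
    using zero_less_one by blast
  have "norm (\<delta> z) \<le> (2 / r) * norm z" for z
  proof (cases "z = 0")
    case False
    define c where "c = r / (2 * norm z)"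
    have c: "c > 0" using False r by (simp add: c_def)
    have "norm (c *\<^sub>R z) < r" using False r by (simp add: c_def)
    from r(2)[OF this] have "norm (c *\<^sub>R \<delta> z) < 1" unfolding clinear_scaleR[OF \<delta>_clinear] .
    then have "c * norm (\<delta> z) < 1" using c by simp
    then show ?thesis using c False r(1) by (simp add: c_def field_simps)
  qed (simp add: clinear_zero[OF \<delta>_clinear])
  then show ?thesis using r(1) by (intro exI[of _ "2 / r"]) simp
qed

text \<open>The derivation is chosen at the cube, not at k. So w = d k is unknown, but the operators
  applied to it still confine the result to the support of k.\<close>

lemma \<delta>_cube:
  assumes k: "cts k"
  shows "\<exists>w. \<delta> (tp (fc k) (fc k) (fc k)) = 2 *\<^sub>R Lo (\<lambda>t. k t * cnj (k t)) w + Qo k k w"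
proof -
  obtain d where d: "triple_derivation tp d" "d (tp (fc k) (fc k) (fc k)) = \<delta> (tp (fc k) (fc k) (fc k))"
    by (rule local_obtain)
  have "\<delta> (tp (fc k) (fc k) (fc k))
      = tp (d (fc k)) (fc k) (fc k) + tp (fc k) (d (fc k)) (fc k) + tp (fc k) (fc k) (d (fc k))"
    by (simp only: d(2)[symmetric] derivation_tp[OF d(1)])
  moreover have "tp (d (fc k)) (fc k) (fc k) = Lo (\<lambda>t. k t * cnj (k t)) (d (fc k))"
    "tp (fc k) (fc k) (d (fc k)) = Lo (\<lambda>t. k t * cnj (k t)) (d (fc k))"
    using outer_symmetric[of "d (fc k)" "fc k" "fc k"] fc_box_Lo[OF k k] by simp_all
  ultimately have "\<delta> (tp (fc k) (fc k) (fc k)) = 2 *\<^sub>R Lo (\<lambda>t. k t * cnj (k t)) (d (fc k)) + Qo k k (d (fc k))"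
    by (simp only: Qo_def scaleR_2 add_ac)
  then show ?thesis by blast
qed

end

text \<open>Nested cut-offs: m inverts t where f is nonzero, and b is unitary, t b^2 = 1, where m is
  nonzero. The element studied is \<open>fc cf\<close>; b provides the Peirce-2 projection and m the
  weights.\<close>

locale cut_off = local_derivation tp x B R \<delta>
  for tp :: "'z::complex_banach \<Rightarrow> 'z \<Rightarrow> 'z \<Rightarrow> 'z" and x B R \<delta> +
  fixes b m f :: "real \<Rightarrow> real"
  assumes b: "continuous_on {0..R} b" and m: "continuous_on {0..R} m" and f: "continuous_on {0..R} f"
    and bm: "\<And>t. \<lbrakk>0 \<le> t; t \<le> R; m t \<noteq> 0\<rbrakk> \<Longrightarrow> t * (b t)\<^sup>2 = 1"
    and mf: "\<And>t. \<lbrakk>0 \<le> t; t \<le> R; f t \<noteq> 0\<rbrakk> \<Longrightarrow> t * m t = 1"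
begin

abbreviation cb :: "real \<Rightarrow> complex" where "cb \<equiv> \<lambda>t. complex_of_real (b t)"
abbreviation cm :: "real \<Rightarrow> complex" where "cm \<equiv> \<lambda>t. complex_of_real (m t)"
abbreviation cf :: "real \<Rightarrow> complex" where "cf \<equiv> \<lambda>t. complex_of_real (f t)"

lemma cts_cut [simp]: "cts cb" "cts cm" "cts cf"
  by (intro continuous_intros b m f)+

text \<open>The complement of a Peirce-2 projection.\<close>

definition P :: "'z \<Rightarrow> 'z"
  where "P z = z - Qo cb cb (Qo cb cb z)"

lemma P_lin: "P (z + w) = P z + P w" "P (z - w) = P z - P w" "P (c *\<^sub>C z) = c *\<^sub>C P z" "P 0 = 0"
  "P (c' *\<^sub>R z) = c' *\<^sub>R P z"
proof -
  show "P (c *\<^sub>C z) = c *\<^sub>C P z" for c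
    by (simp add: P_def Qo_antilin scaleC.scale_right_diff_distrib)
  from this[of "complex_of_real c'"] show "P (c' *\<^sub>R z) = c' *\<^sub>R P z" by (simp add: scaleC_of_real)
qed (simp_all add: P_def Qo_antilin)

lemma P_Lo: "cts p \<Longrightarrow> P (Lo p z) = Lo p (P z)"
proof -
  assume p: "cts p"
  then have "cts (\<lambda>t. cnj (p t))" by (intro continuous_intros)
  then show ?thesis
    using Lo_Qo_commute[OF p cts_cut(1) cts_cut(1)]
      Lo_Qo_commute[of "\<lambda>t. cnj (p t)", OF _ cts_cut(1) cts_cut(1)]
    by (simp add: P_def Lo_lin)
qed

text \<open>By \<open>Qo_Qo\<close>, Q(b)^2 = 2 Lo(b^2)^2 - Lo(t b^4). Both p = b^2 and p = t b^4
  satisfy t p = 1 where m is nonzero, so Q(b)^2 w = 2w - w.\<close>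

lemma P_zero:
  assumes "\<And>p. cts p \<Longrightarrow> (\<And>t. \<lbrakk>0 \<le> t; t \<le> R; m t \<noteq> 0\<rbrakk> \<Longrightarrow> complex_of_real t * p t = 1) \<Longrightarrow> Lo p w = w"
  shows "P w = 0"
proof -
  have c: "cts (\<lambda>t. cb t * cnj (cb t))" "cts (\<lambda>t. complex_of_real t * cb t * cb t * cnj (cb t) * cnj (cb t))"
    by (intro continuous_intros b)+
  have 1: "Lo (\<lambda>t. cb t * cnj (cb t)) w = w"
  proof (rule assms[OF c(1)])
    fix t assume "0 \<le> t" "t \<le> R" "m t \<noteq> 0"
    from arg_cong[OF bm[OF this], of complex_of_real]
    show "complex_of_real t * (cb t * cnj (cb t)) = 1" by (simp add: power2_eq_square)
  qed
  have 2: "Lo (\<lambda>t. complex_of_real t * cb t * cb t * cnj (cb t) * cnj (cb t)) w = w"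
  proof (rule assms[OF c(2)])
    fix t assume "0 \<le> t" "t \<le> R" "m t \<noteq> 0"
    from bm[OF this] have "t * (t * b t * b t * b t * b t) = (1::real)"
    proof -
      have "t * (t * b t * b t * b t * b t) = (t * (b t)\<^sup>2) * (t * (b t)\<^sup>2)"
        by (simp add: power2_eq_square)
      then show ?thesis by (simp add: \<open>t * (b t)\<^sup>2 = 1\<close>)
    qed
    from arg_cong[OF this, of complex_of_real]
    show "complex_of_real t * (complex_of_real t * cb t * cb t * cnj (cb t) * cnj (cb t)) = 1" by simp
  qed
  show ?thesis
    unfolding P_def Qo_Qo[OF cts_cut(1) cts_cut(1) cts_cut(1) cts_cut(1)] 1 2 by simp
qed

text \<open>Heuristically, disjoint g and k leave only Peirce spaces with one end in each support,
  and these belong to the Peirce-2 part of b. In \<open>Lo_Lo_Lo\<close> the terms with g k vanish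
  and the others reproduce \<open>Lo g (Lo k z)\<close>.\<close>

lemma P_Lo_Lo:
  assumes g: "cts g" and k: "cts k" and gk: "\<And>t. 0 \<le> t \<Longrightarrow> t \<le> R \<Longrightarrow> g t * k t = 0"
    and gm: "\<And>t. \<lbrakk>0 \<le> t; t \<le> R; g t \<noteq> 0\<rbrakk> \<Longrightarrow> m t \<noteq> 0" and km: "\<And>t. \<lbrakk>0 \<le> t; t \<le> R; k t \<noteq> 0\<rbrakk> \<Longrightarrow> m t \<noteq> 0"
  shows "P (Lo g (Lo k z)) = 0"
proof (rule P_zero)
  fix p assume p: "cts p" "\<And>t. \<lbrakk>0 \<le> t; t \<le> R; m t \<noteq> 0\<rbrakk> \<Longrightarrow> complex_of_real t * p t = 1"
  have "Lo (\<lambda>t. complex_of_real t * p t * g t) y = Lo g y" "Lo (\<lambda>t. complex_of_real t * p t * k t) y = Lo k y" for y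
    by (rule Lo_cong, use p(2) gm km in force)+
  moreover have "Lo (\<lambda>t. complex_of_real t * g t * k t) y = 0"
    "Lo (\<lambda>t. complex_of_real t * complex_of_real t * p t * g t * k t) y = 0" for y
    by (rule Lo_zero, use gk in \<open>force simp: mult.assoc\<close>)+
  ultimately have "2 *\<^sub>R Lo p (Lo g (Lo k z)) = 2 *\<^sub>R Lo g (Lo k z)"
    unfolding Lo_Lo_Lo[OF p(1) g k] by (simp add: Lo_commute[OF k g] scaleR_2)
  then show "Lo p (Lo g (Lo k z)) = Lo g (Lo k z)" by simp
qed

text \<open>Between a value with t m = 1 and one outside the support of m, 2 Lo m is the identity.
  Peirce spaces with both ends in that support are removed by P.\<close>

lemma P_m_Lo:
  assumes k: "cts k" and kf: "\<And>t. \<lbrakk>0 \<le> t; t \<le> R; k t \<noteq> 0\<rbrakk> \<Longrightarrow> f t \<noteq> 0"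
  shows "P (2 *\<^sub>R Lo cm (Lo k z) - Lo k z) = 0"
proof (rule P_zero)
  fix p assume p: "cts p" "\<And>t. \<lbrakk>0 \<le> t; t \<le> R; m t \<noteq> 0\<rbrakk> \<Longrightarrow> complex_of_real t * p t = 1"
  have tm: "complex_of_real t * cm t = 1" "m t \<noteq> 0" if "0 \<le> t" "t \<le> R" "k t \<noteq> 0" for t
  proof -
    have "t * m t = 1" using mf[of t] kf[of t] that by simp
    then show "complex_of_real t * cm t = 1" "m t \<noteq> 0"
      unfolding of_real_mult[symmetric] by auto
  qed
  have 1: "Lo (\<lambda>t. complex_of_real t * p t * cm t) y = Lo cm y" for y
    by (rule Lo_cong) (use p(2) in force)
  have 2: "Lo (\<lambda>t. complex_of_real t * p t * k t) y = Lo k y" for y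
    by (rule Lo_cong) (use p(2) tm in force)
  have 3: "Lo (\<lambda>t. complex_of_real t * cm t * k t) y = Lo k y" for y
    by (rule Lo_cong) (use tm in force)
  have 4: "Lo (\<lambda>t. complex_of_real t * complex_of_real t * p t * cm t * k t) y = Lo k y" for y
  proof (rule Lo_cong)
    fix t assume t: "0 \<le> t" "t \<le> R"
    show "complex_of_real t * complex_of_real t * p t * cm t * k t = k t"
    proof (cases "k t = 0")
      case False
      have "complex_of_real t * complex_of_real t * p t * cm t * k t
          = (complex_of_real t * p t) * (complex_of_real t * cm t) * k t" by simp
      then show ?thesis using p(2)[OF t tm(2)[OF t False]] tm(1)[OF t False] by simp
    qed simp
  qed
  have "2 *\<^sub>R Lo p (Lo cm (Lo k z)) = Lo cm (Lo k z) + Lo k (Lo cm z) + Lo k (Lo p z) - Lo k z"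
    unfolding Lo_Lo_Lo[OF p(1) cts_cut(2) k] 1 2 3 4 ..
  then have "2 *\<^sub>R Lo p (Lo cm (Lo k z)) = 2 *\<^sub>R Lo cm (Lo k z) + Lo p (Lo k z) - Lo k z"
    by (simp add: Lo_commute[OF k cts_cut(2)] Lo_commute[OF k p(1)] scaleR_2)
  moreover have "Lo p (2 *\<^sub>R Lo cm (Lo k z) - Lo k z) = 2 *\<^sub>R Lo p (Lo cm (Lo k z)) - Lo p (Lo k z)"
    by (simp add: Lo_lin scaleR_2)
  ultimately show "Lo p (2 *\<^sub>R Lo cm (Lo k z) - Lo k z) = 2 *\<^sub>R Lo cm (Lo k z) - Lo k z"
    by simp
qed

lemma P_Qo:
  assumes k: "cts k" and km: "\<And>t. \<lbrakk>0 \<le> t; t \<le> R; k t \<noteq> 0\<rbrakk> \<Longrightarrow> m t \<noteq> 0"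
  shows "P (Qo k k z) = 0"
proof (rule P_zero)
  fix p assume p: "cts p" "\<And>t. \<lbrakk>0 \<le> t; t \<le> R; m t \<noteq> 0\<rbrakk> \<Longrightarrow> complex_of_real t * p t = 1"
  have eq: "complex_of_real t * p t * k t = k t" if "0 \<le> t" "t \<le> R" for t
    using p(2)[OF that] km[OF that] by (cases "k t = 0") auto
  have "2 *\<^sub>R Lo p (Qo k k z) = 2 *\<^sub>R Qo k k z"
    unfolding Lo_Qo[OF p(1) k k] unfolding scaleR_2 by (intro arg_cong2[of _ _ _ _ plus] Qo_cong eq refl)
  then show "Lo p (Qo k k z) = Qo k k z" by simp
qed

lemma Lo_Qo_disjoint:
  assumes g: "cts g" and k: "cts k" and gk: "\<And>t. 0 \<le> t \<Longrightarrow> t \<le> R \<Longrightarrow> g t * k t = 0"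
  shows "Lo g (Qo k k z) = 0"
proof -
  have "complex_of_real t * g t * k t = 0" if "0 \<le> t" "t \<le> R" for t
    using gk[OF that] by simp
  then have "2 *\<^sub>R Lo g (Qo k k z) = 0"
    unfolding Lo_Qo[OF g k k] using Qo_zero[of "\<lambda>t. complex_of_real t * g t * k t" k z]
      Qo_zero(2)[of "\<lambda>t. complex_of_real t * g t * k t" k z] by simp
  then show ?thesis by simp
qed

text \<open>The weight m cancels the factor t of the calculus wherever f is nonzero.\<close>

definition form :: "(real \<Rightarrow> real) \<Rightarrow> (real \<Rightarrow> real) \<Rightarrow> 'z"
  where "form g h = Lo (\<lambda>t. complex_of_real (m t * g t)) (P (\<delta> (fc (\<lambda>t. complex_of_real (f t * h t)))))"

lemma form_zero_product:
  assumes g: "continuous_on {0..R} g" and h: "continuous_on {0..R} h"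
    and gh: "\<And>t. t \<in> {0..R} \<Longrightarrow> g t * h t = 0"
  shows "form g h = 0"
proof -
  \<comment> \<open>Chosen so that t k^3 = t m f h = f h: f h becomes the symbol of a cube whose
    root k vanishes wherever f or h does.\<close>
  define k where "k t = root 3 (f t * h t * m t)" for t
  let ?k = "\<lambda>t. complex_of_real (k t)" and ?g = "\<lambda>t. complex_of_real (m t * g t)"
  have ck: "cts ?k" "cts ?g" "cts (\<lambda>t. ?k t * cnj (?k t))"
    unfolding k_def by (intro continuous_intros f h m g)+
  have cube: "t * k t * k t * k t = f t * h t" if "0 \<le> t" "t \<le> R" for t
  proof -
    have "k t * k t * k t = f t * h t * m t"
      using odd_real_root_pow[of 3 "f t * h t * m t"] by (simp add: k_def power3_eq_cube)
    then have "t * k t * k t * k t = (t * m t) * (f t * h t)"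
      by (metis mult.assoc mult.commute)
    then show ?thesis using mf[OF that] by (cases "f t = 0") simp_all
  qed
  have k0: "k t = 0" if "f t = 0 \<or> h t = 0" for t
    using that by (auto simp: k_def)
  have "fc (\<lambda>t. complex_of_real (f t * h t)) = fc (\<lambda>t. complex_of_real t * ?k t * cnj (?k t) * ?k t)"
    by (rule fc_cong) (simp add: cube[symmetric])
  also have "\<dots> = tp (fc ?k) (fc ?k) (fc ?k)" by (rule fc_triple[OF ck(1) ck(1) ck(1), symmetric])
  finally obtain w where w: "\<delta> (fc (\<lambda>t. complex_of_real (f t * h t)))
      = 2 *\<^sub>R Lo (\<lambda>t. ?k t * cnj (?k t)) w + Qo ?k ?k w"
    using \<delta>_cube[OF ck(1)] by auto
  have disj: "m t * g t * k t = 0" if "0 \<le> t" "t \<le> R" for t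
    using gh[of t] that k0[of t] by auto
  have mt: "m t \<noteq> 0" if "0 \<le> t" "t \<le> R" "k t \<noteq> 0" for t
  proof -
    have "f t \<noteq> 0" using k0[of t] that(3) by blast
    from mf[OF that(1,2) this] show ?thesis by auto
  qed
  have "P (Lo ?g (Lo (\<lambda>t. ?k t * cnj (?k t)) w)) = 0"
  proof (rule P_Lo_Lo[OF ck(2,3)])
    fix t assume "0 \<le> t" "t \<le> R"
    from disj[OF this] show "?g t * (?k t * cnj (?k t)) = 0" by auto
  qed (use mt in auto)
  moreover have "Lo ?g (Qo ?k ?k w) = 0"
  proof (rule Lo_Qo_disjoint[OF ck(2,1)])
    fix t assume "0 \<le> t" "t \<le> R"
    from disj[OF this] show "?g t * ?k t = 0" by auto
  qed
  ultimately show ?thesis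
    unfolding form_def w P_Lo[OF ck(2), symmetric]
    by (simp add: Lo_lin P_lin scaleR_2)
qed

lemma P_bounded: "\<exists>K\<ge>0. \<forall>z. norm (P z) \<le> K * norm z"
proof -
  define c where "c = B * norm (fc cb) * norm (fc cb)"
  have c: "c \<ge> 0" using B by (simp add: c_def)
  have Q: "norm (Qo cb cb z) \<le> c * norm z" for z
    using tp_norm[of "fc cb" z "fc cb"] by (simp add: Qo_def c_def mult_ac)
  have "norm (P z) \<le> (1 + c * c) * norm z" for z
  proof -
    have "norm (P z) \<le> norm z + norm (Qo cb cb (Qo cb cb z))"
      unfolding P_def by (rule norm_triangle_ineq4)
    also have "norm (Qo cb cb (Qo cb cb z)) \<le> c * (c * norm z)"
      by (rule order_trans[OF Q mult_left_mono[OF Q c]])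
    finally show ?thesis by (simp add: algebra_simps)
  qed
  then show ?thesis using c by (intro exI[of _ "1 + c * c"]) simp
qed

lemma form_bounded:
  "\<exists>C. \<forall>g h. continuous_on {0..R} g \<longrightarrow> continuous_on {0..R} h \<longrightarrow>
    (\<forall>t\<in>{0..R}. \<bar>g t\<bar> \<le> 1) \<longrightarrow> (\<forall>t\<in>{0..R}. \<bar>h t\<bar> \<le> 1) \<longrightarrow> norm (form g h) \<le> C"
proof -
  obtain K1 where K1: "K1 \<ge> 0" "\<And>z. norm (P z) \<le> K1 * norm z" using P_bounded by blast
  obtain K2 where K2: "K2 \<ge> 0" "\<And>z. norm (\<delta> z) \<le> K2 * norm z" using \<delta>_bounded by blast
  obtain M1 where M1: "\<And>t. t \<in> {0..R} \<Longrightarrow> \<bar>m t\<bar> \<le> M1"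
    using continuous_on_Icc_bounded[OF m] unfolding real_norm_def by blast
  obtain M2 where M2: "\<And>t. t \<in> {0..R} \<Longrightarrow> \<bar>f t\<bar> \<le> M2"
    using continuous_on_Icc_bounded[OF f] unfolding real_norm_def by blast
  have pos: "0 \<le> M1" "0 \<le> M2"
    using order_trans[OF abs_ge_zero M1[of 0]] order_trans[OF abs_ge_zero M2[of 0]] R by simp_all
  have le: "norm (fc (\<lambda>t. complex_of_real (u t * g t))) \<le> M * sqrt R"
    if "continuous_on {0..R} u" "continuous_on {0..R} g" "\<And>t. t \<in> {0..R} \<Longrightarrow> \<bar>g t\<bar> \<le> 1"
      "\<And>t. t \<in> {0..R} \<Longrightarrow> \<bar>u t\<bar> \<le> M" "0 \<le> M" for u g M
  proof (rule norm_fc_le)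
    show "cts (\<lambda>t. complex_of_real (u t * g t))" by (intro continuous_intros that)
    fix t assume t: "0 \<le> t" "t \<le> R"
    have "\<bar>u t\<bar> * \<bar>g t\<bar> \<le> M * 1" using t by (intro mult_mono that) auto
    then show "cmod (complex_of_real (u t * g t)) \<le> M" by (simp add: abs_mult norm_mult)
  qed
  have "norm (form g h) \<le> B * (M1 * sqrt R) * norm x * (K1 * (K2 * (M2 * sqrt R)))"
    if "continuous_on {0..R} g" "continuous_on {0..R} h"
      "\<forall>t\<in>{0..R}. \<bar>g t\<bar> \<le> 1" "\<forall>t\<in>{0..R}. \<bar>h t\<bar> \<le> 1" for g h
  proof -
    let ?u = "fc (\<lambda>t. complex_of_real (m t * g t))" and ?v = "fc (\<lambda>t. complex_of_real (f t * h t))"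
    have u: "norm ?u \<le> M1 * sqrt R" using that by (intro le m M1 pos) auto
    have v: "norm ?v \<le> M2 * sqrt R" using that by (intro le f M2 pos) auto
    have "norm (\<delta> ?v) \<le> K2 * (M2 * sqrt R)"
      using order_trans[OF K2(2) mult_left_mono[OF v K2(1)]] .
    then have Pv: "norm (P (\<delta> ?v)) \<le> K1 * (K2 * (M2 * sqrt R))"
      using order_trans[OF K1(2) mult_left_mono[OF _ K1(1)]] by blast
    have "norm (form g h) \<le> B * norm ?u * norm x * norm (P (\<delta> ?v))"
      unfolding form_def Lo_def by (rule tp_norm)
    also have "\<dots> \<le> B * (M1 * sqrt R) * norm x * (K1 * (K2 * (M2 * sqrt R)))"
      using B R pos by (intro mult_mono mult_left_mono mult_right_mono u Pv) auto
    finally show ?thesis .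
  qed
  then show ?thesis by blast
qed

lemma Lo_scaleR: "Lo g (r *\<^sub>R z) = r *\<^sub>R Lo g z"
  using Lo_lin(3)[of g "complex_of_real r" z] by (simp add: scaleC_of_real)

lemma Lo_add_fun: "cts g \<Longrightarrow> cts h \<Longrightarrow> Lo (\<lambda>t. g t + h t) z = Lo g z + Lo h z"
  by (simp add: Lo_def fc_add tp_add)

lemma form_symmetric:
  assumes "continuous_on {0..R} g" "\<And>t. t \<in> {0..R} \<Longrightarrow> 0 \<le> g t" "\<And>t. t \<in> {0..R} \<Longrightarrow> g t \<le> 1"
  shows "form g (\<lambda>t. 1) = form (\<lambda>t. 1) g"
proof -
  obtain C where C: "\<forall>g h. continuous_on {0..R} g \<longrightarrow> continuous_on {0..R} h \<longrightarrow>
    (\<forall>t\<in>{0..R}. \<bar>g t\<bar> \<le> 1) \<longrightarrow> (\<forall>t\<in>{0..R}. \<bar>h t\<bar> \<le> 1) \<longrightarrow> norm (form g h) \<le> C"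
    using form_bounded by (rule exE)
  interpret form: zero_product_map "{0..R}" form C
  proof
    fix g g' h :: "real \<Rightarrow> real"
    assume c: "continuous_on {0..R} g" "continuous_on {0..R} g'" "continuous_on {0..R} h"
    have mc: "cts (\<lambda>t. complex_of_real (m t * g t))" "cts (\<lambda>t. complex_of_real (m t * g' t))"
      by (intro continuous_intros c m)+
    show "form (\<lambda>t. g t + g' t) h = form g h + form g' h"
      using Lo_add_fun[OF mc] by (simp add: form_def distrib_left)
  next
    fix g h h' :: "real \<Rightarrow> real"
    assume c: "continuous_on {0..R} g" "continuous_on {0..R} h" "continuous_on {0..R} h'"
    have fc: "cts (\<lambda>t. complex_of_real (f t * h t))" "cts (\<lambda>t. complex_of_real (f t * h' t))"
      by (intro continuous_intros c f)+
    show "form g (\<lambda>t. h t + h' t) = form g h + form g h'"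
      using fc_add[OF fc] by (simp add: form_def distrib_left clinear_add[OF \<delta>_clinear] P_lin Lo_lin)
  next
    fix g h :: "real \<Rightarrow> real"
    assume c: "continuous_on {0..R} g" "continuous_on {0..R} h"
    show "form g h = 0" if "\<And>t. t \<in> {0..R} \<Longrightarrow> g t * h t = 0"
      using c that by (rule form_zero_product)
    show "norm (form g h) \<le> C" if "\<And>t. t \<in> {0..R} \<Longrightarrow> \<bar>g t\<bar> \<le> 1" "\<And>t. t \<in> {0..R} \<Longrightarrow> \<bar>h t\<bar> \<le> 1"
      by (rule C[rule_format]) (rule c that | assumption)+
  qed
  show ?thesis by (rule form.symmetric_one[OF assms])
qed

text \<open>Let y = {f,f,f}. The middle term Q(f) \<delta> f is killed by P, so the claim reads P
  \<delta> y = 2 D(f,f) P \<delta> f. Symmetry of \<open>form\<close> at g = t f^2 / N gives D(f,f)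
  P \<delta> f = Lo m P \<delta> y, and 2 Lo m fixes P \<delta> y because \<delta> y comes from a
  cube.\<close>

lemma P_defect_zero: "P (defect (fc cf) (fc cf) (fc cf)) = 0"
proof -
  let ?f2 = "\<lambda>t. cf t * cnj (cf t)" and ?y = "tp (fc cf) (fc cf) (fc cf)"
  have cf2: "cts ?f2" by (intro continuous_intros f)
  have f0: "m t \<noteq> 0" if "0 \<le> t" "t \<le> R" "cf t \<noteq> 0" for t
    using mf[of t] that by auto
  have "continuous_on {0..R} (\<lambda>t. t * (f t)\<^sup>2)" by (intro continuous_intros f)
  from continuous_on_Icc_bounded[OF this]
  obtain M where M: "\<And>t. t \<in> {0..R} \<Longrightarrow> \<bar>t * (f t)\<^sup>2\<bar> \<le> M"
    unfolding real_norm_def by blast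
  \<comment> \<open>Dividing by N brings g into [0,1]; the summand 1 makes N positive.\<close>
  define N where "N = M + 1"
  have "0 \<le> M" using order_trans[OF abs_ge_zero M[of 0]] R by simp
  then have N0: "N > 0" by (simp add: N_def)
  have N1: "t * (f t)\<^sup>2 \<le> N" if "t \<in> {0..R}" for t
    using abs_le_D1[OF M[OF that]] by (simp add: N_def)
  note N = N0 N1
  define g where "g t = t * (f t)\<^sup>2 / N" for t
  have "form g (\<lambda>t. 1) = form (\<lambda>t. 1) g"
    using N by (intro form_symmetric) (auto simp: g_def intro!: continuous_intros f)
  moreover have "N *\<^sub>R form g (\<lambda>t. 1) = Lo ?f2 (P (\<delta> (fc cf)))"
  proof -
    have c: "cts (\<lambda>t. complex_of_real (m t * g t))"
      unfolding g_def using N by (intro continuous_intros m f) auto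
    have "N *\<^sub>R Lo (\<lambda>t. complex_of_real (m t * g t)) z = Lo (\<lambda>t. complex_of_real N * complex_of_real (m t * g t)) z" for z
      unfolding Lo_def fc_scaleR[OF c] scaleC_of_real[symmetric] tp_scaleC ..
    also have "Lo (\<lambda>t. complex_of_real N * complex_of_real (m t * g t)) z = Lo ?f2 z" for z
    proof (rule Lo_cong)
      fix t assume "0 \<le> t" "t \<le> R"
      then have "N * (m t * g t) = f t * f t"
        using mf[of t] N(1) by (cases "f t = 0") (simp_all add: g_def power2_eq_square mult_ac)
      from arg_cong[OF this, of complex_of_real]
      show "complex_of_real N * complex_of_real (m t * g t) = ?f2 t" by simp
    qed
    finally show ?thesis by (simp add: form_def)
  qed
  moreover have "N *\<^sub>R form (\<lambda>t. 1) g = Lo cm (P (\<delta> ?y))"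
  proof -
    have c: "cts (\<lambda>t. complex_of_real (f t * g t))"
      unfolding g_def using N by (intro continuous_intros m f) auto
    have "?y = fc (\<lambda>t. complex_of_real t * cf t * cnj (cf t) * cf t)"
      by (rule fc_triple) (rule cts_cut)+
    also have "\<dots> = fc (\<lambda>t. complex_of_real N * complex_of_real (f t * g t))"
      by (rule fc_cong) (use N(1) in \<open>simp add: g_def power2_eq_square\<close>)
    also have "\<dots> = N *\<^sub>R fc (\<lambda>t. complex_of_real (f t * g t))" by (rule fc_scaleR[OF c])
    finally show ?thesis
      by (simp add: form_def clinear_scaleR[OF \<delta>_clinear] P_lin Lo_scaleR)
  qed
  ultimately have sym: "Lo ?f2 (P (\<delta> (fc cf))) = Lo cm (P (\<delta> ?y))" by simp
  obtain w where w: "\<delta> ?y = 2 *\<^sub>R Lo ?f2 w + Qo cf cf w" using \<delta>_cube[OF cts_cut(3)] by blast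
  have PQ: "P (Qo cf cf z) = 0" for z by (rule P_Qo[OF cts_cut(3) f0])
  have "P (2 *\<^sub>R Lo cm (Lo ?f2 w) - Lo ?f2 w) = 0" by (rule P_m_Lo[OF cf2]) auto
  then have half: "2 *\<^sub>R Lo cm (P (\<delta> ?y)) = P (\<delta> ?y)"
  proof -
    assume "P (2 *\<^sub>R Lo cm (Lo ?f2 w) - Lo ?f2 w) = 0"
    then have h: "2 *\<^sub>R Lo cm (P (Lo ?f2 w)) = P (Lo ?f2 w)"
      by (simp only: P_lin P_Lo[OF cts_cut(2)] right_minus_eq)
    have "P (\<delta> ?y) = 2 *\<^sub>R P (Lo ?f2 w)"
      by (simp only: w P_lin PQ add_0_right)
    then show ?thesis by (simp only: Lo_scaleR h)
  qed
  have box: "tp (\<delta> (fc cf)) (fc cf) (fc cf) = Lo ?f2 (\<delta> (fc cf))"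
    "tp (fc cf) (fc cf) (\<delta> (fc cf)) = Lo ?f2 (\<delta> (fc cf))"
    using fc_box_Lo[OF cts_cut(3) cts_cut(3)] outer_symmetric[of "\<delta> (fc cf)" "fc cf" "fc cf"] by simp_all
  have "P (defect (fc cf) (fc cf) (fc cf)) = 2 *\<^sub>R Lo ?f2 (P (\<delta> (fc cf))) - P (\<delta> ?y)"
    unfolding defect_def box Qo_def[of cf cf, symmetric]
    by (simp only: P_lin PQ P_Lo[OF cf2] scaleR_2 add_0_right)
  then show ?thesis by (simp only: sym half diff_self)
qed

end

section \<open>Joining the Peirce components and removing the cut-off\<close>

context local_derivation
begin

text \<open>Membership in the nullspace gives Q(b) of the defect equal to 0, so P fixes the defect;
  but P also annihilates it.\<close>

lemma defect_cut_off:
  assumes \<eta>: "\<eta> > 0"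
  defines "f \<equiv> \<lambda>t. complex_of_real (clip (t / \<eta> - 3))"
  shows "defect (fc f) (fc f) (fc f) = 0"
proof -
  let ?M = "\<lambda>t. max t \<eta>"
  \<comment> \<open>The shifts 1, 2, 3 nest the cut-offs: clip (t/\<eta> - j) vanishes up to j
    \<eta> and is 1 from (j+1) \<eta> on. Replacing t by max t \<eta> changes nothing where these
    are nonzero and avoids division by 0.\<close>
  define b where "b t = clip (t / \<eta> - 1) / sqrt (?M t)" for t
  define m where "m t = clip (t / \<eta> - 2) / ?M t" for t
  define k where "k t = clip (t / \<eta> - 3)" for t
  define e where "e t = complex_of_real (1 / sqrt (?M t))" for t
  define \<phi> where "\<phi> t = complex_of_real (k t * sqrt (?M t))" for t
  have M: "?M t > 0" "sqrt (?M t) \<noteq> 0" for t using \<eta> by auto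
  have c: "continuous_on {0..R} b" "continuous_on {0..R} m" "continuous_on {0..R} k" "cts e" "cts \<phi>"
    unfolding b_def m_def k_def e_def \<phi>_def using M \<eta>
    by (intro continuous_intros; force)+
  have bm: "t * (b t)\<^sup>2 = 1" if "m t \<noteq> 0" for t
  proof -
    have "t / \<eta> > 2" using that by (auto simp: m_def clip_def max_def min_def split: if_splits)
    then have "t > \<eta>" "t / \<eta> - 1 \<ge> 1" using \<eta> by (simp_all add: field_simps)
    then show ?thesis using \<eta> by (simp add: b_def clip_def power_divide)
  qed
  have mk: "t * m t = 1" if "k t \<noteq> 0" for t
  proof -
    have "t / \<eta> > 3" using that by (auto simp: k_def clip_def max_def min_def split: if_splits)
    then have "t > \<eta>" "t / \<eta> - 2 \<ge> 1" using \<eta> by (simp_all add: field_simps)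
    then show ?thesis using \<eta> by (simp add: m_def clip_def)
  qed
  interpret cut_off tp x B R \<delta> b m k
    by unfold_locales (use c bm mk in auto)
  have fe: "fc (\<lambda>t. \<phi> t * e t) = fc f"
  proof (rule fc_cong)
    fix t
    have "\<phi> t * e t = complex_of_real (k t * sqrt (?M t) * (1 / sqrt (?M t)))"
      unfolding \<phi>_def e_def by (rule of_real_mult[symmetric])
    also have "\<dots> = f t" using M(2)[of t] by (simp add: f_def k_def)
    finally show "\<phi> t * e t = f t" .
  qed
  have "plateau \<eta> e"
    unfolding plateau_def
  proof (intro conjI allI impI c)
    fix t assume t: "0 \<le> t" "t \<le> R" "\<eta> \<le> t"
    have "t * (1 / sqrt (?M t)) * (1 / sqrt (?M t)) = 1"
      using t \<eta> by (simp add: max_def)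
    from arg_cong[OF this, of complex_of_real]
    show "complex_of_real t * e t * cnj (e t) = 1"
      unfolding e_def complex_cnj_complex_of_real of_real_mult by simp
  qed
  from defect_plateau[OF this c(5,5,5)]
  have null: "defect (fc f) (fc f) (fc f) \<in> nullspace \<eta>" unfolding fe .
  have "supported \<eta> cb"
    unfolding supported_def
  proof (intro conjI allI impI cts_cut)
    fix t assume "t < \<eta>"
    then have "t / \<eta> - 1 \<le> 0" using \<eta> by (simp add: field_simps)
    then have "clip (t / \<eta> - 1) = 0" by (simp add: clip_def)
    then show "cb t = 0" by (simp add: b_def)
  qed
  from nullspaceD[OF null this this]
  have "P (defect (fc f) (fc f) (fc f)) = defect (fc f) (fc f) (fc f)"
    by (simp add: P_def Qo_antilin)
  moreover have "f = cf" by (simp add: f_def k_def fun_eq_iff)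
  ultimately show ?thesis using P_defect_zero by simp
qed

text \<open>The functions 1 - f_n do not tend to 0 uniformly, being 1 at t = 0. Passing to the cube
  of x - \<open>fc (f n)\<close> supplies a factor t, and t (1 - f_n)^3 is at most 4 \<eta>, since
  f_n = 1 from 4 \<eta> on.\<close>

theorem defect_self: "defect x x x = 0"
proof -
  define \<eta> where "\<eta> n = inverse (real (Suc n))" for n
  define f where "f n t = complex_of_real (clip (t / \<eta> n - 3))" for n t
  have \<eta>: "\<eta> n > 0" for n by (simp add: \<eta>_def)
  have cf: "cts (f n)" for n unfolding f_def using \<eta>[of n] by (intro continuous_intros) simp
  have le: "norm (x - fc (f n)) \<le> root 3 (4 * \<eta> n * sqrt R)" for n
  proof -
    let ?g = "\<lambda>t. 1 - f n t"
    have cg: "cts ?g" by (intro continuous_intros cf)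
    have g_eq: "?g t = complex_of_real (1 - clip (t / \<eta> n - 3))" for t by (simp add: f_def)
    have "norm (fc ?g) ^ 3 = norm (fc (\<lambda>t. complex_of_real t * ?g t * cnj (?g t) * ?g t))"
      by (simp only: norm_tp_cube[symmetric] fc_triple[OF cg cg cg])
    also have "\<dots> \<le> 4 * \<eta> n * sqrt R"
    proof (rule norm_fc_le)
      show "cts (\<lambda>t. complex_of_real t * ?g t * cnj (?g t) * ?g t)" by (intro continuous_intros cg)
      fix t assume t: "0 \<le> t" "t \<le> R"
      define u where "u = 1 - clip (t / \<eta> n - 3)"
      have u: "0 \<le> u" "u \<le> 1" using clip_bounds[of "t / \<eta> n - 3"] by (simp_all add: u_def)
      have "cmod (complex_of_real t * ?g t * cnj (?g t) * ?g t) = t * u * u * u"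
        unfolding g_eq u_def[symmetric] using t u by (simp add: norm_mult)
      also have "\<dots> \<le> 4 * \<eta> n"
      proof (cases "t \<le> 4 * \<eta> n")
        case True
        have "t * u * u * u \<le> t * 1 * 1 * 1" using t u by (intro mult_mono) auto
        with True show ?thesis by simp
      next
        case False
        then have "t / \<eta> n - 3 \<ge> 1" using \<eta>[of n] by (simp add: field_simps)
        then have "u = 0" by (simp add: u_def clip_def)
        then show ?thesis using \<eta>[of n] by simp
      qed
      finally show "cmod (complex_of_real t * ?g t * cnj (?g t) * ?g t) \<le> 4 * \<eta> n" .
    qed
    finally have "root 3 (norm (fc ?g) ^ 3) \<le> root 3 (4 * \<eta> n * sqrt R)" by simp
    moreover have "fc ?g = x - fc (f n)"
      using fc_diff[OF _ cf, of "\<lambda>t. 1" n] by (simp add: fc_one)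
    ultimately show ?thesis by (simp add: real_root_power_cancel)
  qed
  have "(\<lambda>n. root 3 (4 * \<eta> n * sqrt R)) \<longlonglongrightarrow> root 3 (4 * 0 * sqrt R)"
    unfolding \<eta>_def by (intro tendsto_real_root tendsto_mult tendsto_const LIMSEQ_inverse_real_of_nat)
  then have lim0: "(\<lambda>n. root 3 (4 * \<eta> n * sqrt R)) \<longlonglongrightarrow> 0" by simp
  have "(\<lambda>n. x - fc (f n)) \<longlonglongrightarrow> 0"
    by (rule Lim_null_comparison[OF always_eventually[OF allI[OF le]] lim0])
  from tendsto_diff[OF tendsto_const[of x] this] have "(\<lambda>n. fc (f n)) \<longlonglongrightarrow> x" by simp
  from tendsto_defect[OF this this this]
  have "(\<lambda>n. defect (fc (f n)) (fc (f n)) (fc (f n))) \<longlonglongrightarrow> defect x x x" .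
  moreover have "defect (fc (f n)) (fc (f n)) (fc (f n)) = 0" for n
    using defect_cut_off[OF \<eta>, of n] by (simp add: f_def[abs_def])
  ultimately show ?thesis by (simp add: LIMSEQ_const_iff)
qed

end

section \<open>Continuous local derivations on JB*-triples\<close>

lemma jordan_triple_bounded:
  fixes tp' :: "'w::complex_banach \<Rightarrow> 'w \<Rightarrow> 'w \<Rightarrow> 'w"
  assumes "jordan_triple tp'" and cont: "continuous_on UNIV (\<lambda>(a, b, c). tp' a b c)"
  shows "\<exists>B\<ge>0. \<forall>a b c. norm (tp' a b c) \<le> B * norm a * norm b * norm c"
proof -
  interpret T: jordan_triple tp' by (rule assms(1))
  have "isCont (\<lambda>(a, b, c). tp' a b c) (0, 0, 0)"
    using cont by (simp add: continuous_on_eq_continuous_at)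
  from this[unfolded continuous_at_eps_delta, rule_format, OF zero_less_one]
  obtain r where r: "r > 0" "\<And>p. dist p (0, 0, 0) < r \<Longrightarrow> dist (case p of (a, b, c) \<Rightarrow> tp' a b c) (tp' 0 0 0) < 1"
    unfolding prod.case by blast
  define s where "s = r / 4"
  have s: "s > 0" using r by (simp add: s_def)
  have small: "norm (tp' a b c) \<le> 1" if "norm a \<le> s" "norm b \<le> s" "norm c \<le> s" for a b c
  proof -
    have "norm (a, b, c) \<le> norm a + (norm b + norm c)"
      by (rule order_trans[OF norm_Pair_le add_left_mono[OF norm_Pair_le]])
    then have "dist (a, b, c) (0, 0, 0) < r"
      using that r(1) by (simp add: dist_norm s_def)
    from r(2)[OF this] show ?thesis by simp
  qed
  have "norm (tp' a b c) \<le> (1 / s ^ 3) * norm a * norm b * norm c" for a b c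
  proof (cases "a = 0 \<or> b = 0 \<or> c = 0")
    case False
    define u where "u z = complex_of_real (s / norm z)" for z :: 'w
    have n: "norm (u z *\<^sub>C z) \<le> s" if "z \<noteq> 0" for z using that s by (simp add: u_def norm_scaleC norm_divide)
    have "norm (tp' (u a *\<^sub>C a) (u b *\<^sub>C b) (u c *\<^sub>C c)) \<le> 1" using False by (intro small n) auto
    then have "(s / norm a) * ((s / norm b) * ((s / norm c) * norm (tp' a b c))) \<le> 1"
      using s by (simp add: T.tp_scaleC norm_scaleC u_def norm_divide norm_mult mult_ac)
    then show ?thesis using False s by (simp add: field_simps power3_eq_cube)
  qed auto
  then show ?thesis using s by (intro exI[of _ "1 / s ^ 3"]) simp
qed

theorem jb_triple_local_derivation:
  fixes tp :: "'z::complex_banach \<Rightarrow> 'z \<Rightarrow> 'z \<Rightarrow> 'z"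
  assumes jb: "jb_triple tp" and local: "local_triple_derivation tp \<delta>"
    and cont: "continuous_on UNIV \<delta>"
  shows "triple_derivation tp \<delta>"
proof -
  interpret jb_triple tp "\<lambda>a b z. tp a b z" using jb by simp
  define T where "T a b c = tp (\<delta> a) b c + tp a (\<delta> b) c + tp a b (\<delta> c) - \<delta> (tp a b c)" for a b c
  have lin: "clinear \<delta>" using local by (simp add: local_triple_derivation_def)
  obtain B where B: "B \<ge> 0" "\<And>a b c. norm (tp a b c) \<le> B * norm a * norm b * norm c"
    using jordan_triple_bounded[OF jordan_triple_axioms jointly_continuous] by blast
  have cube: "T x x x = 0" for x
  proof -
    \<comment> \<open>Every spectral value of D(x,x) is bounded by the operator bound B |x|^2; the
      summand 1 ensures 0 < R also for x = 0.\<close>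
    define R where "R = B * norm x * norm x + 1"
    have R: "0 < R" using B(1) by (simp add: R_def add_nonneg_pos)
    interpret local_derivation tp x B R \<delta>
    proof
      show "op_spectrum (tp x x) \<subseteq> complex_of_real ` {0..R}"
      proof
        fix c assume c: "c \<in> op_spectrum (tp x x)"
        then obtain r where r: "c = complex_of_real r" "0 \<le> r" using spectrum_nonneg[of x] by auto
        have "r \<le> R"
        proof (rule ccontr)
          assume "\<not> r \<le> R"
          then have "B * norm x * norm x < cmod c" using r by (simp add: R_def)
          then have "c \<notin> op_spectrum (tp x x)"
            using B by (intro op_spectrum_bounded[OF linear_right, of x x "B * norm x * norm x"]) auto
          with c show False by simp
        qed
        with r show "c \<in> complex_of_real ` {0..R}" by auto
      qed
    qed (use B R norm_cube jointly_continuous local cont in auto)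
    show ?thesis using defect_self by (simp add: defect_def T_def)
  qed
  have add: "T (a + a') b c = T a b c + T a' b c" "T a (b + b') c = T a b c + T a b' c"
    "T a b (c + c') = T a b c + T a b c'" for a a' b b' c c'
    by (simp_all add: T_def tp_add clinear_simps[OF lin])
  have scale: "T (k *\<^sub>C a) b c = k *\<^sub>C T a b c" "T a (k *\<^sub>C b) c = cnj k *\<^sub>C T a b c"
    "T a b (k *\<^sub>C c) = k *\<^sub>C T a b c" for k a b c
    by (simp_all add: T_def tp_scaleC clinear_simps[OF lin] scaleC_add_right scaleC.scale_right_diff_distrib)
  have sym: "T a b c = T c b a" for a b c
    by (simp add: T_def outer_symmetric[of _ b] outer_symmetric[of _ "\<delta> b"])
  have mid: "T a b a = 0" for a b
  proof -
    define p where "p = 2 *\<^sub>R T b a a"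
    define q where "q = T a b a"
    define r where "r = T b a b"
    define s where "s = 2 *\<^sub>R T b b a"
    have ex: "c *\<^sub>C p + cnj c *\<^sub>C q + (c * c) *\<^sub>C r + (c * cnj c) *\<^sub>C s = 0" for c
    proof -
      have "T (a + c *\<^sub>C b) (a + c *\<^sub>C b) (a + c *\<^sub>C b)
          = c *\<^sub>C p + cnj c *\<^sub>C q + (c * c) *\<^sub>C r + (c * cnj c) *\<^sub>C s"
        by (simp only: add scale)
          (simp add: cube p_def q_def r_def s_def scaleR_2 scaleC_add_right scaleC_scaleC
            sym[of a a b] sym[of a b b] add_ac mult.commute)
      then show ?thesis by (simp only: cube)
    qed
    \<comment> \<open>The values 1 and -1 give p + q = 0, the values i and -i give p = q;
      antilinearity of the middle slot is what separates q from p.\<close>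
    have e1: "p + q + r + s = 0" using ex[of 1] by (simp add: scaleC_one)
    have e2: "- p - q + r + s = 0" using ex[of "-1"] by (simp add: scaleC_one)
    have e3: "\<i> *\<^sub>C p - \<i> *\<^sub>C q - r + s = 0" using ex[of \<i>] by (simp add: scaleC_one)
    have e4: "- (\<i> *\<^sub>C p) + \<i> *\<^sub>C q - r + s = 0" using ex[of "-\<i>"] by (simp add: scaleC_one)
    have "(p + q + r + s) - (- p - q + r + s) = 2 *\<^sub>R (p + q)" by (simp add: scaleR_2)
    then have pq: "p + q = 0" unfolding e1 e2 by simp
    have "(\<i> *\<^sub>C p - \<i> *\<^sub>C q - r + s) - (- (\<i> *\<^sub>C p) + \<i> *\<^sub>C q - r + s) = 2 *\<^sub>R (\<i> *\<^sub>C (p - q))"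
      by (simp add: scaleR_2 scaleC.scale_right_diff_distrib)
    then have "\<i> *\<^sub>C (p - q) = 0" unfolding e3 e4 by simp
    then have "p = q" by simp
    with pq have "2 *\<^sub>R q = 0" by (simp add: scaleR_2)
    then show ?thesis by (simp add: q_def)
  qed
  have "T a b c = 0" for a b c
  proof -
    have "T (a + c) b (a + c) = 2 *\<^sub>R T a b c"
      by (simp only: add) (simp add: mid sym[of c b a] scaleR_2)
    then have "2 *\<^sub>R T a b c = 0" by (simp only: mid)
    then show ?thesis by simp
  qed
  then have "\<delta> (tp a b c) = tp (\<delta> a) b c + tp a (\<delta> b) c + tp a b (\<delta> c)" for a b c
    unfolding T_def by (metis eq_iff_diff_eq_0)
  with lin show ?thesis by (simp add: triple_derivation_def)
qed

theorem theorem5p11: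
  fixes tp :: "'z::complex_banach \<Rightarrow> 'z \<Rightarrow> 'z \<Rightarrow> 'z"
    and \<delta> :: "'z \<Rightarrow> 'z"
  assumes "jbw_triple tp TYPE('x::complex_banach)"
    and "local_triple_derivation tp \<delta>"
    and "continuous_on UNIV \<delta>"
  shows "triple_derivation tp \<delta>"
  using assms jb_triple_local_derivation by (auto simp: jbw_triple_def)

end
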